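(* Let $R$ be a regular (Noetherian commutative) ring of prime characteristic $p>0$. Let $\mathfrak{a}$ and $I$ be non-zero proper ideals in $R$ with $\mathfrak{a}\subseteq\sqrt{I}$. Then $\mathcal{C}^I(\mathfrak{a}^{(\bullet)})$ exists, where $\mathfrak{a}^{(\bullet)}=\{\mathfrak{a}^{(i)}\}_{i\ge 0}$ is the symbolic power filtration of $\mathfrak{a}$.
   Context: The $i$-th symbolic power of $\mathfrak{a}$ is $\mathfrak{a}^{(i)}=\bigcap_{\mathfrak{p}\in\operatorname{Ass}(\mathfrak{a})}(\mathfrak{a}^iR_{\mathfrak{p}}\cap R)$, where $\operatorname{Ass}(\mathfrak{a})$ is the set of associated primes of $\mathfrak{a}$ (of $R/\mathfrak{a}$). $I^{[p^e]}$ is the ideal generated by all $f^{p^e}$, $f\in I$. For a filtration of ideals $\mathfrak{a}_\bullet=\{\mathfrak{a}_i\}_{i\ge 0}$ (i.e. $\mathfrak{a}_0=R$, $\mathfrak{a}_{i+1}\subseteq\mathfrak{a}_i$, $\mathfrak{a}_i\mathfrak{a}_j\subseteq\mathfrak{a}_{i+j}$) and $e\ge 0$ put $\nu_{\mathfrak{a}_\bullet}^I(p^e)=\sup\{r\in\mathbb{Z}_{\ge 0}:\mathfrak{a}_r\not\subseteq I^{[p^e]}\}$. If $\lim_{e\to\infty}\nu_{\mathfrak{a}_\bullet}^I(p^e)/p^e$ exists as a finite real number, it is denoted $\mathcal{C}^I(\mathfrak{a}_\bullet)$ and is said to exist. *)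

theory Defs
  imports "HOL-Algebra.Algebra" "HOL-Library.Extended_Real" "HOL-Library.Extended_Nat"
begin

section \<open>Localization\<close>

text \<open>
  The ring of fractions of \<open>R\<close> with denominators in a multiplicative set \<open>S\<close>: the fraction
  \<open>a / s\<close> is the class of the pair \<open>(a, s)\<close>. Since \<open>R\<close> may have zero divisors, equality of
  fractions is tested after multiplication by an element of \<open>S\<close>.
\<close>

definition frac_rel :: "('a, 'b) ring_scheme \<Rightarrow> 'a set \<Rightarrow> (('a \<times> 'a) \<times> ('a \<times> 'a)) set"
  where "frac_rel R S =
    {((a, s), (b, t)). a \<in> carrier R \<and> s \<in> S \<and> b \<in> carrier R \<and> t \<in> S \<and>
       (\<exists>u\<in>S. u \<otimes>\<^bsub>R\<^esub> (a \<otimes>\<^bsub>R\<^esub> t) = u \<otimes>\<^bsub>R\<^esub> (b \<otimes>\<^bsub>R\<^esub> s))}"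

definition fraction :: "('a, 'b) ring_scheme \<Rightarrow> 'a set \<Rightarrow> 'a \<Rightarrow> 'a \<Rightarrow> ('a \<times> 'a) set"
  where "fraction R S a s = frac_rel R S `` {(a, s)}"

definition localization :: "('a, 'b) ring_scheme \<Rightarrow> 'a set \<Rightarrow> ('a \<times> 'a) set ring"
  where "localization R S =
    \<lparr>carrier = (carrier R \<times> S) // frac_rel R S,
     monoid.mult = (\<lambda>U V. \<Union>x\<in>U. \<Union>y\<in>V. fraction R S (fst x \<otimes>\<^bsub>R\<^esub> fst y) (snd x \<otimes>\<^bsub>R\<^esub> snd y)),
     one = fraction R S \<one>\<^bsub>R\<^esub> \<one>\<^bsub>R\<^esub>,
     ring.zero = fraction R S \<zero>\<^bsub>R\<^esub> \<one>\<^bsub>R\<^esub>,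
     add = (\<lambda>U V. \<Union>x\<in>U. \<Union>y\<in>V.
       fraction R S ((fst x \<otimes>\<^bsub>R\<^esub> snd y) \<oplus>\<^bsub>R\<^esub> (fst y \<otimes>\<^bsub>R\<^esub> snd x)) (snd x \<otimes>\<^bsub>R\<^esub> snd y))\<rparr>"

definition localization_at :: "('a, 'b) ring_scheme \<Rightarrow> 'a set \<Rightarrow> ('a \<times> 'a) set ring"
  where "localization_at R P = localization R (carrier R - P)"

definition localization_map :: "('a, 'b) ring_scheme \<Rightarrow> 'a set \<Rightarrow> 'a \<Rightarrow> ('a \<times> 'a) set"
  where "localization_map R P x = fraction R (carrier R - P) x \<one>\<^bsub>R\<^esub>"

text \<open>The ideal \<open>J R\<^sub>P\<close> of the localization, and its contraction \<open>J R\<^sub>P \<inter> R\<close>.\<close>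

definition extended_ideal :: "('a, 'b) ring_scheme \<Rightarrow> 'a set \<Rightarrow> 'a set \<Rightarrow> ('a \<times> 'a) set set"
  where "extended_ideal R P J = Idl\<^bsub>localization_at R P\<^esub> (localization_map R P ` J)"

definition extension_contraction :: "('a, 'b) ring_scheme \<Rightarrow> 'a set \<Rightarrow> 'a set \<Rightarrow> 'a set"
  where "extension_contraction R P J =
    {x \<in> carrier R. localization_map R P x \<in> extended_ideal R P J}"


section \<open>Regular rings\<close>

definition krull_dim :: "('a, 'b) ring_scheme \<Rightarrow> enat"
  where "krull_dim R = Sup {enat n |n. \<exists>P :: nat \<Rightarrow> 'a set.
    (\<forall>i\<le>n. primeideal (P i) R) \<and> (\<forall>i<n. P i \<subset> P (Suc i))}"

text \<open>
  A Noetherian local ring is regular if its maximal ideal is generated by as many elements as the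
  Krull dimension.
\<close>

locale regular_local_ring = cring + noetherian_ring +
  assumes local: "\<exists>!M. maximalideal M R"
    and regular: "\<exists>M G. maximalideal M R \<and> finite G \<and> G \<subseteq> carrier R \<and> M = Idl G \<and>
      krull_dim R = enat (card G)"

locale regular_ring = cring + noetherian_ring +
  assumes regular_localizations: "primeideal P R \<Longrightarrow> regular_local_ring (localization_at R P)"

definition has_characteristic :: "('a, 'b) ring_scheme \<Rightarrow> nat \<Rightarrow> bool"
  where "has_characteristic R p \<longleftrightarrow> (\<forall>n::nat. [n] \<cdot>\<^bsub>R\<^esub> \<one>\<^bsub>R\<^esub> = \<zero>\<^bsub>R\<^esub> \<longleftrightarrow> p dvd n)"


section \<open>Radicals, associated primes and symbolic powers\<close>

definition ideal_radical :: "('a, 'b) ring_scheme \<Rightarrow> 'a set \<Rightarrow> 'a set"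
  where "ideal_radical R I = {x \<in> carrier R. \<exists>n::nat. x [^]\<^bsub>R\<^esub> n \<in> I}"

definition ideal_power :: "('a, 'b) ring_scheme \<Rightarrow> 'a set \<Rightarrow> nat \<Rightarrow> 'a set"
  where "ideal_power R I n = I [^]\<^bsub>ideals_set R\<^esub> n"

text \<open>
  The primes of \<open>R\<close> that are annihilators of an element \<open>y\<close> of the \<open>R\<close>-module \<open>R / J\<close>; an element
  \<open>r\<close> of \<open>R\<close> acts on this module as multiplication by its residue class.
\<close>

definition associated_primes :: "('a, 'b) ring_scheme \<Rightarrow> 'a set \<Rightarrow> 'a set set"
  where "associated_primes R J = {P. primeideal P R \<and>
    (\<exists>y\<in>carrier (R Quot J).
       P = {r \<in> carrier R. (J +>\<^bsub>R\<^esub> r) \<otimes>\<^bsub>R Quot J\<^esub> y = \<zero>\<^bsub>R Quot J\<^esub>})}"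

definition symbolic_power :: "('a, 'b) ring_scheme \<Rightarrow> 'a set \<Rightarrow> nat \<Rightarrow> 'a set"
  where "symbolic_power R J i = carrier R \<inter>
    (\<Inter>P\<in>associated_primes R J. extension_contraction R P (ideal_power R J i))"


section \<open>Thresholds of filtrations\<close>

definition ideal_filtration :: "('a, 'b) ring_scheme \<Rightarrow> (nat \<Rightarrow> 'a set) \<Rightarrow> bool"
  where "ideal_filtration R A \<longleftrightarrow> (\<forall>i. ideal (A i) R) \<and> A 0 = carrier R \<and>
    (\<forall>i. A (Suc i) \<subseteq> A i) \<and> (\<forall>i j. A i \<cdot>\<^bsub>R\<^esub> A j \<subseteq> A (i + j))"

definition frobenius_power :: "('a, 'b) ring_scheme \<Rightarrow> 'a set \<Rightarrow> nat \<Rightarrow> 'a set"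
  where "frobenius_power R I q = Idl\<^bsub>R\<^esub> {f [^]\<^bsub>R\<^esub> q |f. f \<in> I}"

text \<open>
  The supremum is taken in the extended naturals, so it may be infinite; a threshold is a finite
  real limit of the quotients.
\<close>

definition nu :: "('a, 'b) ring_scheme \<Rightarrow> 'a set \<Rightarrow> (nat \<Rightarrow> 'a set) \<Rightarrow> nat \<Rightarrow> enat"
  where "nu R I A q = Sup {enat r |r. \<not> A r \<subseteq> frobenius_power R I q}"

definition has_threshold ::
    "('a, 'b) ring_scheme \<Rightarrow> nat \<Rightarrow> 'a set \<Rightarrow> (nat \<Rightarrow> 'a set) \<Rightarrow> real \<Rightarrow> bool"
  where "has_threshold R p I A c \<longleftrightarrow>
    ((\<lambda>e. ereal_of_enat (nu R I A (p ^ e)) / ereal (real (p ^ e))) \<longlongrightarrow> ereal c) sequentially"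

definition threshold_exists ::
    "('a, 'b) ring_scheme \<Rightarrow> nat \<Rightarrow> 'a set \<Rightarrow> (nat \<Rightarrow> 'a set) \<Rightarrow> bool"
  where "threshold_exists R p I A \<longleftrightarrow> (\<exists>c. has_threshold R p I A c)"


section \<open>Symbolic powers form a filtration\<close>


locale mult_set = cring R for R (structure) +
  fixes S assumes S_sub: "S \<subseteq> carrier R" and S_one: "\<one> \<in> S"
    and S_mult: "\<And>s t. s \<in> S \<Longrightarrow> t \<in> S \<Longrightarrow> s \<otimes> t \<in> S"
begin

lemma S_carr[simp]: "s \<in> S \<Longrightarrow> s \<in> carrier R" using S_sub by auto

lemma frac_rel_iff: "((a,s),(b,t)) \<in> frac_rel R S \<longleftrightarrow> a \<in> carrier R \<and> s \<in> S \<and> b \<in> carrier R \<and> t \<in> S \<and> (\<exists>u\<in>S. u \<otimes> (a \<otimes> t) = u \<otimes> (b \<otimes> s))"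
  unfolding frac_rel_def by auto

lemma frac_rel_trans: assumes "((a,s),(b,t)) \<in> frac_rel R S" "((b,t),(c,w)) \<in> frac_rel R S"
  shows "((a,s),(c,w)) \<in> frac_rel R S"
proof -
  from assms obtain u v where c: "a \<in> carrier R" "b \<in> carrier R" "c \<in> carrier R" "s \<in> S" "t \<in> S" "w \<in> S" "u \<in> S" "v \<in> S"
    and 1: "u \<otimes> (a \<otimes> t) = u \<otimes> (b \<otimes> s)" and 2: "v \<otimes> (b \<otimes> w) = v \<otimes> (c \<otimes> t)"
    unfolding frac_rel_iff by blast
  have "(u \<otimes> v \<otimes> t) \<otimes> (a \<otimes> w) = (u \<otimes> (a \<otimes> t)) \<otimes> (v \<otimes> w)"
    using c by (simp add: m_ac)
  also have "\<dots> = (v \<otimes> (b \<otimes> w)) \<otimes> (u \<otimes> s)" unfolding 1 using c by (simp add: m_ac)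
  also have "\<dots> = (u \<otimes> v \<otimes> t) \<otimes> (c \<otimes> s)" unfolding 2 using c by (simp add: m_ac)
  finally show ?thesis unfolding frac_rel_iff using c S_mult by blast
qed

lemma frac_rel_equiv: "equiv (carrier R \<times> S) (frac_rel R S)"
proof (rule equivI)
  show "frac_rel R S \<subseteq> (carrier R \<times> S) \<times> (carrier R \<times> S)" unfolding frac_rel_def by auto
  show "refl_on (carrier R \<times> S) (frac_rel R S)"
    using S_one unfolding refl_on_def by (auto simp: frac_rel_iff)
  show "sym (frac_rel R S)" unfolding sym_def by (auto simp: frac_rel_iff) metis
  show "trans (frac_rel R S)" unfolding trans_def using frac_rel_trans by fast
qed

lemma fraction_eq_iff: assumes "a \<in> carrier R" "b \<in> carrier R" "s \<in> S" "t \<in> S"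
  shows "fraction R S a s = fraction R S b t \<longleftrightarrow> (\<exists>u\<in>S. u \<otimes> (a \<otimes> t) = u \<otimes> (b \<otimes> s))"
  unfolding fraction_def using assms eq_equiv_class_iff[OF frac_rel_equiv, of "(a,s)" "(b,t)"]
  by (simp add: frac_rel_iff)

lemma fraction_mem: "(b,t) \<in> fraction R S a s \<longleftrightarrow> a \<in> carrier R \<and> s \<in> S \<and> b \<in> carrier R \<and> t \<in> S \<and> fraction R S a s = fraction R S b t"
proof -
  have "(b,t) \<in> fraction R S a s \<longleftrightarrow> ((a,s),(b,t)) \<in> frac_rel R S" by (simp add: fraction_def)
  then show ?thesis unfolding frac_rel_iff using fraction_eq_iff[of a b s t] by blast
qed

lemma fraction_self: "a \<in> carrier R \<Longrightarrow> s \<in> S \<Longrightarrow> (a,s) \<in> fraction R S a s"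
  by (simp add: fraction_mem)

abbreviation "L \<equiv> localization R S"

lemma carrier_loc: "carrier L = {fraction R S a s |a s. a \<in> carrier R \<and> s \<in> S}"
  unfolding localization_def quotient_def fraction_def by auto

lemma fraction_carr: "a \<in> carrier R \<Longrightarrow> s \<in> S \<Longrightarrow> fraction R S a s \<in> carrier L"
  unfolding carrier_loc by auto

lemma loc_mult: assumes "a \<in> carrier R" "b \<in> carrier R" "s \<in> S" "t \<in> S"
  shows "fraction R S a s \<otimes>\<^bsub>L\<^esub> fraction R S b t = fraction R S (a \<otimes> b) (s \<otimes> t)"
proof -
  have *: "fraction R S (fst x \<otimes> fst y) (snd x \<otimes> snd y) = fraction R S (a \<otimes> b) (s \<otimes> t)"
    if "x \<in> fraction R S a s" "y \<in> fraction R S b t" for x y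
  proof -
    obtain a' s' b' t' where xy: "x = (a',s')" "y = (b',t')" by fastforce
    with that assms obtain u v where c: "a' \<in> carrier R" "b' \<in> carrier R" "s' \<in> S" "t' \<in> S" "u \<in> S" "v \<in> S"
      and 1: "u \<otimes> (a \<otimes> s') = u \<otimes> (a' \<otimes> s)" and 2: "v \<otimes> (b \<otimes> t') = v \<otimes> (b' \<otimes> t)"
      by (auto simp: fraction_mem fraction_eq_iff)
    have "(u \<otimes> v) \<otimes> ((a' \<otimes> b') \<otimes> (s \<otimes> t)) = (u \<otimes> (a' \<otimes> s)) \<otimes> (v \<otimes> (b' \<otimes> t))"
      using assms c by (simp add: m_ac)
    also have "\<dots> = (u \<otimes> v) \<otimes> ((a \<otimes> b) \<otimes> (s' \<otimes> t'))" unfolding 1[symmetric] 2[symmetric]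
      using assms c by (simp add: m_ac)
    finally show ?thesis using xy assms c S_mult
      by (simp add: fraction_eq_iff) (blast intro: S_mult)
  qed
  have "fraction R S a s \<otimes>\<^bsub>L\<^esub> fraction R S b t = (\<Union>x\<in>fraction R S a s. \<Union>y\<in>fraction R S b t. fraction R S (a \<otimes> b) (s \<otimes> t))"
    unfolding localization_def using * by simp
  also have "\<dots> = fraction R S (a \<otimes> b) (s \<otimes> t)"
    using fraction_self assms by blast
  finally show ?thesis .
qed

lemma loc_add: assumes "a \<in> carrier R" "b \<in> carrier R" "s \<in> S" "t \<in> S"
  shows "fraction R S a s \<oplus>\<^bsub>L\<^esub> fraction R S b t = fraction R S ((a \<otimes> t) \<oplus> (b \<otimes> s)) (s \<otimes> t)"
proof -
  have *: "fraction R S ((fst x \<otimes> snd y) \<oplus> (fst y \<otimes> snd x)) (snd x \<otimes> snd y) = fraction R S ((a \<otimes> t) \<oplus> (b \<otimes> s)) (s \<otimes> t)"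
    if "x \<in> fraction R S a s" "y \<in> fraction R S b t" for x y
  proof -
    obtain a' s' b' t' where xy: "x = (a',s')" "y = (b',t')" by fastforce
    with that assms obtain u v where c: "a' \<in> carrier R" "b' \<in> carrier R" "s' \<in> S" "t' \<in> S" "u \<in> S" "v \<in> S"
      and 1: "u \<otimes> (a \<otimes> s') = u \<otimes> (a' \<otimes> s)" and 2: "v \<otimes> (b \<otimes> t') = v \<otimes> (b' \<otimes> t)"
      by (auto simp: fraction_mem fraction_eq_iff)
    have "(u \<otimes> v) \<otimes> (((a' \<otimes> t') \<oplus> (b' \<otimes> s')) \<otimes> (s \<otimes> t)) = (u \<otimes> (a' \<otimes> s)) \<otimes> (v \<otimes> (t' \<otimes> t)) \<oplus> (v \<otimes> (b' \<otimes> t)) \<otimes> (u \<otimes> (s' \<otimes> s))"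
      using assms c by (simp add: m_ac r_distr l_distr)
    also have "\<dots> = (u \<otimes> v) \<otimes> (((a \<otimes> t) \<oplus> (b \<otimes> s)) \<otimes> (s' \<otimes> t'))" unfolding 1[symmetric] 2[symmetric]
      using assms c by (simp add: m_ac r_distr l_distr)
    finally show ?thesis using xy assms c S_mult
      by (simp add: fraction_eq_iff) (blast intro: S_mult)
  qed
  have "fraction R S a s \<oplus>\<^bsub>L\<^esub> fraction R S b t = (\<Union>x\<in>fraction R S a s. \<Union>y\<in>fraction R S b t. fraction R S ((a \<otimes> t) \<oplus> (b \<otimes> s)) (s \<otimes> t))"
    unfolding localization_def using * by simp
  also have "\<dots> = fraction R S ((a \<otimes> t) \<oplus> (b \<otimes> s)) (s \<otimes> t)"
    using fraction_self assms by blast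
  finally show ?thesis .
qed

lemma loc_one: "\<one>\<^bsub>L\<^esub> = fraction R S \<one> \<one>" and loc_zero: "\<zero>\<^bsub>L\<^esub> = fraction R S \<zero> \<one>"
  unfolding localization_def by auto

lemma feqI: assumes "a \<in> carrier R" "b \<in> carrier R" "s \<in> S" "t \<in> S" "a \<otimes> t = b \<otimes> s"
  shows "fraction R S a s = fraction R S b t"
  using assms S_one by (auto simp: fraction_eq_iff)

lemma locE: assumes "z \<in> carrier L" obtains a s where "z = fraction R S a s" "a \<in> carrier R" "s \<in> S"
  using assms by (auto simp: carrier_loc)

lemma localization_cring: "cring (localization R S)"
proof (rule cringI)
  show "abelian_group L"
  proof (rule abelian_groupI)
    fix x assume "x \<in> carrier L"
    then obtain a s where c: "x = fraction R S a s" "a \<in> carrier R" "s \<in> S" by (rule locE)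
    have "fraction R S (\<ominus> a) s \<oplus>\<^bsub>L\<^esub> x = \<zero>\<^bsub>L\<^esub>"
      using c S_one S_mult by (simp add: loc_add loc_zero l_minus r_neg l_neg) (rule feqI; simp)
    then show "\<exists>w\<in>carrier L. w \<oplus>\<^bsub>L\<^esub> x = \<zero>\<^bsub>L\<^esub>" using c fraction_carr by blast
    show "\<zero>\<^bsub>L\<^esub> \<oplus>\<^bsub>L\<^esub> x = x" using c S_one S_mult by (simp add: loc_add loc_zero)
  next
    show "\<zero>\<^bsub>L\<^esub> \<in> carrier L" by (simp add: loc_zero fraction_carr S_one)
  next
    fix x y assume "x \<in> carrier L" "y \<in> carrier L"
    then obtain a s b t where c: "x = fraction R S a s" "a \<in> carrier R" "s \<in> S"
      "y = fraction R S b t" "b \<in> carrier R" "t \<in> S" by (metis locE)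
    show "x \<oplus>\<^bsub>L\<^esub> y \<in> carrier L" using c S_mult by (simp add: loc_add fraction_carr)
    show "x \<oplus>\<^bsub>L\<^esub> y = y \<oplus>\<^bsub>L\<^esub> x" using c S_mult by (simp add: loc_add m_comm a_comm)
  next
    fix x y z assume "x \<in> carrier L" "y \<in> carrier L" "z \<in> carrier L"
    then obtain a s b t d u where c: "x = fraction R S a s" "a \<in> carrier R" "s \<in> S"
      "y = fraction R S b t" "b \<in> carrier R" "t \<in> S" "z = fraction R S d u" "d \<in> carrier R" "u \<in> S" by (metis locE)
    have "(a \<otimes> t \<oplus> b \<otimes> s) \<otimes> u \<oplus> d \<otimes> (s \<otimes> t) = a \<otimes> (t \<otimes> u) \<oplus> (b \<otimes> u \<oplus> d \<otimes> t) \<otimes> s"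
      using c by (simp add: l_distr r_distr m_ac a_ac)
    then show "x \<oplus>\<^bsub>L\<^esub> y \<oplus>\<^bsub>L\<^esub> z = x \<oplus>\<^bsub>L\<^esub> (y \<oplus>\<^bsub>L\<^esub> z)"
      using c S_mult by (simp add: loc_add m_assoc)
  qed
  show "comm_monoid L"
  proof (rule comm_monoidI)
    show "\<one>\<^bsub>L\<^esub> \<in> carrier L" by (simp add: loc_one fraction_carr S_one)
  next
    fix x y assume "x \<in> carrier L" "y \<in> carrier L"
    then obtain a s b t where c: "x = fraction R S a s" "a \<in> carrier R" "s \<in> S"
      "y = fraction R S b t" "b \<in> carrier R" "t \<in> S" by (metis locE)
    show "x \<otimes>\<^bsub>L\<^esub> y \<in> carrier L" using c S_mult by (simp add: loc_mult fraction_carr)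
    show "x \<otimes>\<^bsub>L\<^esub> y = y \<otimes>\<^bsub>L\<^esub> x" using c S_mult by (simp add: loc_mult m_comm)
    show "\<one>\<^bsub>L\<^esub> \<otimes>\<^bsub>L\<^esub> x = x" using c S_one by (simp add: loc_mult loc_one)
  next
    fix x y z assume "x \<in> carrier L" "y \<in> carrier L" "z \<in> carrier L"
    then obtain a s b t d u where c: "x = fraction R S a s" "a \<in> carrier R" "s \<in> S"
      "y = fraction R S b t" "b \<in> carrier R" "t \<in> S" "z = fraction R S d u" "d \<in> carrier R" "u \<in> S" by (metis locE)
    show "x \<otimes>\<^bsub>L\<^esub> y \<otimes>\<^bsub>L\<^esub> z = x \<otimes>\<^bsub>L\<^esub> (y \<otimes>\<^bsub>L\<^esub> z)"
      using c S_mult by (simp add: loc_mult m_ac)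
  qed
next
  fix x y z assume "x \<in> carrier L" "y \<in> carrier L" "z \<in> carrier L"
  then obtain a s b t d u where c: "x = fraction R S a s" "a \<in> carrier R" "s \<in> S"
    "y = fraction R S b t" "b \<in> carrier R" "t \<in> S" "z = fraction R S d u" "d \<in> carrier R" "u \<in> S" by (metis locE)
  have eq: "((a \<otimes> t \<oplus> b \<otimes> s) \<otimes> d) \<otimes> (s \<otimes> u \<otimes> (t \<otimes> u)) =
      (a \<otimes> d \<otimes> (t \<otimes> u) \<oplus> b \<otimes> d \<otimes> (s \<otimes> u)) \<otimes> (s \<otimes> t \<otimes> u)"
    proof -
    have "((a \<otimes> t \<oplus> b \<otimes> s) \<otimes> d) \<otimes> (s \<otimes> u \<otimes> (t \<otimes> u)) = ((a \<otimes> t \<oplus> b \<otimes> s) \<otimes> (d \<otimes> u)) \<otimes> (s \<otimes> t \<otimes> u)"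
      using c by (simp add: m_ac)
    also have "(a \<otimes> t \<oplus> b \<otimes> s) \<otimes> (d \<otimes> u) = a \<otimes> d \<otimes> (t \<otimes> u) \<oplus> b \<otimes> d \<otimes> (s \<otimes> u)"
      using c by (simp add: l_distr, simp add: m_ac)
    finally show ?thesis .
  qed
  have "fraction R S ((a \<otimes> t \<oplus> b \<otimes> s) \<otimes> d) (s \<otimes> t \<otimes> u) =
      fraction R S (a \<otimes> d \<otimes> (t \<otimes> u) \<oplus> b \<otimes> d \<otimes> (s \<otimes> u)) (s \<otimes> u \<otimes> (t \<otimes> u))"
    by (rule feqI[OF _ _ _ _ eq]) (simp_all add: c S_mult)
  then show "(x \<oplus>\<^bsub>L\<^esub> y) \<otimes>\<^bsub>L\<^esub> z = x \<otimes>\<^bsub>L\<^esub> z \<oplus>\<^bsub>L\<^esub> y \<otimes>\<^bsub>L\<^esub> z"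
    using c S_mult by (simp add: loc_mult loc_add)
qed

end

lemma (in primeideal) complement_mult_set: "mult_set R (carrier R - I)"
  apply unfold_locales
  using I_notcarr I_prime one_imp_carrier by auto

context cring begin

lemma ideal_power_0: "ideal_power R J 0 = carrier R"
  by (simp add: ideal_power_def nat_pow_def ideals_set_def)
lemma ideal_power_Suc: "ideal_power R J (Suc n) = ideal_power R J n \<cdot> J"
  by (simp add: ideal_power_def nat_pow_def ideals_set_def)
lemma ideal_power_ideal: "ideal J R \<Longrightarrow> ideal (ideal_power R J n) R"
  by (induction n) (auto simp: ideal_power_0 ideal_power_Suc oneideal ideal_prod_is_ideal)

lemma loc_at_cring: "primeideal P R \<Longrightarrow> cring (localization_at R P)"
  unfolding localization_at_def
  by (intro mult_set.localization_cring primeideal.complement_mult_set)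

lemma localization_map_ring_hom: assumes "primeideal P R"
  shows "localization_map R P \<in> ring_hom R (localization_at R P)"
proof -
  interpret m: mult_set R "carrier R - P" using primeideal.complement_mult_set[OF assms] .
  show ?thesis unfolding localization_at_def localization_map_def
    using m.S_one by (intro ring_hom_memI) (auto simp: m.fraction_carr m.loc_mult m.loc_add m.loc_one)
qed

lemma extension_contraction_eq: assumes P: "primeideal P R" and J: "ideal J R"
  shows "extension_contraction R P J = {x \<in> carrier R. \<exists>s \<in> carrier R - P. s \<otimes> x \<in> J}"
proof -
  define S where "S = carrier R - P"
  interpret m: mult_set R S unfolding S_def using primeideal.complement_mult_set[OF P] .
  interpret J: ideal J R by (rule J)
  interpret l: cring "localization R S" by (rule m.localization_cring)
  have phi: "localization_map R P = (\<lambda>x. fraction R S x \<one>)"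
    by (simp add: localization_map_def S_def fun_eq_iff)
  have ext: "extended_ideal R P J = Idl\<^bsub>localization R S\<^esub> ((\<lambda>x. fraction R S x \<one>) ` J)"
    unfolding extended_ideal_def phi localization_at_def S_def ..
  define K where "K = {fraction R S a s |a s. a \<in> J \<and> s \<in> S}"
  have KI: "fraction R S a s \<in> K" if "a \<in> J" "s \<in> S" for a s using that K_def by blast
  have img: "(\<lambda>x. fraction R S x \<one>) ` J \<subseteq> carrier (localization R S)"
    using m.S_one by (auto intro!: m.fraction_carr J.Icarr)
  have "ideal K (localization R S)"
  proof (rule idealI[OF l.ring_axioms])
    show "subgroup K (add_monoid (localization R S))"
    proof (rule l.add.subgroupI)
      show "K \<subseteq> carrier (localization R S)" by (auto simp: K_def intro!: m.fraction_carr J.Icarr)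
      show "K \<noteq> {}" using KI[OF J.zero_closed m.S_one] by blast
    next
      fix x assume "x \<in> K"
      then obtain a s where c: "x = fraction R S a s" "a \<in> J" "s \<in> S" by (auto simp: K_def)
      have "fraction R S (\<ominus> a) s \<oplus>\<^bsub>localization R S\<^esub> x = \<zero>\<^bsub>localization R S\<^esub>"
        using c m.S_one m.S_mult J.Icarr
        by (simp add: m.loc_add m.loc_zero l_minus r_neg l_neg) (rule m.feqI; simp)
      then have "\<ominus>\<^bsub>localization R S\<^esub> x = fraction R S (\<ominus> a) s"
        using c J.Icarr by (intro l.minus_equality) (auto intro!: m.fraction_carr)
      then show "\<ominus>\<^bsub>localization R S\<^esub> x \<in> K" using c by (simp add: KI)
    next
      fix x y assume "x \<in> K" "y \<in> K"
      then obtain a s b t where c: "x = fraction R S a s" "a \<in> J" "s \<in> S"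
        "y = fraction R S b t" "b \<in> J" "t \<in> S" by (auto simp: K_def)
      then show "x \<oplus>\<^bsub>localization R S\<^esub> y \<in> K"
        using m.S_mult J.I_r_closed J.Icarr by (simp add: m.loc_add KI)
    qed
  next
    fix a x assume "a \<in> K" "x \<in> carrier (localization R S)"
    then obtain b s d t where c: "a = fraction R S b s" "b \<in> J" "s \<in> S"
        "x = fraction R S d t" "d \<in> carrier R" "t \<in> S" unfolding K_def by (blast elim: m.locE)
    then show "x \<otimes>\<^bsub>localization R S\<^esub> a \<in> K" "a \<otimes>\<^bsub>localization R S\<^esub> x \<in> K"
      using m.S_mult J.I_r_closed J.I_l_closed J.Icarr by (simp_all add: m.loc_mult KI)
  qed
  moreover have "(\<lambda>x. fraction R S x \<one>) ` J \<subseteq> K" using KI m.S_one by blast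
  ultimately have 1: "extended_ideal R P J \<subseteq> K" unfolding ext by (rule l.genideal_minimal)
  interpret E: ideal "extended_ideal R P J" "localization R S"
    unfolding ext using l.genideal_ideal[OF img] .
  have 2: "localization_map R P a \<in> extended_ideal R P J" if "a \<in> J" for a
    using l.genideal_self[OF img] that unfolding ext phi by blast
  show ?thesis
  proof (intro subset_antisym subsetI)
    fix x assume "x \<in> extension_contraction R P J"
    then have x: "x \<in> carrier R" "fraction R S x \<one> \<in> K" using 1 unfolding extension_contraction_def phi by auto
    then obtain a s where "a \<in> J" "s \<in> S" "fraction R S x \<one> = fraction R S a s" unfolding K_def by blast
    then obtain u where "u \<in> S" "a \<in> J" "s \<in> S" "u \<otimes> (x \<otimes> s) = u \<otimes> (a \<otimes> \<one>)"
      using x m.S_one J.Icarr by (auto simp: m.fraction_eq_iff)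
    then have "u \<otimes> s \<otimes> x \<in> J" "u \<otimes> s \<in> S" using x m.S_mult J.Icarr J.I_l_closed by (auto simp: m_ac)
    then show "x \<in> {x \<in> carrier R. \<exists>s \<in> carrier R - P. s \<otimes> x \<in> J}" using x unfolding S_def by blast
  next
    fix x assume "x \<in> {x \<in> carrier R. \<exists>s \<in> carrier R - P. s \<otimes> x \<in> J}"
    then obtain s where x: "x \<in> carrier R" "s \<in> S" "s \<otimes> x \<in> J" unfolding S_def by blast
    have "fraction R S \<one> s \<otimes>\<^bsub>localization R S\<^esub> localization_map R P (s \<otimes> x) \<in> extended_ideal R P J"
      using x by (intro E.I_l_closed 2 m.fraction_carr) auto
    also have "fraction R S \<one> s \<otimes>\<^bsub>localization R S\<^esub> localization_map R P (s \<otimes> x) = fraction R S (s \<otimes> x) s"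
      using x m.S_one by (simp add: phi m.loc_mult)
    also have "\<dots> = localization_map R P x"
      using x m.S_one unfolding phi by (intro m.feqI) (auto simp: m_comm)
    finally show "x \<in> extension_contraction R P J" using x by (simp add: extension_contraction_def)
  qed
qed

lemma extension_contraction_ideal: assumes P: "primeideal P R" and J: "ideal J R"
  shows "ideal (extension_contraction R P J) R"
proof -
  interpret p: primeideal P R by (rule P)
  interpret J: ideal J R by (rule J)
  interpret m: mult_set R "carrier R - P" using p.complement_mult_set .
  define T where "T = extension_contraction R P J"
  have TI: "x \<in> T" if "x \<in> carrier R" "s \<in> carrier R - P" "s \<otimes> x \<in> J" for x s
    using that unfolding T_def extension_contraction_eq[OF assms] by blast
  have TE: "\<exists>s\<in>carrier R - P. x \<in> carrier R \<and> s \<otimes> x \<in> J" if "x \<in> T" for x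
    using that unfolding T_def extension_contraction_eq[OF assms] by blast
  have "ideal T R"
  proof (rule idealI[OF ring_axioms])
    show "subgroup T (add_monoid R)"
    proof (rule add.subgroupI)
      show "T \<subseteq> carrier R" using TE by blast
      have "\<zero> \<in> T" by (rule TI[OF _ m.S_one]) auto
      then show "T \<noteq> {}" by (metis empty_iff)
    next
      fix x assume "x \<in> T"
      then obtain s where c: "x \<in> carrier R" "s \<in> carrier R - P" "s \<otimes> x \<in> J" using TE by blast
      show "\<ominus> x \<in> T" by (rule TI[OF _ c(2)]) (use c in \<open>auto simp: r_minus\<close>)
    next
      fix x y assume "x \<in> T" "y \<in> T"
      then obtain s t where c: "x \<in> carrier R" "y \<in> carrier R" "s \<in> carrier R - P"
        "t \<in> carrier R - P" "s \<otimes> x \<in> J" "t \<otimes> y \<in> J" using TE by meson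
      have "(s \<otimes> t) \<otimes> (x \<oplus> y) = t \<otimes> (s \<otimes> x) \<oplus> s \<otimes> (t \<otimes> y)" using c by (simp add: r_distr m_ac)
      also have "\<dots> \<in> J" by (rule J.a_closed; rule J.I_l_closed) (use c in auto)
      finally show "x \<oplus> y \<in> T" using TI[OF a_closed[OF c(1,2)] m.S_mult[OF c(3,4)]] by blast
    qed
  next
    fix a x assume "a \<in> T" and x: "x \<in> carrier R"
    then obtain s where c: "a \<in> carrier R" "s \<in> carrier R - P" "s \<otimes> a \<in> J" using TE by blast
    have "s \<otimes> (x \<otimes> a) \<in> J" using J.I_l_closed[OF c(3) x] c x by (simp add: m_ac)
    then show "x \<otimes> a \<in> T" using TI[OF m_closed[OF x c(1)] c(2)] by blast
    then show "a \<otimes> x \<in> T" using c x by (simp add: m_comm)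
  qed
  then show ?thesis unfolding T_def .
qed

lemma associated_primes_prime: "P \<in> associated_primes R J \<Longrightarrow> primeideal P R"
  by (simp add: associated_primes_def)

lemma symbolic_power_mem: assumes "ideal J R" shows "x \<in> symbolic_power R J i \<longleftrightarrow> x \<in> carrier R \<and>
   (\<forall>P\<in>associated_primes R J. \<exists>s\<in>carrier R - P. s \<otimes> x \<in> ideal_power R J i)"
proof -
  have "extension_contraction R P (ideal_power R J i) =
      {x \<in> carrier R. \<exists>s \<in> carrier R - P. s \<otimes> x \<in> ideal_power R J i}"
    if "P \<in> associated_primes R J" for P
    by (rule extension_contraction_eq[OF associated_primes_prime[OF that] ideal_power_ideal[OF assms]])
  then show ?thesis unfolding symbolic_power_def by auto
qed

lemma symbolic_power_ideal: assumes "ideal J R" shows "ideal (symbolic_power R J i) R"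
proof -
  have "symbolic_power R J i = \<Inter>(insert (carrier R) ((\<lambda>P. extension_contraction R P (ideal_power R J i)) ` associated_primes R J))"
    unfolding symbolic_power_def by auto
  also have "ideal \<dots> R"
    using extension_contraction_ideal[OF _ ideal_power_ideal[OF assms]] oneideal
    by (intro i_Intersect) (auto simp: associated_primes_def)
  finally show ?thesis .
qed

lemma ideal_prod_subset: "ideal I R \<Longrightarrow> (\<And>i j. i \<in> A \<Longrightarrow> j \<in> B \<Longrightarrow> i \<otimes> j \<in> I) \<Longrightarrow> A \<cdot> B \<subseteq> I"
  by (rule subsetI, erule ideal_prod.induct) (auto simp: additive_subgroup.a_closed ideal.axioms)

lemma ideal_power_add: assumes J: "ideal J R" "a \<in> ideal_power R J i" "b \<in> ideal_power R J j"
  shows "a \<otimes> b \<in> ideal_power R J (i + j)"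
  using assms(3)
proof (induction j arbitrary: b)
  case 0
  then show ?case using ideal.I_r_closed[OF ideal_power_ideal[OF J(1)] J(2)] by (simp add: ideal_power_0)
next
  case (Suc j)
  interpret K: ideal "ideal_power R J (i + Suc j)" R using ideal_power_ideal[OF J(1)] .
  have carr: "a \<in> carrier R" "J \<subseteq> carrier R" "ideal_power R J j \<subseteq> carrier R" 
    using ideal.Icarr[OF ideal_power_ideal[OF J(1)] J(2)] ideal.Icarr[OF J(1)]
      ideal.Icarr[OF ideal_power_ideal[OF J(1)]] by (auto simp only: subset_iff)
  have "b \<in> ideal_power R J j \<cdot> J" using Suc.prems by (simp add: ideal_power_Suc)
  then have "a \<otimes> b \<in> ideal_power R J (i + Suc j) \<and> b \<in> carrier R"
  proof (induction rule: ideal_prod.induct)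
    case (prod c d)
    then have "(a \<otimes> c) \<otimes> d \<in> ideal_power R J (i + Suc j)"
      using Suc.IH[OF prod(1)] by (simp add: ideal_power_Suc ideal_prod.prod)
    moreover have "c \<in> carrier R" "d \<in> carrier R" using carr prod by blast+
    ultimately show ?case using carr(1) by (simp add: m_assoc)
  next
    case (sum s1 s2)
    then have "a \<otimes> s1 \<oplus> a \<otimes> s2 \<in> ideal_power R J (i + Suc j)" by (intro K.a_closed) auto
    then show ?case using sum carr(1) by (simp add: r_distr)
  qed
  then show ?case ..
qed

lemma symbolic_power_filtration: assumes J: "ideal J R"
  shows "ideal_filtration R (symbolic_power R J)"
  unfolding ideal_filtration_def
proof (intro conjI allI)
  show "ideal (symbolic_power R J i) R" for i by (rule symbolic_power_ideal[OF J])
  have "\<one> \<in> carrier R - P" if "P \<in> associated_primes R J" for P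
    by (rule mult_set.S_one[OF primeideal.complement_mult_set[OF associated_primes_prime[OF that]]])
  then have "\<exists>s\<in>carrier R - P. s \<otimes> x \<in> ideal_power R J 0"
    if "P \<in> associated_primes R J" "x \<in> carrier R" for P x
    using that by (intro bexI[of _ \<one>]) (simp_all add: ideal_power_0)
  then show "symbolic_power R J 0 = carrier R"
    using symbolic_power_mem[OF J, of _ 0] by auto
next
  fix i
  have "ideal_power R J (Suc i) \<subseteq> ideal_power R J i"
    unfolding ideal_power_Suc using ideal_prod_inter[OF ideal_power_ideal[OF J] J] by blast
  then show "symbolic_power R J (Suc i) \<subseteq> symbolic_power R J i"
    unfolding subset_iff symbolic_power_mem[OF J] by blast
next
  fix i j
  show "symbolic_power R J i \<cdot> symbolic_power R J j \<subseteq> symbolic_power R J (i + j)"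
  proof (rule ideal_prod_subset[OF symbolic_power_ideal[OF J]])
    fix x y assume xy: "x \<in> symbolic_power R J i" "y \<in> symbolic_power R J j"
    then have c: "x \<in> carrier R" "y \<in> carrier R" unfolding symbolic_power_mem[OF J] by auto
    have "\<exists>s\<in>carrier R - P. s \<otimes> (x \<otimes> y) \<in> ideal_power R J (i + j)" if P: "P \<in> associated_primes R J" for P
    proof -
      interpret m: mult_set R "carrier R - P"
        by (rule primeideal.complement_mult_set[OF associated_primes_prime[OF P]])
      obtain s t where st: "s \<in> carrier R - P" "t \<in> carrier R - P" "s \<otimes> x \<in> ideal_power R J i" "t \<otimes> y \<in> ideal_power R J j"
        using xy P unfolding symbolic_power_mem[OF J] by meson
      have "(s \<otimes> x) \<otimes> (t \<otimes> y) = (s \<otimes> t) \<otimes> (x \<otimes> y)" using st c by (simp add: m_ac)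
      then have "(s \<otimes> t) \<otimes> (x \<otimes> y) \<in> ideal_power R J (i + j)"
        using ideal_power_add[OF J st(3,4)] by simp
      then show ?thesis using m.S_mult[OF st(1,2)] by (rule bexI)
    qed
    then show "x \<otimes> y \<in> symbolic_power R J (i + j)" using c by (simp add: symbolic_power_mem[OF J])
  qed
qed
end

end

theory Submission
  imports Defs
begin

text \<open>
  Let \<open>q = p\<^sup>e\<close>. Everything rests on one consequence of the flatness of the Frobenius endomorphism of a
  regular ring: \<open>(J\<^sup>[\<^sup>q\<^sup>] : s\<^sup>q) \<inter> K\<^sup>[\<^sup>q\<^sup>] = ((J : s) \<inter> K)\<^sup>[\<^sup>q\<^sup>]\<close>. It gives that \<open>f\<^sup>p \<in> J\<^sup>[\<^sup>p\<^sup>]\<close> forces \<open>f \<in> J\<close>,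
  so that \<open>\<nu>(pq) \<ge> p \<nu>(q)\<close> and \<open>\<nu>(q) / q\<close> is increasing in \<open>e\<close>. It also gives that \<open>\<aa>\<^sup>[\<^sup>q\<^sup>]\<close> is saturated
  with respect to the associated primes of \<open>\<aa>\<close>. If \<open>\<aa>\<close> has \<open>k\<close> generators and \<open>q'\<close> is a power of \<open>p\<close>
  with \<open>\<aa>\<^sup>[\<^sup>q\<^sup>'\<^sup>] \<subseteq> I\<close>, then \<open>\<aa>\<^sup>r \<subseteq> \<aa>\<^sup>[\<^sup>q\<^sup>'\<^sup>q\<^sup>]\<close> for \<open>r > k q' q\<close>; hence \<open>\<aa>\<^sup>(\<^sup>r\<^sup>) \<subseteq> \<aa>\<^sup>[\<^sup>q\<^sup>'\<^sup>q\<^sup>] \<subseteq> I\<^sup>[\<^sup>q\<^sup>]\<close>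
  and \<open>\<nu>(q) / q \<le> k q'\<close>.

  For the colon formula one localizes. In a regular local ring the generators of the maximal ideal \<open>M\<close>
  generate prime ideals (by Krull's height theorem), so their \<open>p\<close>-th powers form a regular sequence whose
  relations are the Koszul relations. By induction over colength, for every \<open>M\<close>-primary ideal the
  relations between the \<open>p\<close>-th powers of generators are spanned by the \<open>p\<close>-th powers of the relations
  between the generators; this is the colon formula for \<open>M\<close>-primary \<open>J\<close>, and the theorems of Artin--Rees
  and Krull remove the assumption on \<open>J\<close>.
\<close>

section \<open>Ideals of Noetherian rings\<close>

text \<open>The second ideal \<open>K\<close> in the colon formula is there for intersections. An
  annihilator has several generators, and the colon ideals of \<open>J\<close> by them are
  intersected one after another, each inside the \<open>K\<close> reached so far; a plain colon
  formula says nothing about Frobenius powers of such intersections. With \<open>K = R\<close> the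
  same formula shows that \<open>p\<close>-th powers reflect membership.

  Krull's theorem concerns \<open>R_P\<close> and its quotients. Instead of forming these rings, the
  proof keeps all ideals in \<open>R\<close> and asks that they contain \<open>J\<close> and be
  saturated with respect to \<open>P\<close>, that is, contracted from \<open>R_P\<close>.
  Nakayama's lemma and the descending chain condition are stated for such ideals.

  Flatness is likewise expressed without modules: a relation is a function on an index set, and the
  claim is about spans of relations. As the induction adjoins new generators, the index type has to
  be infinite; \<open>'a \<times> nat\<close> is one.\<close>

context cring
begin

lemma ideal_closed:
  assumes "ideal J R"
  shows ideal_carrier: "x \<in> J \<Longrightarrow> x \<in> carrier R"
    and ideal_zero: "\<zero> \<in> J"
    and ideal_add: "x \<in> J \<Longrightarrow> y \<in> J \<Longrightarrow> x \<oplus> y \<in> J"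
    and ideal_minus: "x \<in> J \<Longrightarrow> y \<in> J \<Longrightarrow> x \<ominus> y \<in> J"
    and ideal_uminus: "x \<in> J \<Longrightarrow> \<ominus> x \<in> J"
    and ideal_lmult: "x \<in> J \<Longrightarrow> r \<in> carrier R \<Longrightarrow> r \<otimes> x \<in> J"
    and ideal_rmult: "x \<in> J \<Longrightarrow> r \<in> carrier R \<Longrightarrow> x \<otimes> r \<in> J"
proof -
  interpret J: ideal J R by fact
  show "x \<in> J \<Longrightarrow> x \<in> carrier R" by (rule J.Icarr)
  show "\<zero> \<in> J" by (rule J.zero_closed)
  show "x \<in> J \<Longrightarrow> y \<in> J \<Longrightarrow> x \<oplus> y \<in> J" by (rule J.a_closed)
  show "x \<in> J \<Longrightarrow> \<ominus> x \<in> J" by (rule J.a_inv_closed)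
  show "x \<in> J \<Longrightarrow> y \<in> J \<Longrightarrow> x \<ominus> y \<in> J"
    by (simp add: minus_eq J.a_closed J.a_inv_closed)
  show "x \<in> J \<Longrightarrow> r \<in> carrier R \<Longrightarrow> r \<otimes> x \<in> J" by (rule J.I_l_closed)
  show "x \<in> J \<Longrightarrow> r \<in> carrier R \<Longrightarrow> x \<otimes> r \<in> J" by (rule J.I_r_closed)
qed

lemma ideal_subset_carrier: "ideal J R \<Longrightarrow> J \<subseteq> carrier R"
  by (auto dest: ideal_carrier)

lemma idealI':
  assumes "J \<subseteq> carrier R" "\<zero> \<in> J"
    and "\<And>x y. x \<in> J \<Longrightarrow> y \<in> J \<Longrightarrow> x \<oplus> y \<in> J"
    and "\<And>x r. x \<in> J \<Longrightarrow> r \<in> carrier R \<Longrightarrow> r \<otimes> x \<in> J"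
  shows "ideal J R"
proof (rule idealI[OF ring_axioms])
  show "subgroup J (add_monoid R)"
  proof (rule add.subgroupI)
    show "J \<subseteq> carrier R" "J \<noteq> {}" using assms by auto
    show "\<ominus> a \<in> J" if "a \<in> J" for a
    proof -
      have "(\<ominus> \<one>) \<otimes> a \<in> J" using that assms(4) by simp
      then show ?thesis using that assms(1) by (auto simp: l_minus subset_iff)
    qed
  qed (use assms in auto)
next
  fix a x assume a: "a \<in> J" and x: "x \<in> carrier R"
  show "x \<otimes> a \<in> J" using a x assms(4) by blast
  then show "a \<otimes> x \<in> J" using a x assms(1) m_comm by (metis subsetD)
qed

lemma ideal_diff_mem:
  assumes "ideal J R" "x \<oplus> y \<in> J" "y \<in> J" "x \<in> carrier R" shows "x \<in> J"
proof -
  have "x = (x \<oplus> y) \<ominus> y" using assms ideal_carrier[OF assms(1,3)] by algebra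
  then show ?thesis using ideal_minus[OF assms(1,2,3)] by simp
qed

lemma Idl_ideal [simp]: "ideal J R \<Longrightarrow> Idl J = J"
  by (rule subset_antisym[OF genideal_minimal[OF _ order_refl] genideal_self[OF ideal_subset_carrier]])

lemma mem_Idl: "A \<subseteq> carrier R \<Longrightarrow> x \<in> A \<Longrightarrow> x \<in> Idl A"
  using genideal_self by blast

lemma colon_ideal: "ideal J R \<Longrightarrow> a \<in> carrier R \<Longrightarrow> ideal {x \<in> carrier R. a \<otimes> x \<in> J} R"
  by (rule ideal.helper_max_prime[OF _ is_cring])

lemma Idl_insert:
  assumes A: "A \<subseteq> carrier R" and y: "y \<in> carrier R"
  shows "Idl (insert y A) = {j \<oplus> r \<otimes> y |j r. j \<in> Idl A \<and> r \<in> carrier R}" (is "_ = ?L")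
proof (rule subset_antisym)
  have I: "ideal (Idl A) R" by (rule genideal_ideal[OF A])
  have carr: "j \<in> Idl A \<Longrightarrow> j \<in> carrier R" for j by (rule ideal_carrier[OF I])
  have L: "ideal ?L R"
  proof (rule idealI')
    show "?L \<subseteq> carrier R" using carr y by auto
    have "\<zero> = \<zero> \<oplus> \<zero> \<otimes> y" using y by simp
    then show "\<zero> \<in> ?L" using ideal_zero[OF I] by blast
  next
    fix u v assume "u \<in> ?L" "v \<in> ?L"
    then obtain j r k s where c: "u = j \<oplus> r \<otimes> y" "j \<in> Idl A" "r \<in> carrier R"
      "v = k \<oplus> s \<otimes> y" "k \<in> Idl A" "s \<in> carrier R" by auto
    then have "u \<oplus> v = (j \<oplus> k) \<oplus> (r \<oplus> s) \<otimes> y" using y carr by algebra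
    then show "u \<oplus> v \<in> ?L" using c ideal_add[OF I] by blast
  next
    fix u s assume "u \<in> ?L" and s: "s \<in> carrier R"
    then obtain j r where c: "u = j \<oplus> r \<otimes> y" "j \<in> Idl A" "r \<in> carrier R" by auto
    then have "s \<otimes> u = s \<otimes> j \<oplus> (s \<otimes> r) \<otimes> y" using y s carr by algebra
    then show "s \<otimes> u \<in> ?L" using c s ideal_lmult[OF I] by blast
  qed
  have "a \<in> ?L" if "a \<in> A" for a
  proof -
    have "a = a \<oplus> \<zero> \<otimes> y" using that A y by auto
    then show ?thesis using mem_Idl[OF A that] by blast
  qed
  moreover have "y \<in> ?L"
  proof -
    have "y = \<zero> \<oplus> \<one> \<otimes> y" using y by auto
    then show ?thesis using ideal_zero[OF I] by blast
  qed
  ultimately show "Idl (insert y A) \<subseteq> ?L" by (intro genideal_minimal[OF L]) auto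
  have yA: "insert y A \<subseteq> carrier R" using A y by auto
  have I': "ideal (Idl (insert y A)) R" by (rule genideal_ideal[OF yA])
  have "Idl A \<subseteq> Idl (insert y A)" by (rule subset_Idl_subset[OF yA]) auto
  then show "?L \<subseteq> Idl (insert y A)"
    using mem_Idl[OF yA, of y] by (auto intro!: ideal_add[OF I'] ideal_lmult[OF I'])
qed

lemma mem_Idl_insert:
  assumes "ideal J R" "y \<in> carrier R"
  shows "x \<in> Idl (insert y J) \<longleftrightarrow> (\<exists>j\<in>J. \<exists>r\<in>carrier R. x = j \<oplus> r \<otimes> y)"
  using Idl_insert[OF ideal_subset_carrier[OF assms(1)] assms(2)] assms(1) by auto

lemma ideal_Idl_insert: "ideal J R \<Longrightarrow> y \<in> carrier R \<Longrightarrow> ideal (Idl (insert y J)) R"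
  by (intro genideal_ideal) (auto dest: ideal_carrier)

lemma subset_Idl_insert: "ideal J R \<Longrightarrow> y \<in> carrier R \<Longrightarrow> insert y J \<subseteq> Idl (insert y J)"
  by (intro genideal_self) (auto dest: ideal_carrier)

lemma Idl_insert_subset: "ideal J R \<Longrightarrow> K \<subseteq> J \<Longrightarrow> y \<in> J \<Longrightarrow> Idl (insert y K) \<subseteq> J"
  by (intro genideal_minimal) auto

lemma Idl_Un_Idl:
  assumes "A \<subseteq> carrier R" "B \<subseteq> carrier R"
  shows "Idl (A \<union> Idl B) = Idl (A \<union> B)"
proof (rule subset_antisym)
  have c: "A \<union> B \<subseteq> carrier R" "A \<union> Idl B \<subseteq> carrier R"
    using assms ideal_subset_carrier[OF genideal_ideal[OF assms(2)]] by auto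
  show "Idl (A \<union> Idl B) \<subseteq> Idl (A \<union> B)"
  proof (rule genideal_minimal[OF genideal_ideal[OF c(1)]])
    show "A \<union> Idl B \<subseteq> Idl (A \<union> B)"
      using genideal_self[OF c(1)] subset_Idl_subset[OF c(1), of B] by auto
  qed
  show "Idl (A \<union> B) \<subseteq> Idl (A \<union> Idl B)"
    by (rule subset_Idl_subset[OF c(2)]) (use genideal_self[OF assms(2)] in auto)
qed

lemma ideal_power_mono:
  assumes J: "ideal J R" and "m \<le> n" shows "ideal_power R J n \<subseteq> ideal_power R J m"
  using \<open>m \<le> n\<close>
proof (induction n rule: dec_induct)
  case (step n)
  then show ?case
    using ideal_prod_inter[OF ideal_power_ideal[OF J] J] by (fastforce simp: ideal_power_Suc)
qed simp

lemma nat_pow_mem_ideal_power: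
  assumes "ideal J R" "x \<in> J" shows "x [^] (n::nat) \<in> ideal_power R J n"
  by (induction n) (auto simp: ideal_power_0 ideal_power_Suc assms intro: ideal_prod.prod)

text \<open>Take the least \<open>k\<close> with \<open>M^k\<close> inside \<open>J\<close>: every
  element of \<open>M^(k-1)\<close> outside \<open>J\<close> is killed by \<open>M\<close> modulo
  \<open>J\<close>. As \<open>J\<close> is proper, \<open>k\<close> is positive.\<close>

lemma exists_socle_element:
  assumes M: "ideal M R" and J: "ideal J R" "J \<noteq> carrier R" "ideal_power R M N \<subseteq> J"
  shows "\<exists>y\<in>carrier R - J. \<forall>x\<in>M. x \<otimes> y \<in> J"
proof -
  define k where "k = (LEAST k. ideal_power R M k \<subseteq> J)"
  have k: "ideal_power R M k \<subseteq> J" unfolding k_def by (rule LeastI[of _ N]) (rule J(3))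
  have "k \<noteq> 0" using k J(2) ideal_subset_carrier[OF J(1)] by (auto simp: ideal_power_0)
  then obtain l where l: "k = Suc l" using not0_implies_Suc by blast
  then have "\<not> ideal_power R M l \<subseteq> J"
    unfolding k_def using not_less_Least[of l "\<lambda>k. ideal_power R M k \<subseteq> J"] by (metis lessI)
  then obtain y where y: "y \<in> ideal_power R M l" "y \<notin> J" by blast
  have yc: "y \<in> carrier R" using y(1) ideal_carrier[OF ideal_power_ideal[OF M]] by blast
  have "x \<otimes> y \<in> J" if "x \<in> M" for x
  proof -
    have "y \<otimes> x \<in> ideal_power R M k" using y(1) that unfolding l ideal_power_Suc by (rule ideal_prod.prod)
    then show ?thesis using k m_comm[OF yc ideal_carrier[OF M that]] by auto
  qed
  then show ?thesis using y yc by blast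
qed

text \<open>Passing from \<open>B\<close> to \<open>(B : g)\<close> lowers the exponent of \<open>g\<close> and of the ideal by one.\<close>

lemma ideal_power_subset:
  assumes "finite A" "A \<subseteq> carrier R" "ideal B R" "\<And>g. g \<in> A \<Longrightarrow> g [^] (e g :: nat) \<in> B" "sum e A < n"
  shows "ideal_power R (Idl A) n \<subseteq> B"
  using assms(3-)
proof (induction n arbitrary: e B)
  case (Suc n)
  have u: "u \<otimes> g \<in> B" if u: "u \<in> ideal_power R (Idl A) n" and g: "g \<in> A" for u g
  proof -
    have gc: "g \<in> carrier R" and uc: "u \<in> carrier R"
      using u g assms(2) ideal_carrier[OF ideal_power_ideal[OF genideal_ideal]] by auto
    define B' where "B' = {x \<in> carrier R. g \<otimes> x \<in> B}"
    have B': "ideal B' R" unfolding B'_def by (rule colon_ideal[OF Suc.prems(1) gc])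
    show ?thesis
    proof (cases "e g")
      case 0
      then have "\<one> \<in> B" using Suc.prems(2)[OF g] by simp
      then show ?thesis using ideal.one_imp_carrier[OF Suc.prems(1)] uc gc by auto
    next
      case (Suc k)
      define e' where "e' = e(g := k)"
      have "sum e A = Suc (sum e' A)"
        using Suc g assms(1) by (simp add: e'_def sum.remove[of A g])
      moreover have "h [^] e' h \<in> B'" if "h \<in> A" for h
      proof (cases "h = g")
        case True
        then show ?thesis using Suc.prems(2)[OF g] Suc gc by (simp add: e'_def B'_def m_comm)
      next
        case False
        then show ?thesis using Suc.prems(2)[OF that] gc assms(2) that
          by (auto simp: e'_def B'_def intro: ideal_lmult[OF \<open>ideal B R\<close>])
      qed
      ultimately have "ideal_power R (Idl A) n \<subseteq> B'"
        using Suc.prems(3) by (intro Suc.IH[OF B']) auto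
      then show ?thesis using u gc by (auto simp: B'_def m_comm)
    qed
  qed
  show ?case
    unfolding ideal_power_Suc
  proof (rule ideal_prod_subset[OF Suc.prems(1)])
    fix u v assume u': "u \<in> ideal_power R (Idl A) n" and v: "v \<in> Idl A"
    have uc: "u \<in> carrier R"
      using u' assms(2) ideal_carrier[OF ideal_power_ideal[OF genideal_ideal]] by auto
    have "Idl A \<subseteq> {x \<in> carrier R. u \<otimes> x \<in> B}"
      using u[OF u'] assms(2) by (intro genideal_minimal[OF colon_ideal[OF Suc.prems(1) uc]]) auto
    then show "u \<otimes> v \<in> B" using v by auto
  qed
qed simp

lemma prime_pow_mem:
  assumes "primeideal P R" "x \<in> carrier R" "x [^] (n::nat) \<in> P" shows "x \<in> P"
  using assms(3)
proof (induction n)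
  case 0
  then show ?case using primeideal.I_notcarr[OF assms(1)] ideal.one_imp_carrier[OF primeideal.axioms(1)[OF assms(1)]]
    by auto
next
  case (Suc n)
  then show ?case using primeideal.I_prime[OF assms(1), of "x [^] n" x] assms(2) by auto
qed

lemma mem_set_add: "x \<in> A <+> B \<longleftrightarrow> (\<exists>a\<in>A. \<exists>b\<in>B. x = a \<oplus> b)"
  unfolding set_add_def' by auto

lemma subset_set_add:
  assumes "ideal A R" "ideal B R" shows "A \<subseteq> A <+> B" "B \<subseteq> A <+> B"
proof -
  show "A \<subseteq> A <+> B"
    unfolding subset_iff mem_set_add using ideal_zero[OF assms(2)] ideal_carrier[OF assms(1)]
    by (metis r_zero)
  show "B \<subseteq> A <+> B"
    unfolding subset_iff mem_set_add using ideal_zero[OF assms(1)] ideal_carrier[OF assms(2)]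
    by (metis l_zero)
qed

lemma primeideal_ideal: "primeideal P R \<Longrightarrow> ideal P R"
  by (rule primeideal.axioms)

lemma prime_complement:
  assumes "primeideal P R"
  shows "\<one> \<in> carrier R - P"
    and "s \<in> carrier R - P \<Longrightarrow> t \<in> carrier R - P \<Longrightarrow> s \<otimes> t \<in> carrier R - P"
  using mult_set.S_one[OF primeideal.complement_mult_set[OF assms]]
    mult_set.S_mult[OF primeideal.complement_mult_set[OF assms]] by blast+

lemma minus_in_complement:
  assumes "primeideal P R" "s \<in> carrier R - P" "y \<in> P" shows "s \<ominus> y \<in> carrier R - P"
proof -
  note P = primeideal_ideal[OF assms(1)]
  have y: "y \<in> carrier R" using ideal_carrier[OF P assms(3)] .
  have "s \<in> carrier R" using assms(2) by auto
  then have "s = (s \<ominus> y) \<oplus> y" using y by algebra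
  then have "s \<ominus> y \<notin> P" using assms ideal_add[OF P] by (metis DiffD2)
  then show ?thesis using assms y by auto
qed

end

section \<open>Noetherian induction, and primes that avoid a multiplicative set\<close>

locale noetherian_cring = cring + noetherian_ring
begin

text \<open>In a Noetherian ring the union of a nonempty chain of ideals belongs to the chain, so
  Zorn's lemma applies to every nonempty family. All Noetherian inductions below take this
  form.\<close>

lemma exists_maximal_ideal:
  assumes "C \<noteq> {}" "\<And>I. I \<in> C \<Longrightarrow> ideal I R"
  shows "\<exists>M\<in>C. \<forall>I\<in>C. M \<subseteq> I \<longrightarrow> I = M"
proof (rule subset_Zorn_nonempty[OF assms(1)])
  fix D assume D: "D \<noteq> {}" "subset.chain C D"
  then have "subset.chain {I. ideal I R} D"
    using assms(2) unfolding subset_chain_def by blast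
  then show "\<Union>D \<in> C" using ideal_chain_is_trivial[OF D(1)] D(2) unfolding subset_chain_def by blast
qed

text \<open>An ideal \<open>P\<close> that is maximal among those above \<open>J\<close> missing
  \<open>S\<close> is prime: if \<open>a\<close> and \<open>b\<close> are outside \<open>P\<close>,
  then \<open>P + (a)\<close> and \<open>P + (b)\<close> both meet \<open>S\<close>, and if
  \<open>a \<otimes> b\<close> were in \<open>P\<close>, the product of the two common elements
  would lie in \<open>P\<close> and in \<open>S\<close>.\<close>

lemma exists_prime_disjoint:
  assumes J: "ideal J R" and S: "mult_set R S" and disj: "J \<inter> S = {}"
  obtains P where "primeideal P R" "J \<subseteq> P" "P \<inter> S = {}"
proof -
  interpret S: mult_set R S by fact
  define C where "C = {P. ideal P R \<and> J \<subseteq> P \<and> P \<inter> S = {}}"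
  have "J \<in> C" using J disj by (simp add: C_def)
  have "\<exists>P\<in>C. \<forall>I\<in>C. P \<subseteq> I \<longrightarrow> I = P"
    by (rule exists_maximal_ideal) (use \<open>J \<in> C\<close> in \<open>auto simp: C_def\<close>)
  then obtain P where "P \<in> C" and Pmax: "\<And>I. I \<in> C \<Longrightarrow> P \<subseteq> I \<Longrightarrow> I = P"
    by blast
  then have P: "ideal P R" "J \<subseteq> P" "P \<inter> S = {}" by (auto simp: C_def)
  note I = P(1)
  have meets: "\<exists>i\<in>P. \<exists>r\<in>carrier R. i \<oplus> r \<otimes> a \<in> S" if "a \<in> carrier R" "a \<notin> P" for a
  proof (rule ccontr)
    assume "\<not> ?thesis"
    then have "Idl (insert a P) \<inter> S = {}" by (auto simp: mem_Idl_insert[OF I that(1)])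
    then have "Idl (insert a P) = P"
      using subset_Idl_insert[OF I that(1)] ideal_Idl_insert[OF I that(1)] P
      by (intro Pmax) (auto simp: C_def)
    then show False using subset_Idl_insert[OF I that(1)] that by auto
  qed
  have "primeideal P R"
  proof (rule primeidealI[OF I is_cring])
    show "carrier R \<noteq> P" using P S.S_one S.S_sub by blast
  next
    fix a b assume ab: "a \<in> carrier R" "b \<in> carrier R" "a \<otimes> b \<in> P"
    show "a \<in> P \<or> b \<in> P"
    proof (rule ccontr)
      assume "\<not> (a \<in> P \<or> b \<in> P)"
      then obtain i r j s where c: "i \<in> P" "r \<in> carrier R" "i \<oplus> r \<otimes> a \<in> S"
        "j \<in> P" "s \<in> carrier R" "j \<oplus> s \<otimes> b \<in> S" using meets ab by meson
      have ij: "i \<in> carrier R" "j \<in> carrier R" using c ideal_carrier[OF I] by auto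
      have "(i \<oplus> r \<otimes> a) \<otimes> (j \<oplus> s \<otimes> b) = (j \<oplus> s \<otimes> b) \<otimes> i \<oplus> ((r \<otimes> a) \<otimes> j \<oplus> (r \<otimes> s) \<otimes> (a \<otimes> b))"
        using c ab ij by algebra
      also have "\<dots> \<in> P" using c ab ij ideal_lmult[OF I ab(3)] ideal_lmult[OF I c(1)] ideal_lmult[OF I c(4)]
        by (intro ideal_add[OF I]) auto
      finally show False using S.S_mult[OF c(3,6)] P by blast
    qed
  qed
  then show ?thesis using that P by auto
qed

text \<open>The exponents of finitely many generators combine into a single one through
  \<open>ideal_power_subset\<close>.\<close>

lemma ideal_power_subset_radical:
  assumes "ideal P R" "ideal B R" "\<And>y. y \<in> P \<Longrightarrow> \<exists>n::nat. y [^] n \<in> B"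
  obtains N where "ideal_power R P N \<subseteq> B"
proof -
  obtain A where A: "A \<subseteq> carrier R" "finite A" "P = Idl A" using finetely_gen[OF assms(1)] by auto
  have "\<forall>y\<in>A. \<exists>n::nat. y [^] n \<in> B" using assms(3) A mem_Idl[OF A(1)] by blast
  then obtain e :: "'a \<Rightarrow> nat" where "\<forall>y\<in>A. y [^] e y \<in> B" by metis
  then have "ideal_power R P (Suc (sum e A)) \<subseteq> B"
    unfolding A(3) using A assms(2) by (intro ideal_power_subset) auto
  then show ?thesis by (rule that)
qed

end

section \<open>Krull's height theorem\<close>

text \<open>For an ideal \<open>J\<close> this says that \<open>J\<close> is contracted from the
  localization at \<open>P\<close>. Such ideals of \<open>R\<close> stand for the ideals of
  \<open>R_P\<close>.\<close>

definition saturated :: "('a, 'b) ring_scheme \<Rightarrow> 'a set \<Rightarrow> 'a set \<Rightarrow> bool"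
  where "saturated R P J \<longleftrightarrow>
    (\<forall>s\<in>carrier R - P. \<forall>x\<in>carrier R. s \<otimes>\<^bsub>R\<^esub> x \<in> J \<longrightarrow> x \<in> J)"

definition prime_chain :: "('a, 'b) ring_scheme \<Rightarrow> (nat \<Rightarrow> 'a set) \<Rightarrow> nat \<Rightarrow> bool"
  where "prime_chain R P n \<longleftrightarrow> (\<forall>i\<le>n. primeideal (P i) R) \<and> (\<forall>i<n. P i \<subset> P (Suc i))"

context cring
begin

abbreviation "sat \<equiv> extension_contraction R"

lemma saturatedD:
  "saturated R P J \<Longrightarrow> s \<in> carrier R - P \<Longrightarrow> x \<in> carrier R \<Longrightarrow> s \<otimes> x \<in> J \<Longrightarrow> x \<in> J"
  unfolding saturated_def by blast

lemma mem_sat: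
  "primeideal P R \<Longrightarrow> ideal J R \<Longrightarrow>
    x \<in> sat P J \<longleftrightarrow> x \<in> carrier R \<and> (\<exists>s\<in>carrier R - P. s \<otimes> x \<in> J)"
  by (simp add: extension_contraction_eq)

lemma sat_ideal: "primeideal P R \<Longrightarrow> ideal J R \<Longrightarrow> ideal (sat P J) R"
  by (rule extension_contraction_ideal)

lemma subset_sat:
  assumes "primeideal P R" "ideal J R" shows "J \<subseteq> sat P J"
proof
  fix x assume x: "x \<in> J"
  then have "x \<in> carrier R" by (rule ideal_carrier[OF assms(2)])
  then show "x \<in> sat P J"
    unfolding mem_sat[OF assms] using prime_complement(1)[OF assms(1)] x l_one by metis
qed

lemma saturated_sat:
  assumes P: "primeideal P R" and J: "ideal J R" shows "saturated R P (sat P J)"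
  unfolding saturated_def
proof (intro ballI impI)
  fix s x assume s: "s \<in> carrier R - P" and x: "x \<in> carrier R" and sx: "s \<otimes> x \<in> sat P J"
  then obtain t where t: "t \<in> carrier R - P" "t \<otimes> (s \<otimes> x) \<in> J" unfolding mem_sat[OF P J] by blast
  have "t \<otimes> (s \<otimes> x) = (t \<otimes> s) \<otimes> x" using s t x by (simp add: m_assoc)
  then show "x \<in> sat P J"
    unfolding mem_sat[OF P J] using prime_complement(2)[OF P t(1) s] t(2) x by metis
qed

lemma sat_subset:
  assumes "primeideal P R" "ideal J R" "ideal K R" "saturated R P K" "J \<subseteq> K"
  shows "sat P J \<subseteq> K"
  using assms(4,5) unfolding subset_iff mem_sat[OF assms(1,2)] saturated_def by blast

lemma saturated_prime:
  assumes "primeideal P R" "primeideal Q R" "Q \<subseteq> P" shows "saturated R P Q"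
  unfolding saturated_def using primeideal.I_prime[OF assms(2)] assms(3) by blast

lemma saturated_mono: "saturated R P J \<Longrightarrow> P \<subseteq> Q \<Longrightarrow> saturated R Q J"
  unfolding saturated_def by blast

lemma saturated_local:
  assumes "\<And>s. s \<in> carrier R - P \<Longrightarrow> s \<in> Units R" "ideal J R" shows "saturated R P J"
  unfolding saturated_def
proof (intro ballI impI)
  fix s x assume s: "s \<in> carrier R - P" and x: "x \<in> carrier R" and sx: "s \<otimes> x \<in> J"
  have "inv s \<otimes> (s \<otimes> x) = x" using assms(1)[OF s] x s by (simp flip: m_assoc)
  then show "x \<in> J" using ideal_lmult[OF assms(2) sx, of "inv s"] assms(1)[OF s] by simp
qed

lemma mem_sat_Idl_insert:
  assumes "primeideal P R" "ideal J R" "y \<in> carrier R"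
  shows "x \<in> sat P (Idl (insert y J)) \<longleftrightarrow>
    x \<in> carrier R \<and> (\<exists>s\<in>carrier R - P. \<exists>j\<in>J. \<exists>r\<in>carrier R. s \<otimes> x = j \<oplus> r \<otimes> y)"
  unfolding mem_sat[OF assms(1) ideal_Idl_insert[OF assms(2,3)]] mem_Idl_insert[OF assms(2,3)] ..

lemma insert_subset_sat:
  assumes "primeideal P R" "ideal J R" "y \<in> carrier R"
  shows "insert y J \<subseteq> sat P (Idl (insert y J))"
  using subset_Idl_insert[OF assms(2,3)] subset_sat[OF assms(1) ideal_Idl_insert[OF assms(2,3)]]
  by (rule order_trans)

section \<open>Chains of primes\<close>

lemma prime_chainD:
  assumes "prime_chain R P n"
  shows "i \<le> n \<Longrightarrow> primeideal (P i) R" "i < n \<Longrightarrow> P i \<subset> P (Suc i)" "i \<le> n \<Longrightarrow> P 0 \<subseteq> P i"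
    "i \<le> n \<Longrightarrow> P i \<subseteq> P n"
proof -
  show "i \<le> n \<Longrightarrow> primeideal (P i) R" and *: "i < n \<Longrightarrow> P i \<subset> P (Suc i)" for i
    using assms unfolding prime_chain_def by auto
  show "i \<le> n \<Longrightarrow> P 0 \<subseteq> P i"
  proof (induction i)
    case (Suc i)
    then show ?case using *[of i] by auto
  qed simp
  show "i \<le> n \<Longrightarrow> P i \<subseteq> P n"
  proof (induction rule: inc_induct)
    case (step i)
    then show ?case using *[of i] by blast
  qed simp
qed

lemma prime_chain_Suc: "prime_chain R P (Suc n) \<Longrightarrow> prime_chain R (\<lambda>i. P (Suc i)) n"
  unfolding prime_chain_def by auto

lemma prime_chain_top:
  assumes "prime_chain R P n" "primeideal M R" "P n \<subseteq> M"
  shows "prime_chain R (P(n := M)) n"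
  unfolding prime_chain_def
proof (intro conjI allI impI)
  show "primeideal ((P(n := M)) i) R" if "i \<le> n" for i
    using that assms(2) prime_chainD(1)[OF assms(1)] by auto
  show "(P(n := M)) i \<subset> (P(n := M)) (Suc i)" if "i < n" for i
    using that prime_chainD(2)[OF assms(1) that] assms(3) by auto
qed

end

section \<open>Nakayama's lemma and Krull's principal ideal theorem over a localization\<close>

context noetherian_cring
begin

text \<open>A proper saturated ideal \<open>N'\<close> between \<open>N\<close> and \<open>M\<close> that is maximal leads to a contradiction,
  since \<open>M\<close> is then the saturation of \<open>N' + (u)\<close> for each \<open>u \<in> M - N'\<close>.\<close>

lemma nakayama:
  assumes P: "primeideal P R" and N: "ideal N R" and M: "ideal M R" and NM: "N \<subseteq> M"
    and sN: "saturated R P N" and sM: "saturated R P M"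
    and gen: "\<And>u. u \<in> M \<Longrightarrow> \<exists>s\<in>carrier R - P. s \<otimes> u \<in> N <+> P \<cdot> M"
  shows "N = M"
proof (rule ccontr)
  assume "N \<noteq> M"
  define C where "C = {K. ideal K R \<and> saturated R P K \<and> N \<subseteq> K \<and> K \<subset> M}"
  have "N \<in> C" using \<open>N \<noteq> M\<close> N sN NM by (auto simp: C_def)
  have "\<exists>K\<in>C. \<forall>I\<in>C. K \<subseteq> I \<longrightarrow> I = K"
    by (rule exists_maximal_ideal) (use \<open>N \<in> C\<close> in \<open>auto simp: C_def\<close>)
  then obtain K where K: "K \<in> C" and max: "\<And>I. I \<in> C \<Longrightarrow> K \<subseteq> I \<Longrightarrow> I = K"
    by blast
  have KI: "ideal K R" and sK: "saturated R P K" and NK: "N \<subseteq> K" and KM: "K \<subset> M"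
    using K by (auto simp: C_def)
  obtain u where u: "u \<in> M" "u \<notin> K" using KM by auto
  have uc: "u \<in> carrier R" using ideal_carrier[OF M u(1)] .
  note PI = primeideal_ideal[OF P]
  define L where "L = sat P (Idl (insert u K))"
  have LI: "ideal L R" "saturated R P L"
    unfolding L_def using ideal_Idl_insert[OF KI uc] by (auto intro!: sat_ideal saturated_sat P)
  have "L \<subseteq> M"
    unfolding L_def by (intro sat_subset[OF P ideal_Idl_insert[OF KI uc] M sM] Idl_insert_subset[OF M])
      (use KM u in auto)
  moreover have uL: "insert u K \<subseteq> L" unfolding L_def by (rule insert_subset_sat[OF P KI uc])
  ultimately have "L = M" using max[of L] LI NK u unfolding C_def by blast
  \<comment> \<open>Since \<open>M = L\<close> is generated by \<open>u\<close> over
    \<open>K\<close> up to saturation, \<open>P \<cdot> M\<close> is generated over \<open>K\<close>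
    by multiples of \<open>u\<close> with coefficients in \<open>P\<close>.\<close>
  have Z: "\<exists>s\<in>carrier R - P. \<exists>p\<in>P. \<exists>n\<in>K. s \<otimes> z = n \<oplus> p \<otimes> u" if "z \<in> P \<cdot> M" for z
    using that
  proof (induction z rule: ideal_prod.induct)
    case (prod i j)
    then have "j \<in> L" using \<open>L = M\<close> by simp
    then obtain s n r where c: "s \<in> carrier R - P" "n \<in> K" "r \<in> carrier R" "s \<otimes> j = n \<oplus> r \<otimes> u"
      unfolding L_def mem_sat_Idl_insert[OF P KI uc] by blast
    have carr: "i \<in> carrier R" "j \<in> carrier R" "n \<in> carrier R" "s \<in> carrier R"
      using prod ideal_carrier[OF PI] ideal_carrier[OF M] ideal_carrier[OF KI] c by auto
    have "s \<otimes> (i \<otimes> j) = i \<otimes> (s \<otimes> j)" using carr by algebra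
    also have "\<dots> = i \<otimes> n \<oplus> (i \<otimes> r) \<otimes> u" unfolding c(4) using carr c(3) uc by algebra
    finally have "s \<otimes> (i \<otimes> j) = i \<otimes> n \<oplus> (i \<otimes> r) \<otimes> u" .
    then show ?case
      using c(1) ideal_lmult[OF KI c(2) carr(1)] ideal_rmult[OF PI prod(1) c(3)] by blast
  next
    case (sum z1 z2)
    then obtain s p n t q m where c: "s \<in> carrier R - P" "p \<in> P" "n \<in> K" "s \<otimes> z1 = n \<oplus> p \<otimes> u"
      "t \<in> carrier R - P" "q \<in> P" "m \<in> K" "t \<otimes> z2 = m \<oplus> q \<otimes> u" by blast
    have carr: "z1 \<in> carrier R" "z2 \<in> carrier R" "n \<in> carrier R" "m \<in> carrier R" "s \<in> carrier R"
      "t \<in> carrier R" "p \<in> carrier R" "q \<in> carrier R"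
      using sum(1,2) ideal_prod_in_carrier[OF PI M] ideal_carrier[OF PI] ideal_carrier[OF KI] c by auto
    have "(s \<otimes> t) \<otimes> (z1 \<oplus> z2) = t \<otimes> (s \<otimes> z1) \<oplus> s \<otimes> (t \<otimes> z2)" using carr by algebra
    also have "\<dots> = (t \<otimes> n \<oplus> s \<otimes> m) \<oplus> (t \<otimes> p \<oplus> s \<otimes> q) \<otimes> u"
      unfolding c(4,8) using carr uc by algebra
    finally show ?case
      using prime_complement(2)[OF P c(1,5)]
        ideal_add[OF KI ideal_lmult[OF KI c(3) carr(6)] ideal_lmult[OF KI c(7) carr(5)]]
        ideal_add[OF PI ideal_lmult[OF PI c(2) carr(6)] ideal_lmult[OF PI c(6) carr(5)]] by blast
  qed
  obtain s n z where c: "s \<in> carrier R - P" "n \<in> N" "z \<in> P \<cdot> M" "s \<otimes> u = n \<oplus> z"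
    using gen[OF u(1)] unfolding mem_set_add by blast
  obtain t p m where d: "t \<in> carrier R - P" "p \<in> P" "m \<in> K" "t \<otimes> z = m \<oplus> p \<otimes> u"
    using Z[OF c(3)] by blast
  have carr: "z \<in> carrier R" "n \<in> carrier R" "m \<in> carrier R" "s \<in> carrier R"
      "t \<in> carrier R" "p \<in> carrier R"
    using ideal_prod_in_carrier[OF PI M] ideal_carrier[OF PI] ideal_carrier[OF KI]
      ideal_carrier[OF N] c d by auto
  have "t \<otimes> (s \<otimes> u) = t \<otimes> n \<oplus> (m \<oplus> p \<otimes> u)" unfolding c(4) d(4)[symmetric] using carr by algebra
  \<comment> \<open>\<open>t \<otimes> s\<close> is outside \<open>P\<close> and \<open>p\<close> is
    inside, so their difference is outside \<open>P\<close> and saturation of \<open>K\<close>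
    cancels it. This replaces the unit \<open>1 - p\<close> of a local ring.\<close>
  then have "(t \<otimes> s \<ominus> p) \<otimes> u = (t \<otimes> n \<oplus> (m \<oplus> p \<otimes> u)) \<ominus> p \<otimes> u" using carr uc by algebra
  also have "\<dots> = t \<otimes> n \<oplus> m" using carr uc by algebra
  also have "\<dots> \<in> K" using c(2) d(3) NK carr by (intro ideal_add[OF KI] ideal_lmult[OF KI]) auto
  finally have "u \<in> K"
    using minus_in_complement[OF P prime_complement(2)[OF P d(1) c(1)] d(2)] saturatedD[OF sK _ uc] by blast
  then show False using u by simp
qed

text \<open>The saturated ideals above \<open>I \<supseteq> P\<^sup>N\<close> correspond to the ideals of the Artinian local ring
  \<open>R\<^sub>P / I R\<^sub>P\<close>.\<close>

lemma saturated_chain_stabilizes: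
  assumes P: "primeideal P R" and "ideal I R" "saturated R P I" "ideal_power R P N \<subseteq> I"
    and "\<And>n::nat. ideal (C n) R \<and> saturated R P (C n) \<and> I \<subseteq> C n \<and> C (Suc n) \<subseteq> C n"
  shows "\<exists>n. C (Suc n) = C n"
proof -
  note PI = primeideal_ideal[OF P]
  define chain where "chain I C \<longleftrightarrow>
    (\<forall>n::nat. ideal (C n) R \<and> saturated R P (C n) \<and> I \<subseteq> C n \<and> C (Suc n) \<subseteq> C n)" for I C
  define B where "B = {I. ideal I R \<and> saturated R P I \<and> ideal_power R P N \<subseteq> I \<and>
    (\<exists>C. chain I C \<and> (\<forall>n. C (Suc n) \<noteq> C n))}"
  have "B = {}"
  proof (rule ccontr)
    assume "B \<noteq> {}"
    then have "\<exists>I\<in>B. \<forall>K\<in>B. I \<subseteq> K \<longrightarrow> K = I"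
      by (rule exists_maximal_ideal) (simp add: B_def)
    then obtain I where "I \<in> B" and max: "\<And>K. K \<in> B \<Longrightarrow> I \<subseteq> K \<Longrightarrow> K = I"
      by blast
    then obtain C where I: "ideal I R" "saturated R P I" "ideal_power R P N \<subseteq> I"
      and C: "chain I C" "\<And>n. C (Suc n) \<noteq> C n" unfolding B_def by blast
    have Cn: "ideal (C n) R" "saturated R P (C n)" "I \<subseteq> C n" "C (Suc n) \<subseteq> C n" for n
      using C(1) by (auto simp: chain_def)
    have "I \<noteq> carrier R"
    proof
      assume "I = carrier R"
      then have "C 1 = C 0" using Cn(3)[of 0] Cn(3)[of 1] ideal_subset_carrier[OF Cn(1)] by blast
      then show False using C(2)[of 0] by simp
    qed
    obtain y where yc: "y \<in> carrier R" and y: "y \<notin> I" and Py: "\<And>a. a \<in> P \<Longrightarrow> a \<otimes> y \<in> I"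
      using exists_socle_element[OF PI I(1) \<open>I \<noteq> carrier R\<close> I(3)] by blast
    define I' where "I' = sat P (Idl (insert y I))"
    have I': "ideal I' R" "saturated R P I'"
      unfolding I'_def using ideal_Idl_insert[OF I(1) yc] by (auto intro!: sat_ideal saturated_sat P)
    have II': "insert y I \<subseteq> I'" unfolding I'_def by (rule insert_subset_sat[OF P I(1) yc])
    \<comment> \<open>\<open>I'\<close> is strictly larger than the maximal bad ideal
      \<open>I\<close>.\<close>
    have stab: "\<exists>n. D (Suc n) = D n" if "chain I' D" for D
    proof (rule ccontr)
      assume "\<not> ?thesis"
      then have "I' \<in> B" using I' II' I(3) that unfolding B_def by blast
      then show False using max[of I'] II' y by auto
    qed
    show False
    proof (cases "\<forall>n. y \<in> C n")
      case True
      have "I' \<subseteq> C n" for n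
        unfolding I'_def by (intro sat_subset[OF P ideal_Idl_insert[OF I(1) yc] Cn(1,2)]
          Idl_insert_subset[OF Cn(1)] Cn(3)) (use True in auto)
      then have "chain I' C" using Cn by (auto simp: chain_def)
      then show False using stab C(2) by blast
    next
      case False
      then obtain k where k: "y \<notin> C k" by blast
      have yn: "y \<notin> C (k + n)" for n
        by (induction n) (use k Cn(4) in auto)
      \<comment> \<open>Adjoining \<open>y\<close> moves the tail of \<open>C\<close> above
        \<open>I'\<close>, where it stabilizes. Nothing is lost: a multiple
        \<open>r \<otimes> y\<close> in \<open>C (k + n)\<close> has \<open>r \<in> P\<close>,
        because \<open>y\<close> is outside this saturated ideal, and then it already lies in
        \<open>I\<close>.\<close>
      define D where "D n = sat P (Idl (insert y (C (k + n))))" for n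
      have Did: "ideal (Idl (insert y (C n))) R" for n by (rule ideal_Idl_insert[OF Cn(1) yc])
      have Dn: "ideal (D n) R" "saturated R P (D n)" for n
        unfolding D_def using Did by (auto intro!: sat_ideal saturated_sat P)
      have "chain I' D"
        unfolding chain_def
      proof (intro allI conjI Dn)
        fix n
        have *: "insert y (C (k + n)) \<subseteq> D n" unfolding D_def by (rule insert_subset_sat[OF P Cn(1) yc])
        show "I' \<subseteq> D n"
          unfolding I'_def by (intro sat_subset[OF P ideal_Idl_insert[OF I(1) yc] Dn]
            Idl_insert_subset[OF Dn(1)]) (use * Cn(3) in auto)
        show "D (Suc n) \<subseteq> D n"
          unfolding D_def[of "Suc n"] by (intro sat_subset[OF P Did Dn] Idl_insert_subset[OF Dn(1)])
            (use * Cn(4)[of "k + n"] in auto)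
      qed
      then obtain n where n: "D (Suc n) = D n" using stab by blast
      have "C (k + n) \<subseteq> C (Suc (k + n))"
      proof
        fix c assume c: "c \<in> C (k + n)"
        have cc: "c \<in> carrier R" using ideal_carrier[OF Cn(1) c] .
        have "c \<in> D n" using c insert_subset_sat[OF P Cn(1) yc, of "k + n"] unfolding D_def by blast
        then have "c \<in> D (Suc n)" using n by simp
        then obtain s c' r where d: "s \<in> carrier R - P" "c' \<in> C (Suc (k + n))" "r \<in> carrier R"
          "s \<otimes> c = c' \<oplus> r \<otimes> y"
          unfolding D_def add_Suc_right mem_sat_Idl_insert[OF P Cn(1) yc] by blast
        have c'c: "c' \<in> carrier R" using ideal_carrier[OF Cn(1) d(2)] .
        have "r \<otimes> y = s \<otimes> c \<ominus> c'" unfolding d(4) using c'c d(3) yc by algebra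
        also have "\<dots> \<in> C (k + n)"
          using c d Cn(4)[of "k + n"] by (intro ideal_minus[OF Cn(1)] ideal_lmult[OF Cn(1)]) auto
        finally have "r \<in> P" using saturatedD[OF Cn(2) _ yc] yn d(3) by blast
        then have "r \<otimes> y \<in> C (Suc (k + n))" using Py Cn(3) by blast
        then have "s \<otimes> c \<in> C (Suc (k + n))" unfolding d(4) by (rule ideal_add[OF Cn(1) d(2)])
        then show "c \<in> C (Suc (k + n))" using saturatedD[OF Cn(2) d(1) cc] by blast
      qed
      then show False using C(2)[of "k + n"] Cn(4)[of "k + n"] by blast
    qed
  qed
  moreover have "chain I C" using assms(5) by (auto simp: chain_def)
  ultimately show ?thesis using assms(2-4) unfolding B_def by blast
qed

text \<open>Every \<open>y \<in> P\<close> has a power in \<open>sat P B\<close>: otherwise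
  \<open>B\<close> misses the multiplicative set of all \<open>s y^n\<close> with \<open>s\<close>
  outside \<open>P\<close>, and a prime above \<open>B\<close> missing that set lies inside
  \<open>P\<close> without containing \<open>y\<close>, against minimality.\<close>

lemma minimal_prime_power:
  assumes P: "primeideal P R" and B: "ideal B R" and BP: "B \<subseteq> P"
    and min: "\<And>Q. primeideal Q R \<Longrightarrow> B \<subseteq> Q \<Longrightarrow> Q \<subseteq> P \<Longrightarrow> Q = P"
  shows "\<exists>N. ideal_power R P N \<subseteq> sat P B"
proof -
  note PI = primeideal_ideal[OF P]
  have "\<exists>n::nat. y [^] n \<in> sat P B" if y: "y \<in> P" for y
  proof (rule ccontr)
    assume neg: "\<not> ?thesis"
    have yc: "y \<in> carrier R" using ideal_carrier[OF PI y] .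
    define S where "S = {s \<otimes> y [^] (n::nat) |s n. s \<in> carrier R - P}"
    have S: "mult_set R S"
    proof unfold_locales
      show "S \<subseteq> carrier R" using yc by (auto simp: S_def)
      have "\<one> = \<one> \<otimes> y [^] (0::nat)" by simp
      then show "\<one> \<in> S" unfolding S_def using prime_complement(1)[OF P] by blast
    next
      fix a b assume "a \<in> S" "b \<in> S"
      then obtain s t and m n :: nat where c: "a = s \<otimes> y [^] m" "b = t \<otimes> y [^] n"
        "s \<in> carrier R - P" "t \<in> carrier R - P" by (auto simp: S_def)
      then have "a \<otimes> b = (s \<otimes> t) \<otimes> y [^] (m + n)"
        using yc by (simp add: m_ac flip: nat_pow_mult)
      then show "a \<otimes> b \<in> S" unfolding S_def using prime_complement(2)[OF P c(3,4)] by blast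
    qed
    have "B \<inter> S = {}"
    proof (rule ccontr)
      assume "B \<inter> S \<noteq> {}"
      then obtain s and n :: nat where c: "s \<otimes> y [^] n \<in> B" "s \<in> carrier R - P" by (auto simp: S_def)
      then have "y [^] n \<in> sat P B" unfolding mem_sat[OF P B] using yc by blast
      then show False using neg by blast
    qed
    then obtain Q where Q: "primeideal Q R" "B \<subseteq> Q" "Q \<inter> S = {}"
      by (rule exists_prime_disjoint[OF B S])
    have "Q \<subseteq> P"
    proof
      fix x assume x: "x \<in> Q"
      have xc: "x \<in> carrier R" using ideal_carrier[OF primeideal_ideal[OF Q(1)] x] .
      then have "x = x \<otimes> y [^] (0::nat)" by simp
      then have "x \<in> S" if "x \<notin> P" using xc that unfolding S_def by blast
      then show "x \<in> P" using Q(3) x by blast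
    qed
    then have "Q = P" using min Q by blast
    have "y = \<one> \<otimes> y [^] (1::nat)" using yc by simp
    then have "y \<in> S" unfolding S_def using prime_complement(1)[OF P] by blast
    then show False using Q(3) y \<open>Q = P\<close> by blast
  qed
  then show ?thesis by (meson ideal_power_subset_radical PI sat_ideal P B)
qed

text \<open>Krull's principal ideal theorem, for the element \<open>x\<close> of the domain \<open>R / P0\<close>. The chain
  \<open>D\<close> below consists of the symbolic powers of \<open>P1\<close> modulo \<open>P0\<close>.\<close>

lemma krull_principal_ideal:
  assumes P0: "primeideal P0 R" and P1: "primeideal P1 R" and P2: "primeideal P2 R"
    and P01: "P0 \<subset> P1" and P12: "P1 \<subset> P2" and x: "x \<in> P2"
  obtains Q where "primeideal Q R" "x \<in> Q" "P0 \<subset> Q" "Q \<subset> P2"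
proof (cases "x \<in> P1")
  case True
  then show ?thesis using that P1 P01 P12 by blast
next
  case x1: False
  note I0 = primeideal_ideal[OF P0] and I1 = primeideal_ideal[OF P1] and I2 = primeideal_ideal[OF P2]
  have xc: "x \<in> carrier R" using ideal_carrier[OF I2 x] .
  define B where "B = Idl (insert x P0)"
  have B: "ideal B R" "insert x P0 \<subseteq> B"
    unfolding B_def by (rule ideal_Idl_insert[OF I0 xc], rule subset_Idl_insert[OF I0 xc])
  show ?thesis
  proof (rule ccontr)
    assume "\<not> thesis"
    then have noQ: "\<not> (primeideal Q R \<and> x \<in> Q \<and> P0 \<subset> Q \<and> Q \<subset> P2)" for Q using that by blast
    \<comment> \<open>Without a prime \<open>Q\<close> as desired, \<open>P2\<close> is minimal over
      \<open>P0 + (x)\<close>.\<close>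
    have "Q = P2" if "primeideal Q R" "B \<subseteq> Q" "Q \<subseteq> P2" for Q
      using noQ[of Q] that B(2) x1 P01 by blast
    moreover have "B \<subseteq> P2" unfolding B_def using P01 P12 x by (intro Idl_insert_subset[OF I2]) auto
    ultimately obtain N where N: "ideal_power R P2 N \<subseteq> sat P2 B"
      using minimal_prime_power[OF P2 B(1)] by blast
    define A where "A n = P0 <+>\<^bsub>R\<^esub> ideal_power R P1 n" for n
    have A: "ideal (A n) R" for n
      unfolding A_def by (rule add_ideals[OF I0 ideal_power_ideal[OF I1]])
    define D where "D n = sat P1 (A n)" for n
    have D: "ideal (D n) R" "saturated R P1 (D n)" "A n \<subseteq> D n" for n
      unfolding D_def by (rule sat_ideal[OF P1 A], rule saturated_sat[OF P1 A], rule subset_sat[OF P1 A])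
    have P0D: "P0 \<subseteq> D n" and powD: "ideal_power R P1 n \<subseteq> D n" for n
      using D(3)[of n] subset_set_add[OF I0 ideal_power_ideal[OF I1], of n] unfolding A_def by auto
    have Amono: "A (Suc n) \<subseteq> A n" for n
      using ideal_power_mono[OF I1 le_SucI[OF order_refl], of n] unfolding A_def subset_iff mem_set_add by blast
    have Dmono: "D (Suc n) \<subseteq> D n" for n
      unfolding D_def[of "Suc n"] using Amono[of n] D(3)[of n] by (intro sat_subset[OF P1 A D(1,2)]) auto
    have sD2: "saturated R P2 (D n)" for n
      by (rule saturated_mono[OF D(2)]) (use P12 in blast)
    define C where "C n = sat P2 (Idl (insert x (D n)))" for n
    have Did: "ideal (Idl (insert x (D n))) R" for n by (rule ideal_Idl_insert[OF D(1) xc])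
    have C: "ideal (C n) R" "saturated R P2 (C n)" for n
      unfolding C_def by (rule sat_ideal[OF P2 Did], rule saturated_sat[OF P2 Did])
    have DC: "insert x (D n) \<subseteq> C n" for n
      unfolding C_def by (rule insert_subset_sat[OF P2 D(1) xc])
    have "\<exists>n. C (Suc n) = C n"
    proof (rule saturated_chain_stabilizes[OF P2 _ _ N])
      show "ideal (sat P2 B) R" "saturated R P2 (sat P2 B)"
        by (rule sat_ideal[OF P2 B(1)], rule saturated_sat[OF P2 B(1)])
      fix n
      have "B \<subseteq> C n" unfolding B_def using DC[of n] P0D[of n] by (intro Idl_insert_subset[OF C(1)]) auto
      then have "sat P2 B \<subseteq> C n" by (rule sat_subset[OF P2 B(1) C])
      moreover have "C (Suc n) \<subseteq> C n"
        unfolding C_def[of "Suc n"] using DC[of n] Dmono[of n]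
        by (intro sat_subset[OF P2 Did C] Idl_insert_subset[OF C(1)]) auto
      ultimately show "ideal (C n) R \<and> saturated R P2 (C n) \<and> sat P2 B \<subseteq> C n \<and> C (Suc n) \<subseteq> C n"
        using C by blast
    qed
    then obtain n where n: "C (Suc n) = C n" by blast
    \<comment> \<open>Locally at \<open>P2\<close> an element \<open>u\<close> of \<open>D n\<close>
      is \<open>v + r x\<close> with \<open>v \<in> D (Suc n)\<close>. As \<open>x\<close> is
      outside \<open>P1\<close> and \<open>D n\<close> is saturated there,
      \<open>r \<in> D n\<close>; so \<open>D n\<close> is \<open>D (Suc n) + x D n\<close>, and
      Nakayama at \<open>P2\<close> applies.\<close>
    have DD: "D (Suc n) = D n"
    proof (rule nakayama[OF P2 D(1) D(1) Dmono sD2 sD2])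
      fix u assume u: "u \<in> D n"
      then have "u \<in> C (Suc n)" unfolding n using DC by blast
      then obtain s v r where c: "s \<in> carrier R - P2" "v \<in> D (Suc n)" "r \<in> carrier R"
        "s \<otimes> u = v \<oplus> r \<otimes> x"
        unfolding C_def mem_sat_Idl_insert[OF P2 D(1) xc] by blast
      have carr: "u \<in> carrier R" "v \<in> carrier R" "s \<in> carrier R"
        using ideal_carrier[OF D(1) u] ideal_carrier[OF D(1) c(2)] c(1) by auto
      have "x \<otimes> r = s \<otimes> u \<ominus> v" unfolding c(4) using carr c(3) xc by algebra
      also have "\<dots> \<in> D n" using Dmono[of n] c(2) ideal_lmult[OF D(1) u carr(3)] by (intro ideal_minus[OF D(1)]) auto
      finally have "r \<in> D n" using saturatedD[OF D(2) _ c(3)] x1 xc by blast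
      then have "x \<otimes> r \<in> P2 \<cdot> D n" by (rule ideal_prod.prod[OF x])
      then have "s \<otimes> u \<in> D (Suc n) <+>\<^bsub>R\<^esub> P2 \<cdot> D n"
        unfolding mem_set_add c(4) m_comm[OF c(3) xc] using c(2) by blast
      then show "\<exists>s\<in>carrier R - P2. s \<otimes> u \<in> D (Suc n) <+>\<^bsub>R\<^esub> P2 \<cdot> D n" using c(1) by blast
    qed
    \<comment> \<open>Now Nakayama at \<open>P1\<close>: \<open>D n = D (Suc n)\<close> is
      \<open>P0 + P1^(n+1)\<close> up to saturation, and \<open>P1^(n+1)\<close> lies in
      \<open>P1 \<cdot> D n\<close>. The outcome puts \<open>P1^n\<close>, hence \<open>P1\<close>,
      inside \<open>P0\<close>.\<close>
    have "P0 = D n"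
    proof (rule nakayama[OF P1 I0 D(1) P0D _ D(2)])
      show "saturated R P1 P0" by (rule saturated_prime[OF P1 P0]) (use P01 in blast)
      fix u assume "u \<in> D n"
      then have "u \<in> D (Suc n)" unfolding DD .
      then obtain s where s: "s \<in> carrier R - P1" "s \<otimes> u \<in> A (Suc n)"
        unfolding D_def mem_sat[OF P1 A] by blast
      have "ideal_power R P1 (Suc n) \<subseteq> P1 \<cdot> D n"
        unfolding ideal_power_Suc
      proof (rule ideal_prod_subset[OF ideal_prod_is_ideal[OF I1 D(1)]])
        fix i j assume i: "i \<in> ideal_power R P1 n" and j: "j \<in> P1"
        have "j \<otimes> i \<in> P1 \<cdot> D n" using powD i by (intro ideal_prod.prod[OF j]) auto
        then show "i \<otimes> j \<in> P1 \<cdot> D n"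
          using m_comm ideal_carrier[OF I1 j] ideal_carrier[OF ideal_power_ideal[OF I1] i] by metis
      qed
      then have "A (Suc n) \<subseteq> P0 <+>\<^bsub>R\<^esub> P1 \<cdot> D n" unfolding A_def subset_iff mem_set_add by blast
      then show "\<exists>s\<in>carrier R - P1. s \<otimes> u \<in> P0 <+>\<^bsub>R\<^esub> P1 \<cdot> D n" using s by blast
    qed
    then have "y \<in> P0" if "y \<in> P1" for y
      using prime_pow_mem[OF P0 ideal_carrier[OF I1 that]] nat_pow_mem_ideal_power[OF I1 that] powD by blast
    then show False using P01 by blast
  qed
qed

text \<open>The principal ideal theorem, applied to the last three primes, replaces the last but one
  by a prime containing \<open>x\<close>; the chain below it is treated by induction. The ends and
  the length do not change.\<close>

lemma prime_chain_shift:
  assumes "prime_chain R P (Suc n)" "x \<in> P (Suc n)"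
  shows "\<exists>Q. prime_chain R Q (Suc n) \<and> Q 0 = P 0 \<and> x \<in> Q 1 \<and> Q (Suc n) = P (Suc n)"
  using assms
proof (induction n arbitrary: P)
  case 0
  then show ?case by auto
next
  case (Suc n)
  note ch = prime_chainD[OF Suc.prems(1)]
  have "P n \<subset> P (Suc n)" "P (Suc n) \<subset> P (Suc (Suc n))" by (rule ch; simp)+
  moreover have "primeideal (P n) R" "primeideal (P (Suc n)) R" "primeideal (P (Suc (Suc n))) R"
    by (rule ch; simp)+
  ultimately obtain P' where P': "primeideal P' R" "x \<in> P'" "P n \<subset> P'" "P' \<subset> P (Suc (Suc n))"
    using krull_principal_ideal Suc.prems(2) by metis
  define P1 where "P1 = P(Suc n := P')"
  have "prime_chain R P1 (Suc n)"
    unfolding prime_chain_def P1_def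
  proof (intro conjI allI impI)
    fix i assume "i \<le> Suc n" then show "primeideal ((P(Suc n := P')) i) R" using ch(1)[of i] P'(1) by auto
  next
    fix i assume i: "i < Suc n"
    then show "(P(Suc n := P')) i \<subset> (P(Suc n := P')) (Suc i)"
      using ch(2)[of i] P'(3) by (cases "i = n") auto
  qed
  moreover have "x \<in> P1 (Suc n)" using P' by (simp add: P1_def)
  ultimately obtain Q where Q: "prime_chain R Q (Suc n)" "Q 0 = P1 0" "x \<in> Q 1" "Q (Suc n) = P1 (Suc n)"
    using Suc.IH by blast
  define Q1 where "Q1 = Q(Suc (Suc n) := P (Suc (Suc n)))"
  have "prime_chain R Q1 (Suc (Suc n))"
    unfolding prime_chain_def Q1_def
  proof (intro conjI allI impI)
    fix i assume "i \<le> Suc (Suc n)"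
    then show "primeideal ((Q(Suc (Suc n) := P (Suc (Suc n)))) i) R"
      using prime_chainD(1)[OF Q(1), of i] ch(1)[of "Suc (Suc n)"] by auto
  next
    fix i assume "i < Suc (Suc n)"
    then show "(Q(Suc (Suc n) := P (Suc (Suc n)))) i \<subset> (Q(Suc (Suc n) := P (Suc (Suc n)))) (Suc i)"
      using prime_chainD(2)[OF Q(1), of i] Q(4) P'(4) by (cases "i = Suc n") (auto simp: P1_def)
  qed
  moreover have "Q1 0 = P 0" "x \<in> Q1 1" "Q1 (Suc (Suc n)) = P (Suc (Suc n))"
    using Q by (auto simp: Q1_def P1_def)
  ultimately show ?case by blast
qed

text \<open>Dropping \<open>Q 0\<close> leaves a chain with one step less, above
  \<open>J + (x)\<close> instead of \<open>J\<close>. This is the induction step of the height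
  estimates.\<close>

lemma prime_chain_shift_into:
  assumes ch: "prime_chain R P (Suc n)" and M: "primeideal M R" and PM: "P (Suc n) \<subseteq> M"
    and J: "ideal J R" "J \<subseteq> P 0" and x: "x \<in> M"
  shows "\<exists>Q. prime_chain R Q (Suc n) \<and> Q 0 = P 0 \<and> Q (Suc n) = M \<and> Idl (insert x J) \<subseteq> Q 1"
proof -
  obtain Q where Q: "prime_chain R Q (Suc n)" "Q 0 = P 0" "x \<in> Q 1" "Q (Suc n) = M"
    using prime_chain_shift[OF prime_chain_top[OF ch M PM], of x] x by auto
  have "J \<subseteq> Q 1" using J(2) prime_chainD(3)[OF Q(1), of 1] Q(2) by auto
  moreover have "ideal (Q 1) R" using prime_chainD(1)[OF Q(1), of 1] by (auto intro: primeideal_ideal)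
  ultimately have "Idl (insert x J) \<subseteq> Q 1" using Q(3) by (intro Idl_insert_subset)
  then show ?thesis using Q by blast
qed

lemma Idl_Un_insert:
  assumes "ideal J R" "insert g G \<subseteq> carrier R"
  shows "Idl (G \<union> Idl (insert g J)) = Idl (insert g G \<union> J)"
  using Idl_Un_Idl[of G "insert g J"] assms ideal_subset_carrier[OF assms(1)] by simp

text \<open>Krull's height theorem for \<open>M / J\<close> in \<open>R / J\<close>: each generator
  is absorbed into \<open>J\<close> at the price of the lowest prime.\<close>

lemma height_le_card:
  assumes "finite G" "G \<subseteq> carrier R" "ideal J R" "primeideal M R" "M = Idl (G \<union> J)"
    and "prime_chain R P n" "P n \<subseteq> M" "J \<subseteq> P 0"
  shows "n \<le> card G"
  using assms
proof (induction G arbitrary: J P n rule: finite_induct)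
  case empty
  then have "P n \<subseteq> P 0" by simp
  moreover have "P 0 \<subset> P 1" "P 1 \<subseteq> P n" if "n \<noteq> 0"
    using prime_chainD(2)[OF empty(5), of 0] prime_chainD(4)[OF empty(5), of 1] that by auto
  ultimately show ?case by force
next
  case (insert g G)
  note J = insert.prems(2) and M = insert.prems(3)
  have gc: "g \<in> carrier R" "insert g G \<subseteq> carrier R" using insert.prems(1) by auto
  have gM: "g \<in> M"
    unfolding insert.prems(4) by (rule mem_Idl) (use gc ideal_subset_carrier[OF J] in auto)
  show ?case
  proof (cases n)
    case (Suc m)
    obtain Q where Q: "prime_chain R Q (Suc m)" "Q 0 = P 0" "Q (Suc m) = M" "Idl (insert g J) \<subseteq> Q 1"
      using prime_chain_shift_into[OF _ M _ J _ gM, of P m] insert.prems(5-7) Suc by blast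
    have "m \<le> card G"
    proof (rule insert.IH[OF _ ideal_Idl_insert[OF J gc(1)] M _ prime_chain_Suc[OF Q(1)]])
      show "M = Idl (G \<union> Idl (insert g J))" unfolding insert.prems(4) Idl_Un_insert[OF J gc(2)] ..
    qed (use Q gc in auto)
    then show ?thesis using Suc insert.hyps by simp
  qed simp
qed

text \<open>The equality case of the height estimate in a local ring. Its use is that
  \<open>J\<close> turns out to be prime: this is the proof that a regular local ring, and its
  quotient by part of the parameters, is a domain.\<close>

lemma bottom_of_long_chain:
  assumes "finite G" "G \<subseteq> carrier R" "ideal J R" "primeideal M R" "M = Idl (G \<union> J)"
    and units: "\<And>s. s \<in> carrier R - M \<Longrightarrow> s \<in> Units R"
    and "prime_chain R P (card G)" "P (card G) \<subseteq> M" "J \<subseteq> P 0"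
  shows "P 0 = J"
  using assms(1-5,7-)
proof (induction G arbitrary: J P rule: finite_induct)
  case empty
  then show ?case by auto
next
  case (insert g G)
  note J = insert.prems(2) and M = insert.prems(3)
  have gc: "g \<in> carrier R" "insert g G \<subseteq> carrier R" using insert.prems(1) by auto
  have gM: "g \<in> M"
    unfolding insert.prems(4) by (rule mem_Idl) (use gc ideal_subset_carrier[OF J] in auto)
  have card: "card (insert g G) = Suc (card G)" using insert.hyps by simp
  obtain Q where Q: "prime_chain R Q (Suc (card G))" "Q 0 = P 0" "Q (Suc (card G)) = M"
    "Idl (insert g J) \<subseteq> Q 1"
    using prime_chain_shift_into[OF _ M _ J _ gM, of P "card G"] insert.prems(5-7) card by auto
  have J': "ideal (Idl (insert g J)) R" by (rule ideal_Idl_insert[OF J gc(1)])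
  have MJ': "M = Idl (G \<union> Idl (insert g J))" unfolding insert.prems(4) Idl_Un_insert[OF J gc(2)] ..
  have Q1: "Q 1 = Idl (insert g J)"
    using insert.IH[OF _ J' M MJ' prime_chain_Suc[OF Q(1)]] Q gc by auto
  have Q0: "primeideal (P 0) R" using prime_chainD(1)[OF Q(1), of 0] Q(2) by simp
  note I0 = primeideal_ideal[OF Q0]
  \<comment> \<open>If \<open>g\<close> were in \<open>P 0\<close>, the whole chain would lie above
    \<open>J + (g)\<close>, with one step more than the remaining generators permit.\<close>
  have g0: "g \<notin> P 0"
  proof
    assume "g \<in> P 0"
    then have "Idl (insert g J) \<subseteq> Q 0" unfolding Q(2) using insert.prems(7) by (intro Idl_insert_subset[OF I0])
    then have "Suc (card G) \<le> card G"
      using height_le_card[OF insert.hyps(1) _ J' M MJ' Q(1)] Q(3) gc by auto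
    then show False by simp
  qed
  \<comment> \<open>An element of \<open>P 0\<close> is \<open>j + r g\<close> with
    \<open>j \<in> J\<close>, since \<open>P 0\<close> lies below \<open>Q 1 = J + (g)\<close>. As
    \<open>g\<close> is outside the prime \<open>P 0\<close>, also \<open>r \<in> P 0\<close>; thus
    \<open>P 0\<close> is \<open>J + g P 0\<close> with \<open>g \<in> M\<close>.\<close>
  have "J = P 0"
  proof (rule nakayama[OF M J I0 insert.prems(7)])
    show "saturated R M J" using saturated_local[OF units J] by blast
    show "saturated R M (P 0)" using saturated_local[OF units I0] by blast
    fix u assume u: "u \<in> P 0"
    have "P 0 \<subseteq> Idl (insert g J)" using prime_chainD(2)[OF Q(1), of 0] Q1 Q(2) by auto
    then obtain j r where c: "u = j \<oplus> r \<otimes> g" "j \<in> J" "r \<in> carrier R"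
      using u mem_Idl_insert[OF J gc(1)] by blast
    have carr: "u \<in> carrier R" "j \<in> carrier R" using ideal_carrier[OF I0 u] ideal_carrier[OF J c(2)] .
    have "r \<otimes> g = u \<ominus> j" unfolding c(1) using carr c(3) gc by algebra
    also have "\<dots> \<in> P 0" using insert.prems(7) u c(2) by (intro ideal_minus[OF I0]) auto
    finally have "r \<in> P 0" using primeideal.I_prime[OF Q0 c(3) gc(1)] g0 by blast
    then have "g \<otimes> r \<in> M \<cdot> P 0" by (rule ideal_prod.prod[OF gM])
    then have "u \<in> J <+>\<^bsub>R\<^esub> M \<cdot> P 0" unfolding mem_set_add c(1) m_comm[OF c(3) gc(1)] using c(2) by blast
    then show "\<exists>s\<in>carrier R - M. s \<otimes> u \<in> J <+>\<^bsub>R\<^esub> M \<cdot> P 0"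
      using prime_complement(1)[OF M] carr(1) by (intro bexI[of _ \<one>]) auto
  qed
  then show ?case ..
qed

text \<open>Absorbing the elements of \<open>A\<close> one by one leaves a chain of
  \<open>card (G - A)\<close> steps above \<open>Idl A\<close>, which must start at
  \<open>Idl A\<close>. A redundant generator \<open>x\<close> would violate
  \<open>height_le_card\<close> for the same chain.\<close>

lemma regular_generators_prime:
  assumes fin: "finite G" and Gc: "G \<subseteq> carrier R" and M: "primeideal M R" and MG: "M = Idl G"
    and units: "\<And>s. s \<in> carrier R - M \<Longrightarrow> s \<in> Units R"
    and P: "prime_chain R P (card G)" "P (card G) \<subseteq> M"
    and AG: "A \<subseteq> G"
  shows "primeideal (Idl A) R" and "x \<in> G - A \<Longrightarrow> x \<notin> Idl A"
proof -
  have finA: "finite A" using AG fin by (rule finite_subset)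
  have Ac: "A \<subseteq> carrier R" using AG Gc by blast
  have IA: "ideal (Idl A) R" by (rule genideal_ideal[OF Ac])
  have "\<exists>Q. prime_chain R Q (card G - card A) \<and> Q (card G - card A) \<subseteq> M \<and> Idl A \<subseteq> Q 0"
    using finA AG
  proof (induction A rule: finite_induct)
    case empty
    have "Idl {} \<subseteq> P 0"
      using prime_chainD(1)[OF P(1), of 0] by (intro genideal_minimal primeideal_ideal) auto
    then show ?case using P by auto
  next
    case (insert g A)
    then obtain Q where Q: "prime_chain R Q (card G - card A)" "Q (card G - card A) \<subseteq> M" "Idl A \<subseteq> Q 0"
      by blast
    have "card (insert g A) \<le> card G" by (rule card_mono[OF fin insert.prems])
    then have card: "card G - card A = Suc (card G - card (insert g A))" using insert.hyps by simp
    have A: "A \<subseteq> carrier R" "g \<in> carrier R" "g \<in> M" using insert.prems Gc mem_Idl[OF Gc] MG by auto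
    obtain Q' where Q': "prime_chain R Q' (card G - card A)" "Q' (card G - card A) = M"
      "Idl (insert g (Idl A)) \<subseteq> Q' 1"
      using prime_chain_shift_into[OF _ M _ genideal_ideal[OF A(1)] _ A(3), of Q] Q unfolding card by blast
    have "Idl (insert g A) \<subseteq> Idl (insert g (Idl A))"
      by (rule subset_Idl_subset) (use genideal_self[OF A(1)] ideal_subset_carrier[OF genideal_ideal[OF A(1)]] A in auto)
    then show ?case using Q' prime_chain_Suc[of Q'] unfolding card by fastforce
  qed
  then obtain Q where Q: "prime_chain R Q (card G - card A)" "Q (card G - card A) \<subseteq> M" "Idl A \<subseteq> Q 0"
    by blast
  have card: "card (G - A) = card G - card A" by (rule card_Diff_subset[OF finA AG])
  have "Idl ((G - A) \<union> Idl A) = Idl ((G - A) \<union> A)" using Gc Ac by (intro Idl_Un_Idl) auto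
  then have M': "M = Idl ((G - A) \<union> Idl A)" unfolding MG using AG by (simp add: Un_absorb2)
  have "Q 0 = Idl A"
    by (rule bottom_of_long_chain[OF _ _ IA M M' units]) (use fin Gc Q card in auto)
  then show "primeideal (Idl A) R" using prime_chainD(1)[OF Q(1), of 0] by simp
  show "x \<notin> Idl A" if x: "x \<in> G - A"
  proof
    assume "x \<in> Idl A"
    then have "(G - A) \<union> Idl A = (G - A - {x}) \<union> Idl A" by auto
    then have "M = Idl ((G - A - {x}) \<union> Idl A)" using M' by simp
    then have "card G - card A \<le> card (G - A - {x})"
      using fin Gc Q by (intro height_le_card[OF _ _ IA M _ Q]) auto
    moreover have "card (G - A - {x}) < card (G - A)" by (rule psubset_card_mono) (use fin x in auto)
    ultimately show False using card by simp
  qed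
qed

end

section \<open>The Frobenius endomorphism\<close>

context cring
begin

lemma binomial:
  assumes a: "a \<in> carrier R" and b: "b \<in> carrier R"
  shows "(a \<oplus> b) [^] (n::nat) = (\<Oplus>k\<in>{..n}. add_pow R (n choose k) (a [^] k \<otimes> b [^] (n - k)))"
proof (induction n)
  case 0
  then show ?case by simp
next
  case (Suc n)
  \<comment> \<open>Pascal's rule splits the term with index \<open>Suc k\<close> into
    \<open>a \<otimes> f k\<close> and \<open>g (Suc k)\<close>, and \<open>g k\<close> is
    \<open>b \<otimes> f k\<close> for \<open>k \<le> n\<close>. The surplus
    \<open>g (Suc n)\<close> vanishes with its binomial coefficient.\<close>
  define g where "g k = add_pow R (n choose k) (a [^] k \<otimes> b [^] (Suc n - k))" for k
  define f where "f k = add_pow R (n choose k) (a [^] k \<otimes> b [^] (n - k))" for k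
  have [simp]: "f k \<in> carrier R" "g k \<in> carrier R" for k using a b by (auto simp: f_def g_def)
  have fs: "(\<Oplus>k\<in>{..n}. f k) \<in> carrier R" by (rule finsum_closed) simp
  have gf: "g k = b \<otimes> f k" if "k \<le> n" for k
    using that a b by (simp add: g_def f_def add_pow_rdistr Suc_diff_le m_ac)
  have "(\<Oplus>k\<in>{..Suc n}. add_pow R (Suc n choose k) (a [^] k \<otimes> b [^] (Suc n - k)))
      = (\<Oplus>k\<in>{..n}. add_pow R (Suc n choose Suc k) (a [^] Suc k \<otimes> b [^] (n - k))) \<oplus> b [^] Suc n"
    using a b by (subst finsum_Suc2) auto
  also have "(\<Oplus>k\<in>{..n}. add_pow R (Suc n choose Suc k) (a [^] Suc k \<otimes> b [^] (n - k)))
      = (\<Oplus>k\<in>{..n}. a \<otimes> f k \<oplus> g (Suc k))"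
    using a b by (intro finsum_cong') (auto simp: f_def g_def add_pow_rdistr m_ac simp flip: add.nat_pow_mult)
  also have "\<dots> = a \<otimes> (\<Oplus>k\<in>{..n}. f k) \<oplus> (\<Oplus>k\<in>{..n}. g (Suc k))"
    using a by (simp add: finsum_rdistr)
  also have "(a \<otimes> (\<Oplus>k\<in>{..n}. f k) \<oplus> (\<Oplus>k\<in>{..n}. g (Suc k))) \<oplus> b [^] Suc n
      = a \<otimes> (\<Oplus>k\<in>{..n}. f k) \<oplus> ((\<Oplus>k\<in>{..n}. g (Suc k)) \<oplus> g 0)"
    using a b by (simp add: a_assoc g_def)
  also have "(\<Oplus>k\<in>{..n}. g (Suc k)) \<oplus> g 0 = (\<Oplus>k\<in>{..Suc n}. g k)"
    by (rule finsum_Suc2[symmetric]) auto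
  also have "\<dots> = g (Suc n) \<oplus> (\<Oplus>k\<in>{..n}. g k)" by (rule finsum_Suc) auto
  also have "g (Suc n) = \<zero>" by (simp add: g_def binomial_eq_0)
  also have "(\<Oplus>k\<in>{..n}. g k) = (\<Oplus>k\<in>{..n}. b \<otimes> f k)" by (rule finsum_cong') (use b gf in auto)
  also have "\<dots> = b \<otimes> (\<Oplus>k\<in>{..n}. f k)" using b by (simp add: finsum_rdistr)
  also have "a \<otimes> (\<Oplus>k\<in>{..n}. f k) \<oplus> (\<zero> \<oplus> b \<otimes> (\<Oplus>k\<in>{..n}. f k)) = (\<Oplus>k\<in>{..n}. f k) \<otimes> (a \<oplus> b)"
    using a b fs by algebra
  also have "\<dots> = (a \<oplus> b) [^] Suc n" using Suc.IH by (simp add: f_def)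
  finally show ?case ..
qed

lemma finsum_zero': "(\<And>i. i \<in> A \<Longrightarrow> f i = \<zero>) \<Longrightarrow> (\<Oplus>i\<in>A. f i) = \<zero>"
  by (rule add.finprod_one_eqI)

lemma lin_comb_add:
  assumes "finite I" "g \<in> I \<rightarrow> carrier R" "c \<in> I \<rightarrow> carrier R" "d \<in> I \<rightarrow> carrier R" "r \<in> carrier R"
  shows "(\<Oplus>i\<in>I. (c i \<oplus> r \<otimes> d i) \<otimes> g i) = (\<Oplus>i\<in>I. c i \<otimes> g i) \<oplus> r \<otimes> (\<Oplus>i\<in>I. d i \<otimes> g i)"
proof -
  have "(\<Oplus>i\<in>I. (c i \<oplus> r \<otimes> d i) \<otimes> g i) = (\<Oplus>i\<in>I. c i \<otimes> g i \<oplus> r \<otimes> (d i \<otimes> g i))"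
    using assms by (intro finsum_cong') (auto simp: Pi_iff l_distr m_assoc)
  also have "\<dots> = (\<Oplus>i\<in>I. c i \<otimes> g i) \<oplus> (\<Oplus>i\<in>I. r \<otimes> (d i \<otimes> g i))"
    using assms by (intro finsum_addf) (auto simp: Pi_iff)
  also have "(\<Oplus>i\<in>I. r \<otimes> (d i \<otimes> g i)) = r \<otimes> (\<Oplus>i\<in>I. d i \<otimes> g i)"
    using assms by (intro finsum_rdistr[symmetric]) (auto simp: Pi_iff)
  finally show ?thesis .
qed

lemma ideal_finsum:
  assumes "ideal J R" "finite I" "\<And>i. i \<in> I \<Longrightarrow> f i \<in> J"
  shows "(\<Oplus>i\<in>I. f i) \<in> J"
  using assms(2,3)
proof (induction I rule: finite_induct)
  case empty
  then show ?case using ideal_zero[OF assms(1)] by simp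
next
  case (insert i I)
  then have "f \<in> insert i I \<rightarrow> carrier R" using ideal_carrier[OF assms(1)] by blast
  then show ?case using insert ideal_add[OF assms(1)] by (subst finsum_insert) auto
qed

lemma Idl_image:
  assumes "finite I" "g \<in> I \<rightarrow> carrier R"
  shows "Idl (g ` I) = {\<Oplus>i\<in>I. c i \<otimes> g i |c. c \<in> I \<rightarrow> carrier R}" (is "_ = ?L")
proof (rule subset_antisym)
  have gI: "g ` I \<subseteq> carrier R" using assms(2) by auto
  show "?L \<subseteq> Idl (g ` I)"
  proof safe
    fix c assume c: "c \<in> I \<rightarrow> carrier R"
    show "(\<Oplus>i\<in>I. c i \<otimes> g i) \<in> Idl (g ` I)"
      using c mem_Idl[OF gI] by (intro ideal_finsum genideal_ideal[OF gI] assms(1) ideal_lmult[OF genideal_ideal[OF gI]]) auto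
  qed
  have L: "ideal ?L R"
  proof (rule idealI')
    show "?L \<subseteq> carrier R"
    proof safe
      fix c assume "c \<in> I \<rightarrow> carrier R"
      then show "(\<Oplus>i\<in>I. c i \<otimes> g i) \<in> carrier R" using assms(2) by (intro finsum_closed) (auto simp: Pi_iff)
    qed
    have "\<zero> = (\<Oplus>i\<in>I. \<zero> \<otimes> g i)" using assms(2) by (subst finsum_zero') (auto simp: Pi_iff)
    moreover have "(\<lambda>_. \<zero>) \<in> I \<rightarrow> carrier R" by simp
    ultimately show "\<zero> \<in> ?L" by (intro CollectI exI conjI)
  next
    fix x y assume "x \<in> ?L" "y \<in> ?L"
    then obtain c d where c: "x = (\<Oplus>i\<in>I. c i \<otimes> g i)" "c \<in> I \<rightarrow> carrier R"
      "y = (\<Oplus>i\<in>I. d i \<otimes> g i)" "d \<in> I \<rightarrow> carrier R" by blast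
    then have "x \<oplus> y = (\<Oplus>i\<in>I. (c i \<oplus> \<one> \<otimes> d i) \<otimes> g i)"
      using assms by (subst lin_comb_add) (auto simp: Pi_iff)
    moreover have "(\<lambda>i. c i \<oplus> \<one> \<otimes> d i) \<in> I \<rightarrow> carrier R" using c by auto
    ultimately show "x \<oplus> y \<in> ?L" by (intro CollectI exI conjI)
  next
    fix x r assume "x \<in> ?L" and r: "r \<in> carrier R"
    then obtain c where c: "x = (\<Oplus>i\<in>I. c i \<otimes> g i)" "c \<in> I \<rightarrow> carrier R" by blast
    have "r \<otimes> x = (\<Oplus>i\<in>I. r \<otimes> (c i \<otimes> g i))"
      unfolding c(1) using c(2) r assms by (intro finsum_rdistr) (auto simp: Pi_iff)
    also have "\<dots> = (\<Oplus>i\<in>I. (r \<otimes> c i) \<otimes> g i)"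
      using c(2) r assms(2) by (intro finsum_cong') (auto simp: Pi_iff m_assoc)
    finally have "r \<otimes> x = (\<Oplus>i\<in>I. (r \<otimes> c i) \<otimes> g i)" .
    moreover have "(\<lambda>i. r \<otimes> c i) \<in> I \<rightarrow> carrier R" using c r by auto
    ultimately show "r \<otimes> x \<in> ?L" by (intro CollectI exI conjI)
  qed
  have "g j \<in> ?L" if j: "j \<in> I" for j
  proof -
    have "(\<Oplus>i\<in>I. (if j = i then \<one> else \<zero>) \<otimes> g i) = (\<Oplus>i\<in>I. if j = i then g i else \<zero>)"
      using assms(2) by (intro finsum_cong') (auto simp: Pi_iff)
    also have "\<dots> = g j" by (rule finsum_singleton[OF j assms])
    finally have "g j = (\<Oplus>i\<in>I. (if j = i then \<one> else \<zero>) \<otimes> g i)" ..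
    moreover have "(\<lambda>i. if j = i then \<one> else \<zero>) \<in> I \<rightarrow> carrier R" by auto
    ultimately show ?thesis by (intro CollectI exI conjI)
  qed
  then show "Idl (g ` I) \<subseteq> ?L" by (intro genideal_minimal[OF L]) auto
qed

lemma frobenius_power_ideal: "I \<subseteq> carrier R \<Longrightarrow> ideal (frobenius_power R I q) R"
  unfolding frobenius_power_def by (intro genideal_ideal) auto

lemma nat_pow_mem_frobenius_power:
  "I \<subseteq> carrier R \<Longrightarrow> f \<in> I \<Longrightarrow> f [^] q \<in> frobenius_power R I q"
  unfolding frobenius_power_def by (rule mem_Idl) auto

lemma frobenius_power_subset:
  assumes "ideal J R" "\<And>f. f \<in> I \<Longrightarrow> f [^] q \<in> J" shows "frobenius_power R I q \<subseteq> J"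
  unfolding frobenius_power_def using assms by (intro genideal_minimal) auto

lemma frobenius_power_mono:
  assumes "I \<subseteq> J" "J \<subseteq> carrier R" shows "frobenius_power R I q \<subseteq> frobenius_power R J q"
  using assms nat_pow_mem_frobenius_power by (intro frobenius_power_subset frobenius_power_ideal) auto

lemma frobenius_power_le:
  assumes "ideal I R" "0 < q" shows "frobenius_power R I q \<subseteq> I"
proof (rule frobenius_power_subset[OF assms(1)])
  fix f assume f: "f \<in> I"
  obtain k where "q = Suc k" using assms(2) gr0_conv_Suc by auto
  then show "f [^] q \<in> I" using f ideal_carrier[OF assms(1) f] by (auto intro: ideal_lmult[OF assms(1)])
qed

end

locale frobenius_ring = cring +
  fixes p :: nat
  assumes p_prime: "Factorial_Ring.prime p" and p_zero: "add_pow R p \<one> = \<zero>"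

context frobenius_ring
begin

lemma p_pos: "0 < p" using p_prime prime_gt_0_nat by blast

lemma multiple_p_zero:
  assumes "p dvd n" "x \<in> carrier R" shows "add_pow R n x = \<zero>"
proof -
  obtain m where m: "n = p * m" using assms(1) by (elim dvdE)
  have "add_pow R p x = (add_pow R p \<one>) \<otimes> x" using assms(2) by (simp add: add_pow_ldistr)
  then have "add_pow R p x = \<zero>" using assms(2) by (simp add: p_zero)
  then show ?thesis unfolding m using assms(2) by (simp flip: add.nat_pow_pow)
qed

lemma frob_add:
  assumes a: "a \<in> carrier R" and b: "b \<in> carrier R"
  shows "(a \<oplus> b) [^] p = a [^] p \<oplus> b [^] p"
proof -
  define f where "f k = add_pow R (p choose k) (a [^] k \<otimes> b [^] (p - k))" for k
  have f: "f k \<in> carrier R" for k using a b by (auto simp: f_def)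
  obtain q where q: "p = Suc (Suc q)" using prime_ge_2_nat[OF p_prime] by (metis add_2_eq_Suc le_Suc_ex)
  have mid: "f (Suc k) = \<zero>" if "k \<le> q" for k
    unfolding f_def using that a b p_prime
    by (intro multiple_p_zero dvd_choose_prime) (auto simp: q)
  have "(a \<oplus> b) [^] p = (\<Oplus>k\<in>{..Suc (Suc q)}. f k)" unfolding binomial[OF a b] f_def q ..
  also have "\<dots> = f p \<oplus> ((\<Oplus>k\<in>{..q}. f (Suc k)) \<oplus> f 0)"
    unfolding q using f by (subst finsum_Suc, simp, subst finsum_Suc2, simp_all)
  also have "(\<Oplus>k\<in>{..q}. f (Suc k)) = \<zero>" by (rule finsum_zero') (use mid in auto)
  also have "f p \<oplus> (\<zero> \<oplus> f 0) = a [^] p \<oplus> b [^] p" using a b by (simp add: f_def)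
  finally show ?thesis .
qed

lemma frob_mult: "a \<in> carrier R \<Longrightarrow> b \<in> carrier R \<Longrightarrow> (a \<otimes> b) [^] p = a [^] p \<otimes> b [^] p"
  by (rule nat_pow_distrib)

lemma frob_zero: "\<zero> [^] p = \<zero>"
  using p_pos by (simp add: nat_pow_zero)

lemma frob_uminus:
  assumes "a \<in> carrier R" shows "(\<ominus> a) [^] p = \<ominus> (a [^] p)"
proof -
  have "(\<ominus> a) [^] p \<oplus> a [^] p = \<zero>"
    using frob_add[of "\<ominus> a" a] assms frob_zero by (simp add: l_neg)
  then show ?thesis using assms minus_equality[of "(\<ominus> a) [^] p" "a [^] p"] by simp
qed

lemma frob_finsum:
  assumes "finite I" "f \<in> I \<rightarrow> carrier R"
  shows "(\<Oplus>i\<in>I. f i) [^] p = (\<Oplus>i\<in>I. f i [^] p)"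
  using assms by (induction I rule: finite_induct) (auto simp: frob_zero frob_add Pi_iff)

text \<open>Additivity of the Frobenius makes the \<open>p\<close>-th powers of the generators
  enough. From here on, generators are families, so that relations between them have an index
  set.\<close>

lemma frobenius_power_image:
  assumes "finite I" "g \<in> I \<rightarrow> carrier R"
  shows "frobenius_power R (Idl (g ` I)) p = Idl ((\<lambda>i. g i [^] p) ` I)"
proof (rule subset_antisym)
  have gI: "g ` I \<subseteq> carrier R" and gpI: "(\<lambda>i. g i [^] p) ` I \<subseteq> carrier R" using assms(2) by auto
  note I = genideal_ideal[OF gpI]
  show "frobenius_power R (Idl (g ` I)) p \<subseteq> Idl ((\<lambda>i. g i [^] p) ` I)"
  proof (rule frobenius_power_subset[OF I])
    fix f assume "f \<in> Idl (g ` I)"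
    then obtain c where c: "f = (\<Oplus>i\<in>I. c i \<otimes> g i)" "c \<in> I \<rightarrow> carrier R"
      unfolding Idl_image[OF assms] by blast
    have "f [^] p = (\<Oplus>i\<in>I. (c i \<otimes> g i) [^] p)"
      unfolding c(1) using c(2) assms by (intro frob_finsum) (auto simp: Pi_iff)
    also have "\<dots> = (\<Oplus>i\<in>I. c i [^] p \<otimes> g i [^] p)"
      using c(2) assms(2) by (intro finsum_cong') (auto simp: Pi_iff frob_mult)
    also have "\<dots> \<in> Idl ((\<lambda>i. g i [^] p) ` I)"
      using c(2) mem_Idl[OF gpI] by (intro ideal_finsum[OF I assms(1)] ideal_lmult[OF I]) (auto simp: Pi_iff)
    finally show "f [^] p \<in> Idl ((\<lambda>i. g i [^] p) ` I)" .
  qed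
  show "Idl ((\<lambda>i. g i [^] p) ` I) \<subseteq> frobenius_power R (Idl (g ` I)) p"
    using mem_Idl[OF gI] ideal_subset_carrier[OF genideal_ideal[OF gI]]
    by (intro genideal_minimal[OF frobenius_power_ideal]) (auto intro: nat_pow_mem_frobenius_power)
qed

end

section \<open>Powers of regular parameters\<close>

context cring
begin

text \<open>As \<open>u\<close> is regular modulo \<open>K\<close>, the successive quotients of the
  ideals \<open>K + (u^i)\<close> are copies of \<open>R / (K + (u))\<close>, on which
  \<open>x\<close> is regular. In the induction, \<open>z = b' + c' u^n\<close>, and cancelling
  \<open>u^n\<close> puts \<open>x c'\<close> into \<open>K + (u)\<close>.\<close>

lemma regular_power:
  assumes K: "ideal K R" and u: "u \<in> carrier R" and x: "x \<in> carrier R"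
    and ureg: "\<And>z. z \<in> carrier R \<Longrightarrow> u \<otimes> z \<in> K \<Longrightarrow> z \<in> K"
    and xreg: "\<And>z. z \<in> carrier R \<Longrightarrow> x \<otimes> z \<in> Idl (insert u K) \<Longrightarrow> z \<in> Idl (insert u K)"
  shows "z \<in> carrier R \<Longrightarrow> x \<otimes> z \<in> Idl (insert (u [^] (n::nat)) K) \<Longrightarrow> z \<in> Idl (insert (u [^] n) K)"
proof (induction n arbitrary: z)
  case 0
  have "Idl (insert \<one> K) = carrier R"
    using subset_Idl_insert[OF K one_closed] ideal.one_imp_carrier[OF ideal_Idl_insert[OF K one_closed]] by blast
  then show ?case using 0 by simp
next
  case (Suc n)
  have un: "u [^] n \<in> carrier R" "u [^] Suc n \<in> carrier R" using u by auto
  have unreg: "z \<in> K" if "z \<in> carrier R" "u [^] m \<otimes> z \<in> K" for z and m :: nat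
    using that
  proof (induction m arbitrary: z)
    case (Suc m)
    have "u [^] m \<otimes> (u \<otimes> z) \<in> K" using Suc.prems(2) m_assoc[of "u [^] m" u z] Suc.prems(1) u by simp
    then have "u \<otimes> z \<in> K" using Suc.IH[of "u \<otimes> z"] Suc.prems(1) u by simp
    then show ?case by (rule ureg[OF Suc.prems(1)])
  qed simp
  obtain b c where b: "b \<in> K" and c: "c \<in> carrier R" and xz: "x \<otimes> z = b \<oplus> c \<otimes> u [^] Suc n"
    using Suc.prems(2) mem_Idl_insert[OF K un(2)] by blast
  have bc: "b \<in> carrier R" using ideal_carrier[OF K b] .
  have "x \<otimes> z = b \<oplus> (c \<otimes> u) \<otimes> u [^] n" unfolding xz using bc c u by (simp add: m_ac)
  then have "x \<otimes> z \<in> Idl (insert (u [^] n) K)"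
    unfolding mem_Idl_insert[OF K un(1)] using b c u by blast
  then obtain b' c' where b': "b' \<in> K" and c': "c' \<in> carrier R" and z: "z = b' \<oplus> c' \<otimes> u [^] n"
    using Suc.IH[OF Suc.prems(1)] mem_Idl_insert[OF K un(1)] by blast
  have b'c: "b' \<in> carrier R" using ideal_carrier[OF K b'] .
  have "x \<otimes> b' \<oplus> (x \<otimes> c') \<otimes> u [^] n = b \<oplus> (c \<otimes> u) \<otimes> u [^] n"
    using \<open>x \<otimes> z = b \<oplus> (c \<otimes> u) \<otimes> u [^] n\<close> unfolding z using x b'c c' un by (simp add: r_distr m_assoc)
  then have "u [^] n \<otimes> (x \<otimes> c' \<ominus> c \<otimes> u) = b \<ominus> x \<otimes> b'"
  proof -
    assume eq: "x \<otimes> b' \<oplus> (x \<otimes> c') \<otimes> u [^] n = b \<oplus> (c \<otimes> u) \<otimes> u [^] n"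
    have "u [^] n \<otimes> (x \<otimes> c' \<ominus> c \<otimes> u) = (x \<otimes> b' \<oplus> (x \<otimes> c') \<otimes> u [^] n) \<ominus> x \<otimes> b' \<ominus> (c \<otimes> u) \<otimes> u [^] n"
      using x b'c c' c un(1) u by algebra
    also have "\<dots> = b \<ominus> x \<otimes> b'" unfolding eq using x b'c bc c un(1) u by algebra
    finally show ?thesis .
  qed
  also have "\<dots> \<in> K" by (intro ideal_minus[OF K b] ideal_lmult[OF K b' x])
  finally have "x \<otimes> c' \<ominus> c \<otimes> u \<in> K" using unreg x c' c u by auto
  moreover have "x \<otimes> c' = (x \<otimes> c' \<ominus> c \<otimes> u) \<oplus> c \<otimes> u" using x c' c u by algebra
  ultimately have "x \<otimes> c' \<in> Idl (insert u K)" unfolding mem_Idl_insert[OF K u] using c by blast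
  then obtain k d where k: "k \<in> K" and d: "d \<in> carrier R" and c'eq: "c' = k \<oplus> d \<otimes> u"
    using xreg[OF c'] mem_Idl_insert[OF K u] by blast
  have "z = (b' \<oplus> u [^] n \<otimes> k) \<oplus> d \<otimes> u [^] Suc n"
    unfolding z c'eq nat_pow_Suc using b'c d u ideal_carrier[OF K k] un(1) by algebra
  moreover have "b' \<oplus> u [^] n \<otimes> k \<in> K" by (intro ideal_add[OF K b'] ideal_lmult[OF K k un(1)])
  ultimately show ?case unfolding mem_Idl_insert[OF K un(2)] using d by blast
qed

text \<open>\<open>regular_power\<close> asks for regularity modulo \<open>u\<close> itself as well
  as without \<open>u\<close>. So the induction must admit mixed exponents: \<open>A\<close>
  collects the parameters with exponent 1, and \<open>u\<close> either disappears or moves to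
  \<open>A\<close>. With \<open>B\<close> empty, \<open>Idl A\<close> is a prime without
  \<open>x\<close>.\<close>

lemma parameter_power_regular:
  assumes Gc: "G \<subseteq> carrier R"
    and prime: "\<And>A. A \<subseteq> G \<Longrightarrow> primeideal (Idl A) R" "\<And>A x. A \<subseteq> G \<Longrightarrow> x \<in> G - A \<Longrightarrow> x \<notin> Idl A"
    and "finite B" "B \<subseteq> G" "A \<subseteq> G" "A \<inter> B = {}" "x \<in> G - (A \<union> B)" "z \<in> carrier R"
    and "x \<otimes> z \<in> Idl (A \<union> (\<lambda>b. b [^] (n::nat)) ` B)"
  shows "z \<in> Idl (A \<union> (\<lambda>b. b [^] n) ` B)"
  using assms(4-)
proof (induction B arbitrary: A x z rule: finite_induct)
  case empty
  then have "x \<in> carrier R" "x \<notin> Idl A" using Gc prime(2)[of A x] by auto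
  then show ?case using primeideal.I_prime[OF prime(1)[of A], of x z] empty by auto
next
  case (insert u B)
  let ?pw = "\<lambda>B. (\<lambda>b. b [^] n) ` B"
  define K where "K = Idl (A \<union> ?pw B)"
  have c: "A \<union> ?pw B \<subseteq> carrier R" "u \<in> carrier R" "x \<in> carrier R" using insert.prems Gc by auto
  have K: "ideal K R" unfolding K_def by (rule genideal_ideal[OF c(1)])
  have ins: "Idl (insert v K) = Idl (insert v (A \<union> ?pw B))" if "v \<in> carrier R" for v
    unfolding K_def using Idl_Un_Idl[of "{v}" "A \<union> ?pw B"] that c by simp
  have "z \<in> Idl (insert (u [^] n) K)"
  proof (rule regular_power[OF K c(2,3) _ _ insert.prems(5)])
    fix z assume "z \<in> carrier R" "u \<otimes> z \<in> K"
    moreover have "B \<subseteq> G" "A \<inter> B = {}" "u \<in> G - (A \<union> B)" using insert.prems insert.hyps by auto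
    ultimately show "z \<in> K" unfolding K_def using insert.IH[OF _ insert.prems(2)] by blast
  next
    fix z assume "z \<in> carrier R" "x \<otimes> z \<in> Idl (insert u K)"
    moreover have "B \<subseteq> G" "insert u A \<subseteq> G" "insert u A \<inter> B = {}" "x \<in> G - (insert u A \<union> B)"
      using insert.prems insert.hyps by auto
    ultimately show "z \<in> Idl (insert u K)"
      unfolding ins[OF c(2)] using insert.IH[of "insert u A" x z] by simp
  next
    show "x \<otimes> z \<in> Idl (insert (u [^] n) K)" using insert.prems(6) ins[of "u [^] n"] c by simp
  qed
  then show ?case using ins[of "u [^] n"] c by simp
qed

text \<open>Exactness of the Koszul complex in degree one.\<close>

lemma koszul:
  assumes "finite B" "z \<in> B \<rightarrow> carrier R" "\<And>b i. b \<in> B \<Longrightarrow> H b i \<in> carrier R"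
    and reg: "\<And>B' u r. B' \<subseteq> B \<Longrightarrow> u \<in> B - B' \<Longrightarrow> r \<in> carrier R \<Longrightarrow> z u \<otimes> r \<in> Idl (z ` B') \<Longrightarrow> r \<in> Idl (z ` B')"
    and W0: "W (\<lambda>_. \<zero>)"
    and Wadd: "\<And>v w r. W v \<Longrightarrow> W w \<Longrightarrow> r \<in> carrier R \<Longrightarrow> W (\<lambda>i. v i \<oplus> r \<otimes> w i)"
    and WH: "\<And>b c. b \<in> B \<Longrightarrow> c \<in> B \<Longrightarrow> W (\<lambda>i. z b \<otimes> H c i \<ominus> z c \<otimes> H b i)"
    and \<beta>: "\<beta> \<in> B \<rightarrow> carrier R" "(\<Oplus>b\<in>B. \<beta> b \<otimes> z b) = \<zero>"
  shows "W (\<lambda>i. \<Oplus>b\<in>B. \<beta> b \<otimes> H b i)"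
  using assms(1-4) WH \<beta>
proof (induction B arbitrary: \<beta> rule: finite_induct)
  case empty
  then show ?case using W0 by simp
next
  case (insert u B)
  have zB: "z \<in> B \<rightarrow> carrier R" and zu: "z u \<in> carrier R" using insert.prems(1) by auto
  have \<beta>B: "\<beta> \<in> B \<rightarrow> carrier R" and \<beta>u: "\<beta> u \<in> carrier R" using insert.prems(5) by auto
  have Hc: "\<And>b i. b \<in> B \<Longrightarrow> H b i \<in> carrier R" "\<And>i. H u i \<in> carrier R" using insert.prems(2) by auto
  have I: "ideal (Idl (z ` B)) R" using zB by (intro genideal_ideal) auto
  have sc: "(\<Oplus>b\<in>B. \<beta> b \<otimes> z b) \<in> carrier R" using zB \<beta>B by (intro finsum_closed) (auto simp: Pi_iff)
  have s0: "\<beta> u \<otimes> z u \<oplus> (\<Oplus>b\<in>B. \<beta> b \<otimes> z b) = \<zero>"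
    using insert.prems(6) insert.hyps zB zu \<beta>B \<beta>u by (subst (asm) finsum_insert) (auto simp: Pi_iff)
  have "z u \<otimes> \<beta> u = \<ominus> (\<Oplus>b\<in>B. \<beta> b \<otimes> z b)"
    using minus_equality[OF s0] sc zu \<beta>u by (simp add: m_comm)
  also have "\<dots> \<in> Idl (z ` B)"
    unfolding Idl_image[OF insert.hyps(1) zB] using \<beta>B
    by (intro ideal_uminus[OF I[unfolded Idl_image[OF insert.hyps(1) zB]]]) blast
  finally have "\<beta> u \<in> Idl (z ` B)"
    using insert.prems(3)[of B u "\<beta> u"] insert.hyps \<beta>u by blast
  then obtain \<gamma> where \<gamma>: "\<gamma> \<in> B \<rightarrow> carrier R" "\<beta> u = (\<Oplus>b\<in>B. \<gamma> b \<otimes> z b)"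
    unfolding Idl_image[OF insert.hyps(1) zB] by blast
  \<comment> \<open>The combination of the Koszul relations \<open>z b e_u - z u e_b\<close> with
    coefficients \<open>\<gamma> b\<close> has \<open>\<beta> u\<close> as coordinate at
    \<open>u\<close>. Subtracting it from \<open>\<beta>\<close> leaves a relation on
    \<open>B\<close>, to which the induction hypothesis applies.\<close>
  have "W (\<lambda>i. \<Oplus>b\<in>B. (\<beta> b \<oplus> z u \<otimes> \<gamma> b) \<otimes> H b i)"
  proof (rule insert.IH)
    show "(\<Oplus>b\<in>B. (\<beta> b \<oplus> z u \<otimes> \<gamma> b) \<otimes> z b) = \<zero>"
      using lin_comb_add[OF insert.hyps(1) zB \<beta>B \<gamma>(1) zu] s0 sc zu \<beta>u
      by (simp add: m_comm a_comm flip: \<gamma>(2))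
    show "(\<lambda>b. \<beta> b \<oplus> z u \<otimes> \<gamma> b) \<in> B \<rightarrow> carrier R" using \<beta>B \<gamma>(1) zu by auto
    fix B' v r assume "B' \<subseteq> B" "v \<in> B - B'" "r \<in> carrier R" "z v \<otimes> r \<in> Idl (z ` B')"
    then show "r \<in> Idl (z ` B')" using insert.prems(3)[of B' v r] by blast
  qed (use zB Hc insert.prems(4) in auto)
  moreover have "W (\<lambda>i. \<Oplus>b\<in>C. \<gamma> b \<otimes> (z b \<otimes> H u i \<ominus> z u \<otimes> H b i))" if "C \<subseteq> B" for C
    using finite_subset[OF that insert.hyps(1)] that
  proof (induction C rule: finite_induct)
    case empty
    then show ?case using W0 by simp
  next
    case (insert b C)
    have b: "b \<in> B" and C: "C \<subseteq> B" using insert.prems by auto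
    have t: "\<gamma> c \<otimes> (z c \<otimes> H u i \<ominus> z u \<otimes> H c i) \<in> carrier R" if "c \<in> B" for c i
    proof -
      have "\<gamma> c \<in> carrier R" "z c \<in> carrier R" using that \<gamma>(1) zB by auto
      then show ?thesis using zu Hc that by simp
    qed
    have "W (\<lambda>i. (\<Oplus>b\<in>C. \<gamma> b \<otimes> (z b \<otimes> H u i \<ominus> z u \<otimes> H b i)) \<oplus> \<gamma> b \<otimes> (z b \<otimes> H u i \<ominus> z u \<otimes> H b i))"
      using insert.IH[OF C] \<open>\<And>b c. b \<in> Set.insert u B \<Longrightarrow> c \<in> Set.insert u B \<Longrightarrow> W (\<lambda>i. z b \<otimes> H c i \<ominus> z c \<otimes> H b i)\<close>[of b u] b \<gamma>(1)
      by (intro Wadd) auto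
    also have "(\<lambda>i. (\<Oplus>b\<in>C. \<gamma> b \<otimes> (z b \<otimes> H u i \<ominus> z u \<otimes> H b i)) \<oplus> \<gamma> b \<otimes> (z b \<otimes> H u i \<ominus> z u \<otimes> H b i))
      = (\<lambda>i. \<Oplus>b\<in>Set.insert b C. \<gamma> b \<otimes> (z b \<otimes> H u i \<ominus> z u \<otimes> H b i))"
    proof
      fix i
      have tC: "(\<lambda>b. \<gamma> b \<otimes> (z b \<otimes> H u i \<ominus> z u \<otimes> H b i)) \<in> C \<rightarrow> carrier R" using t C by blast
      show "(\<Oplus>b\<in>C. \<gamma> b \<otimes> (z b \<otimes> H u i \<ominus> z u \<otimes> H b i)) \<oplus> \<gamma> b \<otimes> (z b \<otimes> H u i \<ominus> z u \<otimes> H b i) =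
        (\<Oplus>b\<in>Set.insert b C. \<gamma> b \<otimes> (z b \<otimes> H u i \<ominus> z u \<otimes> H b i))"
        unfolding finsum_insert[OF insert.hyps tC t[OF b]] using t[OF b] tC by (intro a_comm finsum_closed)
    qed
    finally show ?case .
  qed
  ultimately have "W (\<lambda>i. (\<Oplus>b\<in>B. (\<beta> b \<oplus> z u \<otimes> \<gamma> b) \<otimes> H b i) \<oplus>
      \<one> \<otimes> (\<Oplus>b\<in>B. \<gamma> b \<otimes> (z b \<otimes> H u i \<ominus> z u \<otimes> H b i)))"
    by (intro Wadd) auto
  also have "(\<lambda>i. (\<Oplus>b\<in>B. (\<beta> b \<oplus> z u \<otimes> \<gamma> b) \<otimes> H b i) \<oplus> \<one> \<otimes> (\<Oplus>b\<in>B. \<gamma> b \<otimes> (z b \<otimes> H u i \<ominus> z u \<otimes> H b i)))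
    = (\<lambda>i. \<Oplus>b\<in>Set.insert u B. \<beta> b \<otimes> H b i)"
  proof
    fix i
    have sH: "(\<lambda>b. \<beta> b \<otimes> H b i) \<in> B \<rightarrow> carrier R" and sz: "(\<lambda>b. \<gamma> b \<otimes> z b) \<in> B \<rightarrow> carrier R"
      and tc: "(\<lambda>b. \<gamma> b \<otimes> (z b \<otimes> H u i \<ominus> z u \<otimes> H b i)) \<in> B \<rightarrow> carrier R"
      and uc: "(\<lambda>b. (\<beta> b \<oplus> z u \<otimes> \<gamma> b) \<otimes> H b i) \<in> B \<rightarrow> carrier R"
      using \<beta>B \<gamma>(1) Hc zB zu by (auto simp: Pi_iff)
    have "(\<Oplus>b\<in>B. (\<beta> b \<oplus> z u \<otimes> \<gamma> b) \<otimes> H b i) \<oplus> \<one> \<otimes> (\<Oplus>b\<in>B. \<gamma> b \<otimes> (z b \<otimes> H u i \<ominus> z u \<otimes> H b i))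
      = (\<Oplus>b\<in>B. (\<beta> b \<oplus> z u \<otimes> \<gamma> b) \<otimes> H b i \<oplus> \<gamma> b \<otimes> (z b \<otimes> H u i \<ominus> z u \<otimes> H b i))"
      using finsum_closed[OF tc] by (simp add: finsum_addf[OF uc tc])
    also have "\<dots> = (\<Oplus>b\<in>B. \<beta> b \<otimes> H b i \<oplus> (\<gamma> b \<otimes> z b) \<otimes> H u i)"
    proof (rule finsum_cong'[OF refl])
      fix b assume b: "b \<in> B"
      have "\<beta> b \<in> carrier R" "\<gamma> b \<in> carrier R" "z b \<in> carrier R" "H b i \<in> carrier R" "H u i \<in> carrier R"
        using b \<beta>B \<gamma>(1) Hc zB by auto
      then show "(\<beta> b \<oplus> z u \<otimes> \<gamma> b) \<otimes> H b i \<oplus> \<gamma> b \<otimes> (z b \<otimes> H u i \<ominus> z u \<otimes> H b i)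
          = \<beta> b \<otimes> H b i \<oplus> (\<gamma> b \<otimes> z b) \<otimes> H u i" using zu by algebra
    qed (use sH sz Hc(2) in \<open>auto simp: Pi_iff\<close>)
    also have "\<dots> = (\<Oplus>b\<in>B. \<beta> b \<otimes> H b i) \<oplus> (\<Oplus>b\<in>B. (\<gamma> b \<otimes> z b) \<otimes> H u i)"
      using sz Hc by (intro finsum_addf[OF sH]) auto
    also have "(\<Oplus>b\<in>B. (\<gamma> b \<otimes> z b) \<otimes> H u i) = \<beta> u \<otimes> H u i"
      unfolding \<gamma>(2) by (rule finsum_ldistr[OF insert.hyps(1) Hc(2) sz, symmetric])
    also have "(\<Oplus>b\<in>B. \<beta> b \<otimes> H b i) \<oplus> \<beta> u \<otimes> H u i = (\<Oplus>b\<in>Set.insert u B. \<beta> b \<otimes> H b i)"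
      using finsum_insert[OF insert.hyps sH] finsum_closed[OF sH] \<beta>u Hc(2) by (simp add: a_comm)
    finally show "(\<Oplus>b\<in>B. (\<beta> b \<oplus> z u \<otimes> \<gamma> b) \<otimes> H b i) \<oplus> \<one> \<otimes> (\<Oplus>b\<in>B. \<gamma> b \<otimes> (z b \<otimes> H u i \<ominus> z u \<otimes> H b i))
      = (\<Oplus>b\<in>Set.insert u B. \<beta> b \<otimes> H b i)" .
  qed
  finally show ?case .
qed

end

section \<open>Relations between Frobenius powers\<close>

text \<open>Values outside \<open>I\<close> are left arbitrary, so that enlarging the family by an
  index requires no change of type; vectors are compared on \<open>I\<close> only.\<close>

definition relations :: "('a, 'b) ring_scheme \<Rightarrow> 'i set \<Rightarrow> ('i \<Rightarrow> 'a) \<Rightarrow> ('i \<Rightarrow> 'a) set"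
  where "relations R I g = {c \<in> I \<rightarrow> carrier R. (\<Oplus>\<^bsub>R\<^esub>i\<in>I. c i \<otimes>\<^bsub>R\<^esub> g i) = \<zero>\<^bsub>R\<^esub>}"

text \<open>The vectors that agree on \<open>I\<close> with a linear combination of the vectors \<open>(c\<^sub>i\<^sup>p)\<close>, where \<open>c\<close> is
  a relation of the family \<open>g\<close>.\<close>

inductive frob_span ::
    "('a, 'b) ring_scheme \<Rightarrow> nat \<Rightarrow> 'i set \<Rightarrow> ('i \<Rightarrow> 'a) \<Rightarrow> ('i \<Rightarrow> 'a) \<Rightarrow> bool"
  for R p I g where
    zero: "(\<And>i. i \<in> I \<Longrightarrow> v i = \<zero>\<^bsub>R\<^esub>) \<Longrightarrow> frob_span R p I g v"
  | step: "frob_span R p I g v \<Longrightarrow> r \<in> carrier R \<Longrightarrow> c \<in> relations R I g \<Longrightarrow>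
      (\<And>i. i \<in> I \<Longrightarrow> w i = v i \<oplus>\<^bsub>R\<^esub> r \<otimes>\<^bsub>R\<^esub> c i [^]\<^bsub>R\<^esub> p) \<Longrightarrow> frob_span R p I g w"

lemma relations_carrier: "c \<in> relations R I g \<Longrightarrow> i \<in> I \<Longrightarrow> c i \<in> carrier R"
  unfolding relations_def by auto

context cring
begin

lemma relations_lin_comb:
  assumes "finite I" "g \<in> I \<rightarrow> carrier R" "c \<in> relations R I g" "d \<in> relations R I g" "r \<in> carrier R"
  shows "(\<lambda>i. c i \<oplus> r \<otimes> d i) \<in> relations R I g"
  using assms lin_comb_add[OF assms(1,2), of c d r] unfolding relations_def by (auto simp: Pi_iff)

lemma relations_cong:
  assumes "c \<in> relations R I g" "g \<in> I \<rightarrow> carrier R" "\<And>i. i \<in> I \<Longrightarrow> d i = c i"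
  shows "d \<in> relations R I g"
proof -
  have "(\<Oplus>i\<in>I. d i \<otimes> g i) = (\<Oplus>i\<in>I. c i \<otimes> g i)"
    using assms by (intro finsum_cong') (auto simp: relations_def Pi_iff)
  then show ?thesis using assms unfolding relations_def by (auto simp: Pi_iff)
qed

lemma relations_zero:
  assumes "g \<in> I \<rightarrow> carrier R" shows "(\<lambda>_. \<zero>) \<in> relations R I g"
proof -
  have "(\<Oplus>i\<in>I. \<zero> \<otimes> g i) = \<zero>" using assms by (intro finsum_zero') (auto simp: Pi_iff)
  then show ?thesis by (simp add: relations_def)
qed

lemma relations_finsum:
  assumes "finite I" "g \<in> I \<rightarrow> carrier R" "finite G" "\<And>x. x \<in> G \<Longrightarrow> H x \<in> relations R I g"
    "\<alpha> \<in> G \<rightarrow> carrier R"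
  shows "(\<lambda>i. \<Oplus>x\<in>G. \<alpha> x \<otimes> H x i) \<in> relations R I g"
  using assms(3-)
proof (induction G rule: finite_induct)
  case empty
  then show ?case using relations_zero[OF assms(2)] by simp
next
  case (insert x G)
  have "(\<lambda>i. (\<Oplus>x\<in>G. \<alpha> x \<otimes> H x i) \<oplus> \<alpha> x \<otimes> H x i) \<in> relations R I g"
    using insert by (intro relations_lin_comb assms(1,2)) auto
  then show ?case
  proof (rule relations_cong[OF _ assms(2)])
    fix i assume i: "i \<in> I"
    have *: "\<alpha> y \<otimes> H y i \<in> carrier R" if "y \<in> Set.insert x G" for y
      using that insert.prems relations_carrier[OF insert.prems(1)[OF that] i] by (auto simp: Pi_iff)
    then have f: "(\<lambda>y. \<alpha> y \<otimes> H y i) \<in> G \<rightarrow> carrier R" by auto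
    show "(\<Oplus>x\<in>Set.insert x G. \<alpha> x \<otimes> H x i) = (\<Oplus>x\<in>G. \<alpha> x \<otimes> H x i) \<oplus> \<alpha> x \<otimes> H x i"
      using finsum_insert[OF insert.hyps f *[of x]] finsum_closed[OF f] *[of x] by (simp add: a_comm)
  qed
qed

lemma relations_insert:
  assumes I: "finite I" "j \<notin> I" and g: "g \<in> insert j I \<rightarrow> carrier R"
  shows "c \<in> relations R (insert j I) g \<longleftrightarrow>
    c \<in> insert j I \<rightarrow> carrier R \<and> (\<Oplus>i\<in>I. c i \<otimes> g i) = \<ominus> (c j \<otimes> g j)"
proof (cases "c \<in> insert j I \<rightarrow> carrier R")
  case True
  then have t: "(\<lambda>i. c i \<otimes> g i) \<in> I \<rightarrow> carrier R" "c j \<otimes> g j \<in> carrier R" using g by (auto simp: Pi_iff)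
  note s = finsum_closed[OF t(1)]
  have "(\<Oplus>i\<in>insert j I. c i \<otimes> g i) = c j \<otimes> g j \<oplus> (\<Oplus>i\<in>I. c i \<otimes> g i)"
    by (rule finsum_insert[OF I t])
  moreover have "c j \<otimes> g j \<oplus> (\<Oplus>i\<in>I. c i \<otimes> g i) = \<zero> \<longleftrightarrow> (\<Oplus>i\<in>I. c i \<otimes> g i) = \<ominus> (c j \<otimes> g j)"
    using minus_equality[of "\<Oplus>i\<in>I. c i \<otimes> g i" "c j \<otimes> g j"] s t(2)
    by (auto simp: r_neg a_comm)
  ultimately show ?thesis using True by (simp add: relations_def)
qed (auto simp: relations_def)

lemma frob_span_carrier:
  assumes "frob_span R p I g v" "i \<in> I" shows "v i \<in> carrier R"
  using assms by (induction rule: frob_span.induct) (auto dest: relations_carrier)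

lemma frob_span_cong:
  assumes "frob_span R p I g v" "\<And>i. i \<in> I \<Longrightarrow> w i = v i" shows "frob_span R p I g w"
  using assms(1)
proof (cases rule: frob_span.cases)
  case zero
  then show ?thesis using assms(2) by (intro frob_span.zero) auto
next
  case (step v' r c)
  then show ?thesis using assms(2) by (intro frob_span.step[OF step(1-3)]) auto
qed

lemma frob_span_lin_comb:
  assumes "frob_span R p I g v" "frob_span R p I g w" "s \<in> carrier R"
  shows "frob_span R p I g (\<lambda>i. v i \<oplus> s \<otimes> w i)"
  using assms(2,1,3)
proof (induction rule: frob_span.induct)
  case (zero w)
  then show ?case by (intro frob_span_cong[OF assms(1)]) (use frob_span_carrier[OF assms(1)] in auto)
next
  case (step v' r c w)
  show ?case
  proof (rule frob_span.step[OF step.IH[OF step.prems] _ step.hyps(3), of "s \<otimes> r"])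
    show "s \<otimes> r \<in> carrier R" using step by simp
    fix i assume i: "i \<in> I"
    have "c i [^] p \<in> carrier R" "v i \<in> carrier R" "v' i \<in> carrier R"
      using relations_carrier[OF step.hyps(3) i] frob_span_carrier[OF assms(1) i]
        frob_span_carrier[OF step.hyps(1) i] by auto
    then show "v i \<oplus> s \<otimes> w i = v i \<oplus> s \<otimes> v' i \<oplus> (s \<otimes> r) \<otimes> c i [^] p"
      unfolding step.hyps(4)[OF i] using step.hyps(2) step.prems by algebra
  qed
qed

lemma frob_span_single:
  assumes "c \<in> relations R I g" "r \<in> carrier R"
  shows "frob_span R p I g (\<lambda>i. r \<otimes> c i [^] p)"
  by (rule frob_span.step[OF frob_span.zero assms(2,1)]) (use relations_carrier[OF assms(1)] assms(2) in auto)

lemma frob_span_finsum: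
  assumes "finite K" "\<And>j. j \<in> K \<Longrightarrow> c j \<in> relations R I g" "b \<in> K \<rightarrow> carrier R"
  shows "frob_span R p I g (\<lambda>i. \<Oplus>j\<in>K. b j \<otimes> c j i [^] p)"
  using assms
proof (induction K rule: finite_induct)
  case empty
  then show ?case by (intro frob_span.zero) auto
next
  case (insert k K)
  have "frob_span R p I g (\<lambda>i. \<Oplus>j\<in>K. b j \<otimes> c j i [^] p)" using insert by auto
  then show ?case
  proof (rule frob_span.step)
    show "b k \<in> carrier R" "c k \<in> relations R I g" using insert.prems by auto
    fix i assume i: "i \<in> I"
    have *: "b j \<otimes> c j i [^] p \<in> carrier R" if "j \<in> Set.insert k K" for j
      using that insert.prems relations_carrier[OF insert.prems(1)[OF that] i] by (auto simp: Pi_iff)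
    then have f: "(\<lambda>j. b j \<otimes> c j i [^] p) \<in> K \<rightarrow> carrier R" by auto
    show "(\<Oplus>j\<in>Set.insert k K. b j \<otimes> c j i [^] p) = (\<Oplus>j\<in>K. b j \<otimes> c j i [^] p) \<oplus> b k \<otimes> c k i [^] p"
      using finsum_insert[OF insert.hyps f *[of k]] finsum_closed[OF f] *[of k] by (simp add: a_comm)
  qed
qed

end

context frobenius_ring
begin

text \<open>If \<open>\<Sum> u\<^sub>i g\<^sub>i = 1\<close>, then \<open>v = \<Sum>\<^sub>j v\<^sub>j (e\<^sub>j - g\<^sub>j u)\<^sup>[\<^sup>p\<^sup>]\<close>.\<close>

lemma frob_span_unit_ideal:
  assumes I: "finite I" and g: "g \<in> I \<rightarrow> carrier R" and one: "\<one> \<in> Idl (g ` I)"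
    and v: "v \<in> relations R I (\<lambda>i. g i [^] p)"
  shows "frob_span R p I g v"
proof -
  obtain u where u: "u \<in> I \<rightarrow> carrier R" "(\<Oplus>i\<in>I. u i \<otimes> g i) = \<one>"
    using one unfolding Idl_image[OF I g] by fastforce
  have vc: "v \<in> I \<rightarrow> carrier R" "(\<Oplus>j\<in>I. v j \<otimes> g j [^] p) = \<zero>" using v by (auto simp: relations_def)
  define e where "e j i = (if j = i then \<one> else \<zero>)" for i j :: 'c
  have e: "e j i \<in> carrier R" for i j by (simp add: e_def)
  define c where "c j i = e j i \<oplus> (\<ominus> g j) \<otimes> u i" for i j
  have "c j \<in> relations R I g" if j: "j \<in> I" for j
  proof -
    have gj: "g j \<in> carrier R" using g j by auto
    have "(\<Oplus>i\<in>I. e j i \<otimes> g i) = (\<Oplus>i\<in>I. if j = i then g i else \<zero>)"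
      using g by (intro finsum_cong') (auto simp: e_def Pi_iff)
    also have "\<dots> = g j" by (rule finsum_singleton[OF j I g])
    finally have "(\<Oplus>i\<in>I. c j i \<otimes> g i) = \<zero>"
      unfolding c_def using gj by (subst lin_comb_add[OF I g]) (auto simp: u e r_neg)
    then show ?thesis using e gj u(1) unfolding relations_def c_def by (auto simp: Pi_iff)
  qed
  then have "frob_span R p I g (\<lambda>i. \<Oplus>j\<in>I. v j \<otimes> c j i [^] p)"
    by (intro frob_span_finsum I vc(1))
  then show ?thesis
  proof (rule frob_span_cong)
    fix i assume i: "i \<in> I"
    have ui: "u i \<in> carrier R" using u i by auto
    have ep: "e j i [^] p = e j i" for j by (simp add: e_def frob_zero)
    have "(\<Oplus>j\<in>I. v j \<otimes> c j i [^] p) = (\<Oplus>j\<in>I. (if i = j then v j else \<zero>) \<oplus> (\<ominus> (u i [^] p)) \<otimes> (v j \<otimes> g j [^] p))"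
    proof (rule finsum_cong'[OF refl])
      fix j assume j: "j \<in> I"
      have gj: "g j \<in> carrier R" "v j \<in> carrier R" using g vc j by auto
      have "v j \<otimes> c j i [^] p = v j \<otimes> (e j i \<oplus> (\<ominus> (g j [^] p)) \<otimes> u i [^] p)"
        using gj ui e unfolding c_def by (simp add: frob_add frob_mult frob_uminus ep)
      also have "\<dots> = v j \<otimes> e j i \<oplus> (\<ominus> (u i [^] p)) \<otimes> (v j \<otimes> g j [^] p)"
      proof -
        have "g j [^] p \<in> carrier R" "u i [^] p \<in> carrier R" "e j i \<in> carrier R" using gj ui e by auto
        then show ?thesis using gj(2) by algebra
      qed
      also have "v j \<otimes> e j i = (if i = j then v j else \<zero>)" using gj by (simp add: e_def)
      finally show "v j \<otimes> c j i [^] p = (if i = j then v j else \<zero>) \<oplus> (\<ominus> (u i [^] p)) \<otimes> (v j \<otimes> g j [^] p)" .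
    qed (use vc g ui in \<open>auto simp: Pi_iff\<close>)
    also have "\<dots> = (\<Oplus>j\<in>I. if i = j then v j else \<zero>) \<oplus> (\<Oplus>j\<in>I. (\<ominus> (u i [^] p)) \<otimes> (v j \<otimes> g j [^] p))"
      using vc g ui by (intro finsum_addf) (auto simp: Pi_iff)
    also have "(\<Oplus>j\<in>I. (\<ominus> (u i [^] p)) \<otimes> (v j \<otimes> g j [^] p)) = (\<ominus> (u i [^] p)) \<otimes> (\<Oplus>j\<in>I. v j \<otimes> g j [^] p)"
      using vc g ui I by (intro finsum_rdistr[symmetric]) (auto simp: Pi_iff)
    also have "(\<Oplus>j\<in>I. if i = j then v j else \<zero>) = v i" by (rule finsum_singleton[OF i I vc(1)])
    finally show "v i = (\<Oplus>j\<in>I. v j \<otimes> c j i [^] p)" using vc i ui by (auto simp: Pi_iff)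
  qed
qed

end

text \<open>Regularity is recorded by the last two assumptions, which make the parameters a regular
  sequence in every order.\<close>

locale regular_parameters = noetherian_cring R + frobenius_ring R p for R (structure) and p +
  fixes M G
  assumes M_prime: "primeideal M R" and M_gen: "M = Idl G"
    and G_fin: "finite G" and G_carrier: "G \<subseteq> carrier R"
    and units: "s \<in> carrier R - M \<Longrightarrow> s \<in> Units R"
    and G_prime: "A \<subseteq> G \<Longrightarrow> primeideal (Idl A) R"
    and G_indep: "A \<subseteq> G \<Longrightarrow> x \<in> G - A \<Longrightarrow> x \<notin> Idl A"

context regular_parameters
begin

lemma M_ideal: "ideal M R" by (rule primeideal_ideal[OF M_prime])

text \<open>The factors \<open>u\<close> of \<open>u^p\<close> are cancelled one at a time modulo
  the \<open>p\<close>-th powers of the other parameters; hence an exponent \<open>n\<close>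
  separate from the fixed \<open>p\<close> in the ideal.\<close>

lemma frob_regular:
  assumes "B \<subseteq> G" "u \<in> G - B" "r \<in> carrier R" "u [^] p \<otimes> r \<in> Idl ((\<lambda>b. b [^] p) ` B)"
  shows "r \<in> Idl ((\<lambda>b. b [^] p) ` B)"
proof -
  have u: "u \<in> carrier R" using assms(2) G_carrier by auto
  have "r \<in> Idl ((\<lambda>b. b [^] p) ` B)"
    if "r \<in> carrier R" "u [^] n \<otimes> r \<in> Idl ((\<lambda>b. b [^] p) ` B)" for n :: nat and r
    using that
  proof (induction n arbitrary: r)
    case (Suc n)
    have "u [^] n \<otimes> (u \<otimes> r) \<in> Idl ((\<lambda>b. b [^] p) ` B)"
      using Suc.prems m_assoc[of "u [^] n" u r] u by simp
    then have "u \<otimes> r \<in> Idl ((\<lambda>b. b [^] p) ` B)" using Suc.IH[of "u \<otimes> r"] Suc.prems(1) u by simp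
    moreover have "finite B" using assms(1) G_fin by (rule finite_subset)
    ultimately show ?case
      using parameter_power_regular[OF G_carrier G_prime G_indep, of B "{}" u r p] assms(1,2) Suc.prems(1)
      by simp
  qed simp
  then show ?thesis using assms(3,4) by blast
qed

text \<open>The relations of \<open>(g, y)\<close> map onto \<open>M\<close> by the last coordinate \<open>j\<close>, with kernel the relations
  of \<open>g\<close>; the vectors \<open>H x\<close> lift the generators \<open>x\<close> of \<open>M\<close>.\<close>

lemma frob_span_insert_decompose:
  assumes I: "finite I" "j \<notin> I" and g: "g \<in> insert j I \<rightarrow> carrier R"
    and gj: "g j \<notin> Idl (g ` I)"
    and H: "\<And>x. x \<in> G \<Longrightarrow> H x \<in> relations R (insert j I) g" "\<And>x. x \<in> G \<Longrightarrow> H x j = x"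
    and "frob_span R p (insert j I) g w"
  shows "\<exists>\<beta> w0. \<beta> \<in> G \<rightarrow> carrier R \<and> frob_span R p I g w0 \<and>
    (\<forall>i\<in>I. w i = w0 i \<oplus> (\<Oplus>x\<in>G. \<beta> x \<otimes> H x i [^] p)) \<and> w j = (\<Oplus>x\<in>G. \<beta> x \<otimes> x [^] p)"
  using assms(7)
proof (induction rule: frob_span.induct)
  case (zero w)
  have Hc: "H x i \<in> carrier R" if "x \<in> G" "i \<in> I" for x i using relations_carrier[OF H(1)[OF that(1)]] that(2) by auto
  show ?case
  proof (intro exI[of _ "\<lambda>_. \<zero>"] conjI)
    show "frob_span R p I g (\<lambda>_. \<zero>)" by (rule frob_span.zero) simp
    show "\<forall>i\<in>I. w i = \<zero> \<oplus> (\<Oplus>x\<in>G. \<zero> \<otimes> H x i [^] p)"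
      using zero Hc by (auto simp: finsum_zero')
    show "w j = (\<Oplus>x\<in>G. \<zero> \<otimes> x [^] p)" using zero G_carrier by (subst finsum_zero') auto
  qed auto
next
  case (step v r c w)
  have gI: "g \<in> I \<rightarrow> carrier R" and gjc: "g j \<in> carrier R" using g by auto
  have Hc: "H x i \<in> carrier R" if "x \<in> G" "i \<in> insert j I" for x i using relations_carrier[OF H(1)[OF that(1)] that(2)] .
  have cc: "c i \<in> carrier R" if "i \<in> insert j I" for i using relations_carrier[OF step.hyps(3) that] .
  have J: "ideal (Idl (g ` I)) R" using gI by (intro genideal_ideal) auto
  have "(\<Oplus>i\<in>I. c i \<otimes> g i) = \<ominus> (c j \<otimes> g j)" using step.hyps(3) relations_insert[OF I g] by blast
  then have "\<ominus> (c j \<otimes> g j) = (\<Oplus>i\<in>I. c i \<otimes> g i)" ..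
  then have "\<ominus> (c j \<otimes> g j) \<in> Idl (g ` I)"
    unfolding Idl_image[OF I(1) gI] using cc by (intro CollectI exI conjI) auto
  then have "c j \<otimes> g j \<in> Idl (g ` I)" using ideal_uminus[OF J] cc gjc by fastforce
  \<comment> \<open>Otherwise \<open>c j\<close> is a unit and the relation expresses
    \<open>g j\<close> by the other generators.\<close>
  then have "c j \<in> M"
    using saturatedD[OF saturated_local[OF units J]] gj cc[of j] gjc by blast
  then have "c j \<in> Idl ((\<lambda>x. x) ` G)" using M_gen by simp
  then obtain \<alpha> where \<alpha>: "\<alpha> \<in> G \<rightarrow> carrier R" "c j = (\<Oplus>x\<in>G. \<alpha> x \<otimes> x)"
    using Idl_image[OF G_fin, of "\<lambda>x. x"] G_carrier by auto
  define d where "d i = (\<Oplus>x\<in>G. \<alpha> x \<otimes> H x i)" for i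
  have d: "d \<in> relations R (insert j I) g"
    unfolding d_def using I(1) g G_fin H(1) \<alpha>(1) by (intro relations_finsum) auto
  have dc: "d i \<in> carrier R" if "i \<in> insert j I" for i using relations_carrier[OF d that] .
  have dj: "d j = c j"
    unfolding d_def \<alpha>(2) using \<alpha>(1) G_carrier H(2) by (intro finsum_cong') auto
  \<comment> \<open>\<open>d\<close> is the lift of \<open>c j\<close> built from \<open>H\<close>,
    so \<open>c'\<close> vanishes at \<open>j\<close> and is a relation of \<open>g\<close> on
    \<open>I\<close>.\<close>
  define c' where "c' i = c i \<oplus> (\<ominus> \<one>) \<otimes> d i" for i
  have c'I: "c' \<in> relations R (insert j I) g"
    unfolding c'_def using I(1) g step.hyps(3) d by (intro relations_lin_comb) auto
  have "c' j = \<zero>" unfolding c'_def dj using cc[of j] by (simp add: l_minus r_neg)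
  then have c': "c' \<in> relations R I g"
    using c'I[unfolded relations_insert[OF I g]] gjc by (simp add: relations_def)
  have c'c: "c' i \<in> carrier R" if "i \<in> I" for i using relations_carrier[OF c' that] .
  obtain \<beta> w0 where \<beta>: "\<beta> \<in> G \<rightarrow> carrier R" and w0: "frob_span R p I g w0"
    and vI: "\<And>i. i \<in> I \<Longrightarrow> v i = w0 i \<oplus> (\<Oplus>x\<in>G. \<beta> x \<otimes> H x i [^] p)" and vj: "v j = (\<Oplus>x\<in>G. \<beta> x \<otimes> x [^] p)"
    using step.IH by blast
  \<comment> \<open>Taking \<open>p\<close>-th powers in \<open>c = c' + d\<close> is additive: the
    summand \<open>r c^p\<close> contributes \<open>r c'^p\<close> to the span over \<open>I\<close>
    and \<open>r \<alpha>^p\<close> to the coefficients of the \<open>H x\<close>.\<close>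
  define \<beta>' where "\<beta>' x = \<beta> x \<oplus> r \<otimes> \<alpha> x [^] p" for x
  have pw: "(\<Oplus>x\<in>G. \<beta>' x \<otimes> h x [^] p) = (\<Oplus>x\<in>G. \<beta> x \<otimes> h x [^] p) \<oplus> r \<otimes> (\<Oplus>x\<in>G. \<alpha> x \<otimes> h x) [^] p"
    if h: "\<And>x. x \<in> G \<Longrightarrow> h x \<in> carrier R" for h
  proof -
    have "(\<Oplus>x\<in>G. \<alpha> x \<otimes> h x) [^] p = (\<Oplus>x\<in>G. (\<alpha> x \<otimes> h x) [^] p)"
      using \<alpha>(1) h by (intro frob_finsum G_fin) auto
    also have "\<dots> = (\<Oplus>x\<in>G. \<alpha> x [^] p \<otimes> h x [^] p)"
      using \<alpha>(1) h by (intro finsum_cong') (auto simp: frob_mult Pi_iff)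
    finally have "(\<Oplus>x\<in>G. \<alpha> x \<otimes> h x) [^] p = (\<Oplus>x\<in>G. \<alpha> x [^] p \<otimes> h x [^] p)" .
    then show ?thesis
      unfolding \<beta>'_def using lin_comb_add[OF G_fin, of "\<lambda>x. h x [^] p" \<beta> "\<lambda>x. \<alpha> x [^] p" r] h \<beta> \<alpha>(1) step.hyps(2)
      by (simp add: Pi_iff)
  qed
  show ?case
  proof (intro exI[of _ \<beta>'] exI[of _ "\<lambda>i. w0 i \<oplus> r \<otimes> c' i [^] p"] conjI ballI)
    show "\<beta>' \<in> G \<rightarrow> carrier R" unfolding \<beta>'_def using \<beta> \<alpha>(1) step.hyps(2) by (auto simp: Pi_iff)
    show "frob_span R p I g (\<lambda>i. w0 i \<oplus> r \<otimes> c' i [^] p)"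
      by (rule frob_span.step[OF w0 step.hyps(2) c']) simp
    show "w j = (\<Oplus>x\<in>G. \<beta>' x \<otimes> x [^] p)"
      using step.hyps(4)[of j] pw[OF subsetD[OF G_carrier]] vj \<alpha>(2) by simp
    fix i assume i: "i \<in> I"
    have "c i = c' i \<oplus> d i"
      using cc[of i] dc[of i] i unfolding c'_def by (simp add: l_minus a_assoc l_neg)
    then have "c i [^] p = c' i [^] p \<oplus> d i [^] p" using c'c[OF i] dc[of i] i by (simp add: frob_add)
    then have "w i = (w0 i \<oplus> (\<Oplus>x\<in>G. \<beta> x \<otimes> H x i [^] p)) \<oplus> r \<otimes> (c' i [^] p \<oplus> d i [^] p)"
      using step.hyps(4)[of i] i vI by simp
    also have "\<dots> = (w0 i \<oplus> r \<otimes> c' i [^] p) \<oplus> ((\<Oplus>x\<in>G. \<beta> x \<otimes> H x i [^] p) \<oplus> r \<otimes> d i [^] p)"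
    proof -
      have "w0 i \<in> carrier R" "c' i [^] p \<in> carrier R" "d i [^] p \<in> carrier R"
        "(\<Oplus>x\<in>G. \<beta> x \<otimes> H x i [^] p) \<in> carrier R"
        using frob_span_carrier[OF w0 i] c'c[OF i] dc[of i] i \<beta> Hc by (auto intro!: finsum_closed simp: Pi_iff)
      then show ?thesis using step.hyps(2) by (simp add: r_distr a_ac)
    qed
    also have "(\<Oplus>x\<in>G. \<beta> x \<otimes> H x i [^] p) \<oplus> r \<otimes> d i [^] p = (\<Oplus>x\<in>G. \<beta>' x \<otimes> H x i [^] p)"
      unfolding d_def using pw[of "\<lambda>x. H x i"] Hc i by auto
    finally show "w i = (w0 i \<oplus> r \<otimes> c' i [^] p) \<oplus> (\<Oplus>x\<in>G. \<beta>' x \<otimes> H x i [^] p)" .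
  qed
qed

text \<open>One step of the induction that proves \<open>Tor\<^sub>1(R/J, F) = 0\<close> for the Frobenius \<open>F\<close> and
  \<open>M\<close>-primary \<open>J\<close>: here \<open>J = (g)\<close>, \<open>J + (y)\<close> satisfies the claim, and \<open>(J + (y)) / J = R / M\<close>.\<close>

lemma frob_span_descend:
  assumes I: "finite I" "j \<notin> I" and g: "g \<in> insert j I \<rightarrow> carrier R"
    and gj: "g j \<notin> Idl (g ` I)" and soc: "\<And>x. x \<in> M \<Longrightarrow> x \<otimes> g j \<in> Idl (g ` I)"
    and hyp: "\<And>v. v \<in> relations R (insert j I) (\<lambda>i. g i [^] p) \<Longrightarrow> frob_span R p (insert j I) g v"
    and v: "v \<in> relations R I (\<lambda>i. g i [^] p)"
  shows "frob_span R p I g v"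
proof -
  have gI: "g \<in> I \<rightarrow> carrier R" and gjc: "g j \<in> carrier R" using g by auto
  have gp: "(\<lambda>i. g i [^] p) \<in> insert j I \<rightarrow> carrier R" using g by (auto simp: Pi_iff)
  have vc: "v \<in> I \<rightarrow> carrier R" using v by (simp add: relations_def)
  have "\<exists>h. h \<in> relations R (insert j I) g \<and> h j = x" if x: "x \<in> G" for x
  proof -
    have xM: "x \<in> M" unfolding M_gen using x mem_Idl[OF G_carrier] by blast
    have xc: "x \<in> carrier R" using x G_carrier by auto
    obtain a where a: "a \<in> I \<rightarrow> carrier R" "x \<otimes> g j = (\<Oplus>i\<in>I. a i \<otimes> g i)"
      using soc[OF xM] unfolding Idl_image[OF I(1) gI] by blast
    define h where "h i = (if i = j then x else \<ominus> a i)" for i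
    have "(\<Oplus>i\<in>I. h i \<otimes> g i) = (\<Oplus>i\<in>I. (\<zero> \<oplus> (\<ominus> \<one>) \<otimes> a i) \<otimes> g i)"
      using I(2) a(1) gI by (intro finsum_cong') (auto simp: h_def Pi_iff l_minus)
    also have "\<dots> = (\<Oplus>i\<in>I. \<zero> \<otimes> g i) \<oplus> (\<ominus> \<one>) \<otimes> (x \<otimes> g j)"
      unfolding a(2) by (rule lin_comb_add[OF I(1) gI _ a(1)]) auto
    also have "(\<Oplus>i\<in>I. \<zero> \<otimes> g i) = \<zero>" using gI by (intro finsum_zero') (auto simp: Pi_iff)
    finally have "(\<Oplus>i\<in>I. h i \<otimes> g i) = \<ominus> (h j \<otimes> g j)" using xc gjc by (simp add: h_def l_minus)
    moreover have "h \<in> insert j I \<rightarrow> carrier R" using a(1) xc by (auto simp: h_def Pi_iff)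
    ultimately show ?thesis unfolding relations_insert[OF I g] by (auto simp: h_def)
  qed
  then obtain H where H: "\<And>x. x \<in> G \<Longrightarrow> H x \<in> relations R (insert j I) g" "\<And>x. x \<in> G \<Longrightarrow> H x j = x"
    by metis
  have Hc: "H x i \<in> carrier R" if "x \<in> G" "i \<in> insert j I" for x i using relations_carrier[OF H(1)[OF that(1)] that(2)] .
  \<comment> \<open>The coordinate 0 at \<open>j\<close> has a purpose: comparing it with the
    decomposition shows that \<open>\<beta>\<close> is a relation between the \<open>p\<close>-th
    powers of the parameters.\<close>
  define v' where "v' = v(j := \<zero>)"
  have "(\<Oplus>i\<in>I. v' i \<otimes> g i [^] p) = (\<Oplus>i\<in>I. v i \<otimes> g i [^] p)"
    using I(2) vc gI by (intro finsum_cong') (auto simp: v'_def Pi_iff)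
  then have "v' \<in> relations R (insert j I) (\<lambda>i. g i [^] p)"
    unfolding relations_insert[OF I gp] using v vc gjc by (auto simp: v'_def relations_def)
  then obtain \<beta> w0 where \<beta>: "\<beta> \<in> G \<rightarrow> carrier R" and w0: "frob_span R p I g w0"
    and vI: "\<And>i. i \<in> I \<Longrightarrow> v' i = w0 i \<oplus> (\<Oplus>x\<in>G. \<beta> x \<otimes> H x i [^] p)"
    and vj: "v' j = (\<Oplus>x\<in>G. \<beta> x \<otimes> x [^] p)"
    using frob_span_insert_decompose[OF I g gj H hyp] by blast
  \<comment> \<open>\<open>koszul\<close> expects ring elements at every index, while
    \<open>H x\<close> is controlled on \<open>insert j I\<close> only.\<close>
  define K where "K x i = (if i \<in> I then H x i [^] p else \<zero>)" for x i
  have Kc: "K x i \<in> carrier R" if "x \<in> G" for x i using Hc that by (auto simp: K_def)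
  have "frob_span R p I g (\<lambda>i. \<Oplus>x\<in>G. \<beta> x \<otimes> K x i)"
  proof (rule koszul[where z = "\<lambda>x. x [^] p" and W = "frob_span R p I g"])
    show "(\<Oplus>x\<in>G. \<beta> x \<otimes> x [^] p) = \<zero>" using vj by (simp add: v'_def)
    show "(\<lambda>x. x [^] p) \<in> G \<rightarrow> carrier R" using G_carrier by auto
    show "frob_span R p I g (\<lambda>_. \<zero>)" by (rule frob_span.zero) simp
  next
    fix x y assume x: "x \<in> G" and y: "y \<in> G"
    have xc: "x \<in> carrier R" "y \<in> carrier R" using x y G_carrier by auto
    \<comment> \<open>The Koszul relation of \<open>x^p\<close> and \<open>y^p\<close> is realized
      by the \<open>p\<close>-th power of \<open>x H_y - y H_x\<close>, whose last coordinate
      \<open>x y - y x\<close> vanishes. The leading zero lets \<open>relations_lin_comb\<close> be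
      used twice.\<close>
    define c where "c i = (\<zero> \<oplus> x \<otimes> H y i) \<oplus> (\<ominus> y) \<otimes> H x i" for i
    have cI: "c \<in> relations R (insert j I) g"
      unfolding c_def using I(1) g H(1) x y xc relations_zero[OF g] by (intro relations_lin_comb) auto
    have "c j = \<zero>" unfolding c_def H(2)[OF x] H(2)[OF y] using xc by algebra
    then have "c \<in> relations R I g"
      using cI[unfolded relations_insert[OF I g]] gjc by (simp add: relations_def)
    then have "frob_span R p I g (\<lambda>i. \<one> \<otimes> c i [^] p)" by (rule frob_span_single) simp
    then show "frob_span R p I g (\<lambda>i. x [^] p \<otimes> K y i \<ominus> y [^] p \<otimes> K x i)"
    proof (rule frob_span_cong)
      fix i assume i: "i \<in> I"
      have h: "H x i \<in> carrier R" "H y i \<in> carrier R" using Hc x y i by auto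
      then have "c i [^] p = x [^] p \<otimes> H y i [^] p \<oplus> (\<ominus> (y [^] p)) \<otimes> H x i [^] p"
        unfolding c_def using xc by (simp add: frob_add frob_mult frob_uminus)
      then show "x [^] p \<otimes> K y i \<ominus> y [^] p \<otimes> K x i = \<one> \<otimes> c i [^] p"
        using h xc i by (simp add: K_def minus_eq l_minus)
    qed
  next
    fix B u r assume "B \<subseteq> G" "u \<in> G - B" "r \<in> carrier R" "u [^] p \<otimes> r \<in> Idl ((\<lambda>x. x [^] p) ` B)"
    then show "r \<in> Idl ((\<lambda>x. x [^] p) ` B)" by (rule frob_regular)
  qed (use G_fin Kc \<beta> frob_span_lin_comb in auto)
  then have "frob_span R p I g (\<lambda>i. w0 i \<oplus> \<one> \<otimes> (\<Oplus>x\<in>G. \<beta> x \<otimes> K x i))"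
    by (intro frob_span_lin_comb w0) auto
  then show ?thesis
  proof (rule frob_span_cong)
    fix i assume i: "i \<in> I"
    have s: "(\<Oplus>x\<in>G. \<beta> x \<otimes> K x i) \<in> carrier R" using \<beta> Kc by (intro finsum_closed) (auto simp: Pi_iff)
    have "v i = v' i" using i I(2) by (auto simp: v'_def)
    then show "v i = w0 i \<oplus> \<one> \<otimes> (\<Oplus>x\<in>G. \<beta> x \<otimes> K x i)"
      using vI[OF i] s i by (simp add: K_def)
  qed
qed

text \<open>Noetherian induction on the ideal. A maximal counterexample is proper, hence has a socle
  element \<open>y\<close>; adjoining \<open>y\<close> as one more generator gives a larger ideal,
  which satisfies the claim, and \<open>frob_span_descend\<close> returns to the original one. The
  new generator needs an index outside \<open>I\<close>.\<close>

lemma frob_relations: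
  fixes g :: "'i \<Rightarrow> 'a"
  assumes inf: "infinite (UNIV :: 'i set)"
    and "finite I" "g \<in> I \<rightarrow> carrier R" "ideal_power R M N \<subseteq> Idl (g ` I)"
    and "v \<in> relations R I (\<lambda>i. g i [^] p)"
  shows "frob_span R p I g v"
proof (rule ccontr)
  assume neg: "\<not> frob_span R p I g v"
  define bad where "bad I g \<longleftrightarrow> finite I \<and> g \<in> I \<rightarrow> carrier R \<and> ideal_power R M N \<subseteq> Idl (g ` I) \<and>
    (\<exists>v\<in>relations R I (\<lambda>i. g i [^] p). \<not> frob_span R p I g v)" for I and g :: "'i \<Rightarrow> 'a"
  \<comment> \<open>The family may grow during the induction, so the order is that of the ideals
    generated.\<close>
  define C where "C = {Idl (g ` I) |I g. bad I g}"
  have "Idl (g ` I) \<in> C" using assms neg unfolding C_def bad_def by blast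
  then have ne: "C \<noteq> {}" by blast
  have "ideal J R" if "J \<in> C" for J using that unfolding C_def bad_def by (auto intro!: genideal_ideal)
  then obtain J where "J \<in> C" and max: "\<And>K. K \<in> C \<Longrightarrow> J \<subseteq> K \<Longrightarrow> K = J"
    using exists_maximal_ideal[OF ne] by blast
  then obtain I and g :: "'i \<Rightarrow> 'a" where J: "J = Idl (g ` I)" and bad: "bad I g" unfolding C_def by blast
  have I: "finite I" and g: "g \<in> I \<rightarrow> carrier R" and MN: "ideal_power R M N \<subseteq> J"
    using bad unfolding bad_def J by auto
  obtain v where v: "v \<in> relations R I (\<lambda>i. g i [^] p)" and nv: "\<not> frob_span R p I g v"
    using bad unfolding bad_def by blast
  have JI: "ideal J R" unfolding J using g by (intro genideal_ideal) auto
  have "J \<noteq> carrier R" using frob_span_unit_ideal[OF I g _ v] nv unfolding J by blast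
  then obtain y where y: "y \<in> carrier R" "y \<notin> J" "\<forall>x\<in>M. x \<otimes> y \<in> J"
    using exists_socle_element[OF M_ideal JI _ MN] by blast
  obtain j where j: "j \<notin> I" using ex_new_if_finite[OF inf I] by blast
  define g' where "g' = g(j := y)"
  have g': "g' \<in> insert j I \<rightarrow> carrier R" using g y(1) by (auto simp: g'_def)
  have g'I: "g' ` I = g ` I" using j by (auto simp: g'_def)
  have g'j: "g' j = y" by (simp add: g'_def)
  have sub: "insert y (g ` I) \<subseteq> Idl (g' ` insert j I)"
    using genideal_self[of "insert y (g ` I)"] g y(1) by (auto simp: g'I g'j)
  have K: "ideal (Idl (g' ` insert j I)) R" using g' by (intro genideal_ideal) auto
  have JK: "J \<subseteq> Idl (g' ` insert j I)" unfolding J using sub by (intro genideal_minimal[OF K]) auto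
  have "\<not> bad (insert j I) g'"
  proof
    assume "bad (insert j I) g'"
    then have "Idl (g' ` insert j I) \<in> C" unfolding C_def by blast
    then show False using max JK sub y(2) by blast
  qed
  then have "frob_span R p (insert j I) g' w" if "w \<in> relations R (insert j I) (\<lambda>i. g' i [^] p)" for w
    using that I g' MN JK unfolding bad_def by blast
  moreover have v': "v \<in> relations R I (\<lambda>i. g' i [^] p)"
  proof -
    have "(\<Oplus>i\<in>I. v i \<otimes> g' i [^] p) = (\<Oplus>i\<in>I. v i \<otimes> g i [^] p)"
      using v g j by (intro finsum_cong') (auto simp: g'_def relations_def Pi_iff)
    then show ?thesis using v by (simp add: relations_def)
  qed
  ultimately have "frob_span R p I g' v"
    using y by (intro frob_span_descend[OF I j g']) (auto simp: g'I g'j J)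
  then have "frob_span R p I g v"
  proof (induction rule: frob_span.induct)
    case (step v r c w)
    have "c \<in> relations R I g"
    proof -
      have "(\<Oplus>i\<in>I. c i \<otimes> g i) = (\<Oplus>i\<in>I. c i \<otimes> g' i)"
        using step.hyps(3) g' j by (intro finsum_cong') (auto simp: g'_def relations_def Pi_iff)
      then show ?thesis using step.hyps(3) by (simp add: relations_def)
    qed
    then show ?case using step.IH step.hyps by (intro frob_span.step[of R p I g v r c w]) auto
  qed (rule frob_span.zero)
  then show False using nv by blast
qed

end

section \<open>Frobenius powers and colon ideals in regular local rings\<close>

context noetherian_cring
begin

text \<open>A weak form, proved by maximality. Let \<open>L\<close> be maximal above
  \<open>K = J + M^n B\<close> with \<open>L \<inter> B\<close> inside \<open>K\<close>. For
  \<open>x \<in> M\<close> the ideals \<open>(L : x^k)\<close> become stable under raising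
  \<open>k\<close> by \<open>n\<close>; since \<open>x^n\<close> maps \<open>B\<close> into
  \<open>K\<close>, adjoining \<open>x^k\<close> to \<open>L\<close> adds nothing to
  \<open>L \<inter> B\<close>, so \<open>x^k \<in> L\<close>. Hence \<open>L\<close> contains a
  power of \<open>M\<close>.\<close>

lemma artin_rees:
  assumes M: "ideal M R" and J: "ideal J R" and B: "ideal B R" and JB: "J \<subseteq> B"
  shows "\<exists>m. (J <+>\<^bsub>R\<^esub> ideal_power R M m) \<inter> B \<subseteq> J <+>\<^bsub>R\<^esub> ideal_power R M n \<cdot> B"
proof -
  note Mn = ideal_power_ideal[OF M, of n]
  note MB = ideal_prod_is_ideal[OF Mn B]
  define K where "K = J <+>\<^bsub>R\<^esub> ideal_power R M n \<cdot> B"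
  have K: "ideal K R" "J \<subseteq> K" "ideal_power R M n \<cdot> B \<subseteq> K"
    unfolding K_def by (rule add_ideals[OF J MB], rule subset_set_add[OF J MB], rule subset_set_add[OF J MB])
  define C where "C = {L. ideal L R \<and> K \<subseteq> L \<and> L \<inter> B \<subseteq> K}"
  have "\<exists>L\<in>C. \<forall>I\<in>C. L \<subseteq> I \<longrightarrow> I = L"
    by (rule exists_maximal_ideal) (use K in \<open>auto simp: C_def\<close>)
  then obtain L where "L \<in> C" and max: "\<And>I. I \<in> C \<Longrightarrow> L \<subseteq> I \<Longrightarrow> I = L" by blast
  then have L: "ideal L R" and KL: "K \<subseteq> L" and LB: "L \<inter> B \<subseteq> K" by (auto simp: C_def)
  have "\<exists>k::nat. x [^] k \<in> L" if x: "x \<in> M" for x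
  proof -
    have xc: "x \<in> carrier R" using ideal_carrier[OF M x] .
    define D where "D k = {r \<in> carrier R. x [^] (k::nat) \<otimes> r \<in> L}" for k
    have "\<exists>A\<in>range D. \<forall>I\<in>range D. A \<subseteq> I \<longrightarrow> I = A"
      by (rule exists_maximal_ideal) (use xc in \<open>auto simp: D_def intro!: colon_ideal[OF L]\<close>)
    then obtain k where k: "\<And>l. D k \<subseteq> D l \<Longrightarrow> D l = D k" by auto
    have "D k \<subseteq> D (n + k)"
    proof
      fix r assume "r \<in> D k"
      then have r: "r \<in> carrier R" "x [^] k \<otimes> r \<in> L" by (auto simp: D_def)
      have "x [^] (n + k) \<otimes> r = x [^] n \<otimes> (x [^] k \<otimes> r)"
        using xc r by (simp add: m_assoc flip: nat_pow_mult)
      then show "r \<in> D (n + k)" using r ideal_lmult[OF L r(2)] xc by (simp add: D_def)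
    qed
    then have Dk: "D (n + k) = D k" by (rule k)
    have xk: "x [^] k \<in> carrier R" using xc by simp
    have "Idl (insert (x [^] k) L) \<inter> B \<subseteq> K"
    proof
      fix z assume "z \<in> Idl (insert (x [^] k) L) \<inter> B"
      then obtain l r where z: "z \<in> B" "l \<in> L" "r \<in> carrier R" "z = l \<oplus> r \<otimes> x [^] k"
        unfolding Int_iff mem_Idl_insert[OF L xk] by blast
      have lc: "l \<in> carrier R" using ideal_carrier[OF L z(2)] .
      have xn: "x [^] n \<in> carrier R" using xc by simp
      have "x [^] n \<otimes> z \<in> ideal_power R M n \<cdot> B"
        by (rule ideal_prod.prod[OF nat_pow_mem_ideal_power[OF M x] z(1)])
      then have "x [^] n \<otimes> z \<in> L" using K(3) KL by blast
      moreover have "x [^] (n + k) \<otimes> r = x [^] n \<otimes> z \<ominus> x [^] n \<otimes> l"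
        unfolding z(4) nat_pow_mult[OF xc, symmetric] using xn xk z(3) lc by algebra
      ultimately have "x [^] (n + k) \<otimes> r \<in> L"
        using ideal_minus[OF L _ ideal_lmult[OF L z(2) xn]] by simp
      then have "r \<in> D k" unfolding Dk[symmetric] using z(3) by (simp add: D_def)
      then have "z \<in> L" unfolding z(4) using z(2,3) xk by (auto simp: D_def m_comm intro: ideal_add[OF L])
      then show "z \<in> K" using LB z(1) by blast
    qed
    then have "Idl (insert (x [^] k) L) = L"
      using subset_Idl_insert[OF L xk] ideal_Idl_insert[OF L xk] KL by (intro max) (auto simp: C_def)
    then show ?thesis using subset_Idl_insert[OF L xk] by blast
  qed
  then obtain m where m: "ideal_power R M m \<subseteq> L" by (rule ideal_power_subset_radical[OF M L])
  have "J <+>\<^bsub>R\<^esub> ideal_power R M m \<subseteq> L"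
    using m K(2) KL ideal_add[OF L] unfolding subset_iff mem_set_add by blast
  then show ?thesis using LB unfolding K_def by blast
qed

text \<open>For \<open>B = J + (x)\<close>, Artin-Rees with exponent 1 gives
  \<open>x \<in> J + M B\<close>, and Nakayama gives \<open>B = J\<close>.\<close>

lemma krull_intersection:
  assumes M: "primeideal M R" and units: "\<And>s. s \<in> carrier R - M \<Longrightarrow> s \<in> Units R"
    and J: "ideal J R" and x: "\<And>m. x \<in> J <+>\<^bsub>R\<^esub> ideal_power R M m"
  shows "x \<in> J"
proof -
  note MI = primeideal_ideal[OF M]
  have xc: "x \<in> carrier R"
    using ideal_carrier[OF add_ideals[OF J ideal_power_ideal[OF MI]] x[of 0]] .
  define B where "B = Idl (insert x J)"
  have B: "ideal B R" "insert x J \<subseteq> B"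
    unfolding B_def by (rule ideal_Idl_insert[OF J xc], rule subset_Idl_insert[OF J xc])
  obtain m where m: "(J <+>\<^bsub>R\<^esub> ideal_power R M m) \<inter> B \<subseteq> J <+>\<^bsub>R\<^esub> ideal_power R M 1 \<cdot> B"
    using artin_rees[OF MI J B(1)] B(2) by blast
  have M1: "ideal_power R M 1 \<subseteq> M"
    using ideal_prod_inter[OF oneideal MI] ideal_power_Suc[of M 0] by (simp add: ideal_power_0)
  have MB: "ideal (M \<cdot> B) R" by (rule ideal_prod_is_ideal[OF MI B(1)])
  have "ideal_power R M 1 \<cdot> B \<subseteq> M \<cdot> B"
    by (rule ideal_prod_subset[OF MB]) (use M1 in \<open>auto intro: ideal_prod.prod\<close>)
  moreover have "x \<in> J <+>\<^bsub>R\<^esub> ideal_power R M 1 \<cdot> B" using m x B(2) by blast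
  ultimately obtain j z where j: "j \<in> J" "z \<in> M \<cdot> B" "x = j \<oplus> z" unfolding mem_set_add by blast
  have "J = B"
  proof (rule nakayama[OF M J B(1)])
    show "J \<subseteq> B" using B(2) by blast
    show "saturated R M J" "saturated R M B" using saturated_local[OF units] J B(1) by blast+
    fix u assume "u \<in> B"
    then obtain i r where u: "i \<in> J" "r \<in> carrier R" "u = i \<oplus> r \<otimes> x"
      unfolding B_def mem_Idl_insert[OF J xc] by blast
    have c: "i \<in> carrier R" "j \<in> carrier R" "z \<in> carrier R"
      using ideal_carrier[OF J] ideal_carrier[OF MB] u j by auto
    have "\<one> \<otimes> u = (i \<oplus> r \<otimes> j) \<oplus> r \<otimes> z" unfolding u(3) j(3) using c u(2) by algebra
    moreover have "i \<oplus> r \<otimes> j \<in> J" "r \<otimes> z \<in> M \<cdot> B"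
      using u j by (auto intro!: ideal_add[OF J] ideal_lmult[OF J] ideal_lmult[OF MB])
    ultimately have "\<one> \<otimes> u \<in> J <+>\<^bsub>R\<^esub> M \<cdot> B" unfolding mem_set_add by blast
    then show "\<exists>s\<in>carrier R - M. s \<otimes> u \<in> J <+>\<^bsub>R\<^esub> M \<cdot> B" using prime_complement(1)[OF M] by blast
  qed
  then show ?thesis using B(2) by blast
qed

end

section \<open>The colon formula in a regular local ring\<close>

context cring
begin

text \<open>The tags 0 and 1 keep two sets of generators apart even if they share elements.\<close>

lemma finsum_tagged_Un:
  fixes A B :: "'c set"
  assumes "finite A" "finite B" "\<And>a. a \<in> A \<Longrightarrow> f (a, 0::nat) \<in> carrier R" "\<And>b. b \<in> B \<Longrightarrow> f (b, 1) \<in> carrier R"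
  shows "(\<Oplus>i\<in>(\<lambda>a. (a, 0)) ` A \<union> (\<lambda>b. (b, 1)) ` B. f i) = (\<Oplus>a\<in>A. f (a, 0)) \<oplus> (\<Oplus>b\<in>B. f (b, 1))"
proof -
  have "(\<Oplus>i\<in>(\<lambda>a. (a, 0)) ` A \<union> (\<lambda>b. (b, 1)) ` B. f i)
      = (\<Oplus>i\<in>(\<lambda>a. (a, 0)) ` A. f i) \<oplus> (\<Oplus>i\<in>(\<lambda>b. (b, 1)) ` B. f i)"
    using assms by (intro finsum_Un_disjoint) auto
  also have "(\<Oplus>i\<in>(\<lambda>a. (a, 0)) ` A. f i) = (\<Oplus>a\<in>A. f (a, 0))"
    using assms by (intro finsum_reindex) (auto simp: inj_on_def)
  also have "(\<Oplus>i\<in>(\<lambda>b. (b, 1)) ` B. f i) = (\<Oplus>b\<in>B. f (b, 1))"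
    using assms by (intro finsum_reindex) (auto simp: inj_on_def)
  finally show ?thesis .
qed

lemma Idl_finite:
  assumes "finite A" "A \<subseteq> carrier R"
  shows "Idl A = {\<Oplus>a\<in>A. c a \<otimes> a |c. c \<in> A \<rightarrow> carrier R}"
  using Idl_image[of A "\<lambda>a. a"] assms by auto

lemma colon_Int_ideal:
  assumes "ideal J R" "ideal K R" "s \<in> carrier R" shows "ideal {k \<in> K. s \<otimes> k \<in> J} R"
proof -
  have "{k \<in> K. s \<otimes> k \<in> J} = K \<inter> {k \<in> carrier R. s \<otimes> k \<in> J}" using ideal_carrier[OF assms(2)] by auto
  then show ?thesis using i_intersect[OF assms(2) colon_ideal[OF assms(1,3)]] by simp
qed

end

context regular_parameters
begin

text \<open>Generators \<open>a\<close> of \<open>K\<close> and \<open>b\<close> of \<open>J\<close>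
  give the family of all \<open>s a\<close> and \<open>b\<close>. The hypotheses on \<open>x\<close>
  are a relation between its \<open>p\<close>-th powers, and each relation \<open>c\<close> of the
  family itself yields an element \<open>k\<close>, the sum of the \<open>c_a a\<close>, with
  \<open>k \<in> K\<close> and \<open>s \<otimes> k \<in> J\<close>.\<close>

lemma frob_colon_primary:
  assumes J: "ideal J R" and K: "ideal K R" and s: "s \<in> carrier R" and N: "ideal_power R M N \<subseteq> J"
    and xK: "x \<in> frobenius_power R K p" and xJ: "s [^] p \<otimes> x \<in> frobenius_power R J p"
  shows "x \<in> frobenius_power R {k \<in> K. s \<otimes> k \<in> J} p"
proof -
  define H where "H = {k \<in> K. s \<otimes> k \<in> J}"
  have "ideal H R" unfolding H_def by (rule colon_Int_ideal[OF J K s])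
  then have Hc: "H \<subseteq> carrier R" and HI: "ideal (frobenius_power R H p) R"
    using frobenius_power_ideal ideal_subset_carrier by auto
  obtain A where A: "A \<subseteq> carrier R" "finite A" "K = Idl A" using finetely_gen[OF K] by auto
  obtain B where B: "B \<subseteq> carrier R" "finite B" "J = Idl B" using finetely_gen[OF J] by auto
  have Kp: "frobenius_power R K p = {\<Oplus>a\<in>A. c a \<otimes> a [^] p |c. c \<in> A \<rightarrow> carrier R}"
    using frobenius_power_image[of A "\<lambda>a. a"] Idl_image[of A "\<lambda>a. a [^] p"] A by auto
  have Jp: "frobenius_power R J p = {\<Oplus>b\<in>B. c b \<otimes> b [^] p |c. c \<in> B \<rightarrow> carrier R}"
    using frobenius_power_image[of B "\<lambda>a. a"] Idl_image[of B "\<lambda>a. a [^] p"] B by auto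
  obtain t where t: "t \<in> A \<rightarrow> carrier R" "x = (\<Oplus>a\<in>A. t a \<otimes> a [^] p)" using xK unfolding Kp by blast
  have xc: "x \<in> carrier R" unfolding t(2) using t(1) A(1) by (intro finsum_closed) auto
  have "\<ominus> (s [^] p \<otimes> x) \<in> frobenius_power R J p"
    using ideal_uminus[OF frobenius_power_ideal[OF ideal_subset_carrier[OF J]] xJ] .
  then obtain r where r: "r \<in> B \<rightarrow> carrier R" "\<ominus> (s [^] p \<otimes> x) = (\<Oplus>b\<in>B. r b \<otimes> b [^] p)"
    unfolding Jp by blast
  define I :: "('a \<times> nat) set" where "I = (\<lambda>a. (a, 0)) ` A \<union> (\<lambda>b. (b, 1)) ` B"
  define g where "g = (\<lambda>(a, k::nat). if k = 0 then s \<otimes> a else a)"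
  define v where "v = (\<lambda>(a, k::nat). if k = 0 then t a else r a)"
  have I: "finite I" using A B by (simp add: I_def)
  have split: "(\<Oplus>i\<in>I. w i \<otimes> h i) = (\<Oplus>a\<in>A. w (a, 0) \<otimes> h (a, 0)) \<oplus> (\<Oplus>b\<in>B. w (b, 1) \<otimes> h (b, 1))"
    if "w \<in> I \<rightarrow> carrier R" "h \<in> I \<rightarrow> carrier R" for w h
    unfolding I_def by (rule finsum_tagged_Un) (use that A B in \<open>auto simp: I_def Pi_iff\<close>)
  have g: "g \<in> I \<rightarrow> carrier R" using A B s by (auto simp: g_def I_def)
  then have gp: "(\<lambda>i. g i [^] p) \<in> I \<rightarrow> carrier R" by (auto simp: Pi_iff)
  have v: "v \<in> I \<rightarrow> carrier R" using t(1) r(1) by (auto simp: v_def I_def)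
  have "(\<Oplus>i\<in>I. v i \<otimes> g i [^] p) = (\<Oplus>a\<in>A. t a \<otimes> (s \<otimes> a) [^] p) \<oplus> (\<Oplus>b\<in>B. r b \<otimes> b [^] p)"
    using split[OF v gp] by (simp add: v_def g_def)
  also have "(\<Oplus>a\<in>A. t a \<otimes> (s \<otimes> a) [^] p) = (\<Oplus>a\<in>A. s [^] p \<otimes> (t a \<otimes> a [^] p))"
    using t(1) s A(1) by (intro finsum_cong') (auto simp: frob_mult m_ac Pi_iff subset_iff)
  also have "\<dots> = s [^] p \<otimes> x"
    unfolding t(2) using t(1) A s by (intro finsum_rdistr[symmetric]) auto
  also have "s [^] p \<otimes> x \<oplus> (\<Oplus>b\<in>B. r b \<otimes> b [^] p) = \<zero>"
    unfolding r(2)[symmetric] using xc s by (simp add: r_neg)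
  finally have "v \<in> relations R I (\<lambda>i. g i [^] p)" using v by (simp add: relations_def)
  moreover have "J \<subseteq> Idl (g ` I)"
    unfolding B(3)
  proof (rule subset_Idl_subset)
    show "g ` I \<subseteq> carrier R" using g by auto
    show "B \<subseteq> g ` I"
    proof
      fix b assume "b \<in> B"
      then have "(b, 1) \<in> I" "b = g (b, 1)" by (auto simp: I_def g_def)
      then show "b \<in> g ` I" by blast
    qed
  qed
  moreover have "infinite (UNIV :: ('a \<times> nat) set)" by (simp add: finite_prod)
  ultimately have "frob_span R p I g v" using frob_relations[OF _ I g] N by blast
  \<comment> \<open>The linear map that pairs the first block of a vector with the
    \<open>a^p\<close> sends \<open>v\<close> to \<open>x\<close>, and sends the \<open>p\<close>-th
    power of a relation \<open>c\<close> to \<open>k^p\<close> with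
    \<open>k \<in> H\<close>.\<close>
  then have "(\<Oplus>a\<in>A. v (a, 0) \<otimes> a [^] p) \<in> frobenius_power R H p"
  proof (induction rule: frob_span.induct)
    case (zero v)
    then have "(\<Oplus>a\<in>A. v (a, 0) \<otimes> a [^] p) = \<zero>" using A(1) by (intro finsum_zero') (auto simp: I_def)
    then show ?case using ideal_zero[OF HI] by simp
  next
    case (step v q c w)
    define k where "k = (\<Oplus>a\<in>A. c (a, 0) \<otimes> a)"
    have c: "c \<in> I \<rightarrow> carrier R" "(\<Oplus>i\<in>I. c i \<otimes> g i) = \<zero>" using step.hyps(3) by (auto simp: relations_def)
    have cA: "(\<lambda>a. c (a, 0)) \<in> A \<rightarrow> carrier R" and cB: "(\<lambda>b. c (b, 1)) \<in> B \<rightarrow> carrier R"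
      using c(1) by (auto simp: I_def)
    have vA: "(\<lambda>a. v (a, 0)) \<in> A \<rightarrow> carrier R" using frob_span_carrier[OF step.hyps(1)] by (auto simp: I_def)
    have "k \<in> K" unfolding A(3) Idl_finite[OF A(2,1)] k_def using cA
      by (intro CollectI exI[of _ "\<lambda>a. c (a, 0)"]) simp
    have kc: "k \<in> carrier R" using ideal_carrier[OF K \<open>k \<in> K\<close>] .
    have "s \<otimes> k = (\<Oplus>a\<in>A. s \<otimes> (c (a, 0) \<otimes> a))"
      unfolding k_def using cA s A by (intro finsum_rdistr) auto
    also have "\<dots> = (\<Oplus>a\<in>A. c (a, 0) \<otimes> (s \<otimes> a))"
      using cA s A(1) by (intro finsum_cong') (auto simp: Pi_iff subset_iff m_lcomm)
    finally have sk: "s \<otimes> k = (\<Oplus>a\<in>A. c (a, 0) \<otimes> (s \<otimes> a))" .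
    have "(\<Oplus>b\<in>B. c (b, 1) \<otimes> b) \<in> J" unfolding B(3) Idl_finite[OF B(2,1)] using cB
      by (intro CollectI exI[of _ "\<lambda>b. c (b, 1)"]) simp
    moreover from this have "s \<otimes> k \<oplus> (\<Oplus>b\<in>B. c (b, 1) \<otimes> b) = \<zero>"
      using c(2) unfolding split[OF c(1) g] sk by (simp add: g_def)
    ultimately have "s \<otimes> k \<in> J" using ideal_diff_mem[OF J, of "s \<otimes> k" "\<Oplus>b\<in>B. c (b, 1) \<otimes> b"] ideal_zero[OF J] kc s by simp
    then have "k \<in> H" using \<open>k \<in> K\<close> by (simp add: H_def)
    have "(\<Oplus>a\<in>A. w (a, 0) \<otimes> a [^] p) = (\<Oplus>a\<in>A. (v (a, 0) \<oplus> q \<otimes> c (a, 0) [^] p) \<otimes> a [^] p)"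
      using step.hyps(4) vA cA step.hyps(2) A(1) by (intro finsum_cong') (auto simp: I_def Pi_iff subset_iff)
    also have "\<dots> = (\<Oplus>a\<in>A. v (a, 0) \<otimes> a [^] p) \<oplus> q \<otimes> (\<Oplus>a\<in>A. c (a, 0) [^] p \<otimes> a [^] p)"
      using vA cA step.hyps(2) A by (intro lin_comb_add) (auto simp: Pi_iff)
    also have "(\<Oplus>a\<in>A. c (a, 0) [^] p \<otimes> a [^] p) = (\<Oplus>a\<in>A. (c (a, 0) \<otimes> a) [^] p)"
      using cA A(1) by (intro finsum_cong') (auto simp: Pi_iff subset_iff frob_mult)
    also have "\<dots> = k [^] p" unfolding k_def using cA A by (intro frob_finsum[symmetric]) auto
    also have "(\<Oplus>a\<in>A. v (a, 0) \<otimes> a [^] p) \<oplus> q \<otimes> k [^] p \<in> frobenius_power R H p"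
      by (intro ideal_add[OF HI step.IH] ideal_lmult[OF HI] step.hyps(2)
        nat_pow_mem_frobenius_power[OF Hc \<open>k \<in> H\<close>])
    finally show ?case .
  qed
  then show ?thesis by (simp add: v_def H_def t(2))
qed

text \<open>Replace \<open>J\<close> by \<open>J + M^m\<close> and use the primary case. By
  Artin-Rees inside \<open>T K = J + s K\<close>, for large \<open>m\<close> every
  \<open>k \<in> K\<close> with \<open>s \<otimes> k \<in> J + M^m\<close> has
  \<open>s \<otimes> k \<in> J + s M^n K\<close>, so \<open>k\<close> differs from an element of
  \<open>H\<close> by one of \<open>M^n\<close>. Thus \<open>x\<close> lies in
  \<open>H^[p] + M^n\<close> for all \<open>n\<close>, and Krull's intersection theorem
  concludes.\<close>

lemma frob_colon:
  assumes J: "ideal J R" and K: "ideal K R" and s: "s \<in> carrier R"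
    and xK: "x \<in> frobenius_power R K p" and xJ: "s [^] p \<otimes> x \<in> frobenius_power R J p"
  shows "x \<in> frobenius_power R {k \<in> K. s \<otimes> k \<in> J} p"
proof -
  define H where "H = {k \<in> K. s \<otimes> k \<in> J}"
  have "ideal H R" unfolding H_def by (rule colon_Int_ideal[OF J K s])
  then have Hc: "H \<subseteq> carrier R" and HI: "ideal (frobenius_power R H p) R"
    using frobenius_power_ideal ideal_subset_carrier by auto
  have "x \<in> frobenius_power R H p"
  proof (rule krull_intersection[OF M_prime units HI])
    fix n
    note Mn = ideal_power_ideal[OF M_ideal]
    note MK = ideal_prod_is_ideal[OF Mn[of n] K]
    define T where "T L = {j \<oplus> s \<otimes> k |j k. j \<in> J \<and> k \<in> L}" for L
    have TI: "j \<oplus> s \<otimes> k \<in> T L" if "j \<in> J" "k \<in> L" for j k L using that unfolding T_def by blast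
    have T: "ideal (T L) R" if L: "ideal L R" for L
    proof (rule idealI')
      have c: "j \<in> J \<Longrightarrow> j \<in> carrier R" "k \<in> L \<Longrightarrow> k \<in> carrier R" for j k
        using ideal_carrier[OF J] ideal_carrier[OF L] by auto
      show "T L \<subseteq> carrier R" using c s by (auto simp: T_def)
      show "\<zero> \<in> T L" using TI[OF ideal_zero[OF J] ideal_zero[OF L]] s by simp
      fix u assume "u \<in> T L"
      then obtain j k where u: "u = j \<oplus> s \<otimes> k" "j \<in> J" "k \<in> L" unfolding T_def by blast
      show "u \<oplus> w \<in> T L" if wT: "w \<in> T L" for w
      proof -
        obtain i l where w: "w = i \<oplus> s \<otimes> l" "i \<in> J" "l \<in> L" using wT unfolding T_def by blast
        have "u \<oplus> w = (j \<oplus> i) \<oplus> s \<otimes> (k \<oplus> l)"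
          unfolding u(1) w(1) using c(1)[OF u(2)] c(2)[OF u(3)] c(1)[OF w(2)] c(2)[OF w(3)] s by algebra
        then show ?thesis using TI[OF ideal_add[OF J u(2) w(2)] ideal_add[OF L u(3) w(3)]] by simp
      qed
      show "r \<otimes> u \<in> T L" if r: "r \<in> carrier R" for r
      proof -
        have "r \<otimes> u = r \<otimes> j \<oplus> s \<otimes> (r \<otimes> k)" unfolding u(1) using c(1)[OF u(2)] c(2)[OF u(3)] s r by algebra
        then show ?thesis using TI[OF ideal_lmult[OF J u(2) r] ideal_lmult[OF L u(3) r]] by simp
      qed
    qed
    have JT: "J \<subseteq> T L" if L: "ideal L R" for L
    proof
      fix j assume j: "j \<in> J"
      show "j \<in> T L" using TI[OF j ideal_zero[OF L]] ideal_carrier[OF J j] s by simp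
    qed
    have "ideal_power R M n \<cdot> T K \<subseteq> T (ideal_power R M n \<cdot> K)"
    proof (rule ideal_prod_subset[OF T[OF MK]])
      fix m u assume m: "m \<in> ideal_power R M n" and "u \<in> T K"
      then obtain j k where u: "u = j \<oplus> s \<otimes> k" "j \<in> J" "k \<in> K" unfolding T_def by blast
      have c: "m \<in> carrier R" "j \<in> carrier R" "k \<in> carrier R"
        using ideal_carrier[OF Mn m] ideal_carrier[OF J u(2)] ideal_carrier[OF K u(3)] .
      have "m \<otimes> u = m \<otimes> j \<oplus> s \<otimes> (m \<otimes> k)" unfolding u(1) using c s by algebra
      then show "m \<otimes> u \<in> T (ideal_power R M n \<cdot> K)"
        using TI[OF ideal_lmult[OF J u(2) c(1)] ideal_prod.prod[OF m u(3)]] by simp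
    qed
    moreover obtain m where m: "(J <+>\<^bsub>R\<^esub> ideal_power R M m) \<inter> T K \<subseteq> J <+>\<^bsub>R\<^esub> ideal_power R M n \<cdot> T K"
      using artin_rees[OF M_ideal J T[OF K] JT[OF K]] by blast
    ultimately have JmT: "(J <+>\<^bsub>R\<^esub> ideal_power R M m) \<inter> T K \<subseteq> T (ideal_power R M n \<cdot> K)"
      using JT[OF MK] ideal_add[OF T[OF MK]] unfolding subset_iff mem_set_add by blast
    define Jm where "Jm = J <+>\<^bsub>R\<^esub> ideal_power R M m"
    have Jm: "ideal Jm R" "J \<subseteq> Jm" "ideal_power R M m \<subseteq> Jm"
      unfolding Jm_def using add_ideals[OF J Mn] subset_set_add[OF J Mn] by auto
    have "s [^] p \<otimes> x \<in> frobenius_power R Jm p"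
      using xJ frobenius_power_mono[OF Jm(2) ideal_subset_carrier[OF Jm(1)]] by blast
    then have "x \<in> frobenius_power R {k \<in> K. s \<otimes> k \<in> Jm} p"
      by (rule frob_colon_primary[OF Jm(1) K s Jm(3) xK])
    moreover have "frobenius_power R {k \<in> K. s \<otimes> k \<in> Jm} p \<subseteq> frobenius_power R H p <+>\<^bsub>R\<^esub> ideal_power R M n"
    proof (rule frobenius_power_subset[OF add_ideals[OF HI Mn]])
      fix k assume "k \<in> {k \<in> K. s \<otimes> k \<in> Jm}"
      then have k: "k \<in> K" "s \<otimes> k \<in> Jm" by auto
      have kc: "k \<in> carrier R" using ideal_carrier[OF K k(1)] .
      have "s \<otimes> k \<in> T K" using TI[OF ideal_zero[OF J] k(1)] kc s by simp
      then have "s \<otimes> k \<in> T (ideal_power R M n \<cdot> K)" using JmT k(2) unfolding Jm_def by blast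
      then obtain j k' where j: "j \<in> J" "k' \<in> ideal_power R M n \<cdot> K" "s \<otimes> k = j \<oplus> s \<otimes> k'"
        unfolding T_def by blast
      have k': "k' \<in> ideal_power R M n" "k' \<in> K" using ideal_prod_inter[OF Mn K] j(2) by auto
      have c: "j \<in> carrier R" "k' \<in> carrier R" using ideal_carrier[OF J j(1)] ideal_carrier[OF K k'(2)] .
      have "s \<otimes> (k \<ominus> k') = s \<otimes> k \<ominus> s \<otimes> k'" using kc c s by algebra
      also have "\<dots> = j" unfolding j(3) using kc c s by algebra
      finally have "k \<ominus> k' \<in> H" using j(1) ideal_minus[OF K k(1) k'(2)] by (simp add: H_def)
      then have "(k \<ominus> k') [^] p \<in> frobenius_power R H p" by (rule nat_pow_mem_frobenius_power[OF Hc])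
      moreover have "k' [^] p \<in> ideal_power R M n"
        using frobenius_power_le[OF Mn p_pos] nat_pow_mem_frobenius_power[OF ideal_subset_carrier[OF Mn] k'(1)] by blast
      moreover have "k [^] p = (k \<ominus> k') [^] p \<oplus> k' [^] p"
      proof -
        have "k = (k \<ominus> k') \<oplus> k'" using kc c by algebra
        then show ?thesis using frob_add[of "k \<ominus> k'" k'] kc c by simp
      qed
      ultimately show "k [^] p \<in> frobenius_power R H p <+>\<^bsub>R\<^esub> ideal_power R M n"
        unfolding mem_set_add by blast
    qed
    ultimately show "x \<in> frobenius_power R H p <+>\<^bsub>R\<^esub> ideal_power R M n" by blast
  qed
  then show ?thesis by (simp add: H_def)
qed

end

section \<open>Parameters of a regular local ring\<close>

sublocale regular_local_ring \<subseteq> noetherian_cring ..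

context regular_local_ring
begin

lemma exists_regular_parameters:
  assumes "Factorial_Ring.prime p" "add_pow R p \<one> = \<zero>"
  shows "\<exists>M G. regular_parameters R p M G"
proof -
  obtain M G where M: "maximalideal M R" and G: "finite G" "G \<subseteq> carrier R" "M = Idl G"
    and dim: "krull_dim R = enat (card G)"
    using regular by blast
  have Mp: "primeideal M R" by (rule maximalideal_prime[OF M])
  have in_M: "I \<subseteq> M" if I: "ideal I R" "I \<noteq> carrier R" for I
  proof -
    define C where "C = {K. ideal K R \<and> I \<subseteq> K \<and> K \<noteq> carrier R}"
    have "\<exists>K\<in>C. \<forall>L\<in>C. K \<subseteq> L \<longrightarrow> L = K"
      by (rule exists_maximal_ideal) (use I in \<open>auto simp: C_def\<close>)
    then obtain K where K: "K \<in> C" and max: "\<And>L. L \<in> C \<Longrightarrow> K \<subseteq> L \<Longrightarrow> L = K" by blast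
    have "maximalideal K R"
    proof (rule maximalidealI)
      show "ideal K R" "carrier R \<noteq> K" using K by (auto simp: C_def)
      fix L assume "ideal L R" "K \<subseteq> L" "L \<subseteq> carrier R"
      then show "L = K \<or> L = carrier R" using K max[of L] by (auto simp: C_def)
    qed
    then have "K = M" using local M by blast
    then show ?thesis using K by (simp add: C_def)
  qed
  have units: "s \<in> Units R" if s: "s \<in> carrier R - M" for s
  proof -
    have "PIdl s = carrier R"
      using in_M[OF cgenideal_ideal[of s]] cgenideal_self[of s] s by auto
    then have "\<one> \<in> PIdl s" by simp
    then obtain r where "r \<in> carrier R" "r \<otimes> s = \<one>" unfolding cgenideal_def by auto
    then show ?thesis using s m_comm[of r s] unfolding Units_def by auto
  qed
  define S where "S = {enat n |n. \<exists>P. prime_chain R P n}"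
  have S: "Sup S = enat (card G)" using dim unfolding krull_dim_def S_def prime_chain_def .
  have "prime_chain R (\<lambda>_. M) 0" using Mp by (simp add: prime_chain_def)
  then have "S \<noteq> {}" unfolding S_def by blast
  \<comment> \<open>A finite supremum of a nonempty set of extended naturals is a maximum, so the
    dimension is realized by an actual chain of primes.\<close>
  then have "finite S" "Max S = enat (card G)" using S by (auto simp: Sup_enat_def split: if_splits)
  then have "enat (card G) \<in> S" using Max_in[OF _ \<open>S \<noteq> {}\<close>] by simp
  then obtain P where P: "prime_chain R P (card G)" unfolding S_def by blast
  have top: "primeideal (P (card G)) R" by (rule prime_chainD(1)[OF P]) simp
  have PM: "P (card G) \<subseteq> M"
    by (rule in_M[OF primeideal_ideal[OF top]]) (use primeideal.I_notcarr[OF top] in blast)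
  note reg = regular_generators_prime[OF G(1,2) Mp G(3) units P PM]
  have "regular_parameters R p M G"
  proof (intro regular_parameters.intro regular_parameters_axioms.intro frobenius_ring.intro
      frobenius_ring_axioms.intro noetherian_cring_axioms is_cring)
    show "s \<in> Units R" if "s \<in> carrier R - M" for s by (rule units[OF that])
    show "primeideal (Idl A) R" if "A \<subseteq> G" for A by (rule reg(1)[OF _ that])
    show "x \<notin> Idl A" if "A \<subseteq> G" "x \<in> G - A" for A x by (rule reg(2)[OF _ that])
  qed (fact assms Mp G)+
  then show ?thesis by blast
qed

end

section \<open>Localization\<close>

context mult_set
begin

lemma nat_pow_S: "s \<in> S \<Longrightarrow> s [^] (n::nat) \<in> S"
  by (induction n) (auto intro: S_one S_mult)

lemma fraction_pow:
  assumes "a \<in> carrier R" "s \<in> S"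
  shows "fraction R S a s [^]\<^bsub>L\<^esub> (n::nat) = fraction R S (a [^] n) (s [^] n)"
  by (induction n) (simp_all add: loc_one loc_mult assms nat_pow_S)

definition fraction_ideal :: "'a set \<Rightarrow> ('a \<times> 'a) set set"
  where "fraction_ideal J = {fraction R S a s |a s. a \<in> J \<and> s \<in> S}"

lemma fraction_idealI: "a \<in> J \<Longrightarrow> s \<in> S \<Longrightarrow> fraction R S a s \<in> fraction_ideal J"
  unfolding fraction_ideal_def by blast

lemma fraction_idealE:
  assumes "u \<in> fraction_ideal J" obtains a s where "u = fraction R S a s" "a \<in> J" "s \<in> S"
  using assms unfolding fraction_ideal_def by blast

lemma ideal_fraction_ideal:
  assumes J: "ideal J R" shows "ideal (fraction_ideal J) L"
proof -
  interpret l: cring L by (rule localization_cring)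
  show ?thesis
  proof (rule l.idealI')
    show "fraction_ideal J \<subseteq> carrier L"
      by (auto elim!: fraction_idealE intro!: fraction_carr ideal_carrier[OF J])
    show "\<zero>\<^bsub>L\<^esub> \<in> fraction_ideal J"
      unfolding loc_zero by (rule fraction_idealI[OF ideal_zero[OF J] S_one])
  next
    fix u v assume "u \<in> fraction_ideal J" "v \<in> fraction_ideal J"
    then obtain a s b t where c: "u = fraction R S a s" "a \<in> J" "s \<in> S" "v = fraction R S b t" "b \<in> J" "t \<in> S"
      by (elim fraction_idealE) blast
    then have "a \<otimes> t \<oplus> b \<otimes> s \<in> J" by (intro ideal_add[OF J] ideal_rmult[OF J]) auto
    then show "u \<oplus>\<^bsub>L\<^esub> v \<in> fraction_ideal J"
      using c ideal_carrier[OF J] by (simp add: loc_add fraction_idealI S_mult)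
  next
    fix u v assume "u \<in> fraction_ideal J" "v \<in> carrier L"
    then obtain a s b t where c: "u = fraction R S a s" "a \<in> J" "s \<in> S" "v = fraction R S b t" "b \<in> carrier R" "t \<in> S"
      by (elim fraction_idealE locE) blast
    then show "v \<otimes>\<^bsub>L\<^esub> u \<in> fraction_ideal J"
      using ideal_carrier[OF J] ideal_lmult[OF J] by (simp add: loc_mult fraction_idealI S_mult)
  qed
qed

lemma ideal_preimage:
  assumes Q: "ideal Q L" shows "ideal {x \<in> carrier R. fraction R S x \<one> \<in> Q} R"
proof -
  interpret l: cring L by (rule localization_cring)
  show ?thesis
  proof (rule idealI')
    show "\<zero> \<in> {x \<in> carrier R. fraction R S x \<one> \<in> Q}" using l.ideal_zero[OF Q] by (simp add: loc_zero)
  next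
    fix x y assume *: "x \<in> {x \<in> carrier R. fraction R S x \<one> \<in> Q}" "y \<in> {x \<in> carrier R. fraction R S x \<one> \<in> Q}"
    then have "fraction R S x \<one> \<oplus>\<^bsub>L\<^esub> fraction R S y \<one> \<in> Q" using l.ideal_add[OF Q] by blast
    then show "x \<oplus> y \<in> {x \<in> carrier R. fraction R S x \<one> \<in> Q}" using * S_one by (simp add: loc_add)
  next
    fix x r assume *: "x \<in> {x \<in> carrier R. fraction R S x \<one> \<in> Q}" and r: "r \<in> carrier R"
    then have "fraction R S r \<one> \<otimes>\<^bsub>L\<^esub> fraction R S x \<one> \<in> Q"
      using l.ideal_lmult[OF Q] fraction_carr S_one by blast
    then show "r \<otimes> x \<in> {x \<in> carrier R. fraction R S x \<one> \<in> Q}" using * r S_one by (simp add: loc_mult)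
  qed auto
qed

lemma fraction_mem_frobenius_power:
  assumes J: "ideal J R" and x: "x \<in> frobenius_power R J q"
  shows "fraction R S x \<one> \<in> frobenius_power L (fraction_ideal J) q"
proof -
  interpret l: cring L by (rule localization_cring)
  have JL: "fraction_ideal J \<subseteq> carrier L" by (rule l.ideal_subset_carrier[OF ideal_fraction_ideal[OF J]])
  have "frobenius_power R J q \<subseteq> {x \<in> carrier R. fraction R S x \<one> \<in> frobenius_power L (fraction_ideal J) q}"
  proof (rule frobenius_power_subset[OF ideal_preimage[OF l.frobenius_power_ideal[OF JL]]])
    fix f assume f: "f \<in> J"
    have fc: "f \<in> carrier R" using ideal_carrier[OF J f] .
    have "fraction R S f \<one> [^]\<^bsub>L\<^esub> q \<in> frobenius_power L (fraction_ideal J) q"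
      by (rule l.nat_pow_mem_frobenius_power[OF JL fraction_idealI[OF f S_one]])
    then show "f [^] q \<in> {x \<in> carrier R. fraction R S x \<one> \<in> frobenius_power L (fraction_ideal J) q}"
      using fc S_one by (simp add: fraction_pow)
  qed
  then show ?thesis using x by blast
qed

lemma frobenius_power_fraction_ideal:
  assumes J: "J \<subseteq> carrier R"
  shows "frobenius_power L (fraction_ideal J) q \<subseteq> fraction_ideal (frobenius_power R J q)"
proof -
  interpret l: cring L by (rule localization_cring)
  show ?thesis
  proof (rule l.frobenius_power_subset[OF ideal_fraction_ideal[OF frobenius_power_ideal[OF J]]])
    fix f assume "f \<in> fraction_ideal J"
    then obtain a s where c: "f = fraction R S a s" "a \<in> J" "s \<in> S" by (rule fraction_idealE)
    moreover have "a \<in> carrier R" using c(2) J by blast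
    ultimately have "f [^]\<^bsub>L\<^esub> q = fraction R S (a [^] q) (s [^] q)" by (simp add: fraction_pow)
    then show "f [^]\<^bsub>L\<^esub> q \<in> fraction_ideal (frobenius_power R J q)"
      using fraction_idealI[OF nat_pow_mem_frobenius_power[OF J c(2)] nat_pow_S[OF c(3)]] by simp
  qed
qed

lemma loc_add_pow: "add_pow L (n::nat) \<one>\<^bsub>L\<^esub> = fraction R S (add_pow R n \<one>) \<one>"
proof -
  interpret l: cring L by (rule localization_cring)
  show ?thesis
  proof (induction n)
    case (Suc n)
    then show ?case using S_one by (simp add: loc_one loc_add)
  qed (simp add: loc_zero)
qed

lemma colon_fraction_ideal:
  assumes J: "ideal J R" and K: "ideal K R" and s: "s \<in> carrier R"
    and k: "k \<in> fraction_ideal K" "fraction R S s \<one> \<otimes>\<^bsub>L\<^esub> k \<in> fraction_ideal J"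
  shows "k \<in> fraction_ideal {k \<in> K. s \<otimes> k \<in> J}"
proof -
  obtain c t where c: "k = fraction R S c t" "c \<in> K" "t \<in> S" using k(1) by (rule fraction_idealE)
  have cc: "c \<in> carrier R" using ideal_carrier[OF K c(2)] .
  have "fraction R S (s \<otimes> c) t \<in> fraction_ideal J"
    using k(2) cc c s S_one by (simp add: loc_mult)
  then obtain b w where b: "fraction R S (s \<otimes> c) t = fraction R S b w" "b \<in> J" "w \<in> S" by (rule fraction_idealE)
  have bc: "b \<in> carrier R" using ideal_carrier[OF J b(2)] .
  obtain u where u: "u \<in> S" "u \<otimes> ((s \<otimes> c) \<otimes> w) = u \<otimes> (b \<otimes> t)"
    using b fraction_eq_iff[of "s \<otimes> c" b t w] cc bc s c(3) by auto
  \<comment> \<open>The denominator \<open>w\<close> and the factor \<open>u\<close> that witnesses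
    equality of fractions are absorbed into the numerator, so that \<open>v \<otimes> c\<close>
    satisfies the colon condition in \<open>R\<close> itself.\<close>
  define v where "v = u \<otimes> w"
  have v: "v \<in> S" unfolding v_def by (rule S_mult[OF u(1) b(3)])
  have "s \<otimes> (v \<otimes> c) = u \<otimes> ((s \<otimes> c) \<otimes> w)" unfolding v_def using u b s cc by (simp add: m_ac)
  also have "\<dots> \<in> J"
    unfolding u(2) using ideal_rmult[OF J b(2)] ideal_lmult[OF J] u(1) c(3) by simp
  finally have "v \<otimes> c \<in> {k \<in> K. s \<otimes> k \<in> J}" using ideal_lmult[OF K c(2)] v by simp
  moreover have "k = fraction R S (v \<otimes> c) (v \<otimes> t)"
    unfolding c(1) using cc c(3) v S_mult by (intro feqI) (auto simp: m_ac)
  ultimately show ?thesis using S_mult[OF v c(3)] by (auto intro: fraction_idealI)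
qed

end

section \<open>Frobenius powers and colon ideals in regular rings\<close>

sublocale regular_ring \<subseteq> noetherian_cring ..

locale regular_frobenius_ring = regular_ring R + frobenius_ring R p for R (structure) and p

context frobenius_ring
begin

lemma frobenius_power_mult:
  assumes I: "I \<subseteq> carrier R"
  shows "frobenius_power R I (q * p) = frobenius_power R (frobenius_power R I q) p"
proof (rule subset_antisym)
  note Iq = frobenius_power_ideal[OF I]
  note Iqc = ideal_subset_carrier[OF Iq]
  show "frobenius_power R I (q * p) \<subseteq> frobenius_power R (frobenius_power R I q) p"
  proof (rule frobenius_power_subset[OF frobenius_power_ideal[OF Iqc]])
    fix f assume f: "f \<in> I"
    have "(f [^] q) [^] p \<in> frobenius_power R (frobenius_power R I q) p"
      by (rule nat_pow_mem_frobenius_power[OF Iqc nat_pow_mem_frobenius_power[OF I f]])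
    then show "f [^] (q * p) \<in> frobenius_power R (frobenius_power R I q) p"
      using f I nat_pow_pow by (metis subsetD)
  qed
  \<comment> \<open>\<open>T\<close> is an ideal by additivity of the Frobenius, so the generators
    \<open>f^q\<close> are all that has to be tested.\<close>
  define T where "T = {g \<in> carrier R. g [^] p \<in> frobenius_power R I (q * p)}"
  have "ideal T R"
  proof (rule idealI')
    show "T \<subseteq> carrier R" by (auto simp: T_def)
    show "\<zero> \<in> T" using ideal_zero[OF Iq] by (simp add: T_def frob_zero)
    show "x \<oplus> y \<in> T" if "x \<in> T" "y \<in> T" for x y
      using that ideal_add[OF Iq] by (simp add: T_def frob_add)
    show "r \<otimes> x \<in> T" if "x \<in> T" "r \<in> carrier R" for x r
      using that ideal_lmult[OF Iq] by (simp add: T_def frob_mult)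
  qed
  moreover have "f [^] q \<in> T" if f: "f \<in> I" for f
  proof -
    have fc: "f \<in> carrier R" using f I by blast
    show ?thesis using nat_pow_mem_frobenius_power[OF I f, of "q * p"] fc by (simp add: T_def nat_pow_pow)
  qed
  ultimately have "frobenius_power R I q \<subseteq> T" by (rule frobenius_power_subset)
  then show "frobenius_power R (frobenius_power R I q) p \<subseteq> frobenius_power R I (q * p)"
    by (intro frobenius_power_subset[OF Iq]) (auto simp: T_def)
qed

lemma frobenius_power_1: "ideal I R \<Longrightarrow> frobenius_power R I 1 = I"
  by (rule subset_antisym[OF frobenius_power_le]) (use ideal_carrier nat_pow_mem_frobenius_power[of I _ 1] ideal_subset_carrier in \<open>force+\<close>)

lemma frobenius_power_add_exp:
  assumes I: "I \<subseteq> carrier R"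
  shows "frobenius_power R I (q * p ^ e) = frobenius_power R (frobenius_power R I q) (p ^ e)"
proof (induction e)
  case 0
  show ?case using frobenius_power_1[OF frobenius_power_ideal[OF I]] by simp
next
  case (Suc e)
  have "frobenius_power R I (q * p ^ Suc e) = frobenius_power R (frobenius_power R I (q * p ^ e)) p"
    using frobenius_power_mult[OF I, of "q * p ^ e"] by (simp add: mult_ac)
  also have "\<dots> = frobenius_power R (frobenius_power R I q) (p ^ e * p)"
    unfolding Suc.IH using frobenius_power_mult[OF ideal_subset_carrier[OF frobenius_power_ideal[OF I]]] by simp
  finally show ?case by (simp add: mult_ac)
qed

end

context regular_frobenius_ring
begin

text \<open>Membership is local: if \<open>x\<close> is not in \<open>H^[p]\<close>, its annihilator
  \<open>B\<close> modulo \<open>H^[p]\<close> lies in a prime \<open>P\<close>, and the formula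
  over the regular local ring \<open>R_P\<close> produces an element of \<open>B\<close> outside
  \<open>P\<close>.\<close>

lemma frobenius_colon:
  assumes J: "ideal J R" and K: "ideal K R" and s: "s \<in> carrier R"
    and xK: "x \<in> frobenius_power R K p" and xJ: "s [^] p \<otimes> x \<in> frobenius_power R J p"
  shows "x \<in> frobenius_power R {k \<in> K. s \<otimes> k \<in> J} p"
proof (rule ccontr)
  assume neg: "x \<notin> frobenius_power R {k \<in> K. s \<otimes> k \<in> J} p"
  define H where "H = {k \<in> K. s \<otimes> k \<in> J}"
  have H: "ideal H R" unfolding H_def by (rule colon_Int_ideal[OF J K s])
  note Hc = ideal_subset_carrier[OF H]
  note Hp = frobenius_power_ideal[OF Hc, of p]
  have xc: "x \<in> carrier R" using ideal_carrier[OF frobenius_power_ideal[OF ideal_subset_carrier[OF K]] xK] .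
  define B where "B = {r \<in> carrier R. x \<otimes> r \<in> frobenius_power R H p}"
  have B: "ideal B R" unfolding B_def by (rule colon_ideal[OF Hp xc])
  \<comment> \<open>Avoiding 1 is being proper, so this yields a prime above
    \<open>B\<close>.\<close>
  have "mult_set R {\<one>}" by unfold_locales auto
  moreover have "B \<inter> {\<one>} = {}" using neg xc by (simp add: B_def H_def)
  ultimately obtain P where P: "primeideal P R" "B \<subseteq> P" by (rule exists_prime_disjoint[OF B])
  define S where "S = carrier R - P"
  interpret m: mult_set R S unfolding S_def by (rule primeideal.complement_mult_set[OF P(1)])
  have loc: "localization_at R P = m.L" by (simp add: localization_at_def S_def)
  interpret l: regular_local_ring m.L using regular_localizations[OF P(1)] unfolding loc .
  have "add_pow m.L p \<one>\<^bsub>m.L\<^esub> = \<zero>\<^bsub>m.L\<^esub>" unfolding m.loc_add_pow p_zero m.loc_zero ..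
  then obtain M G where "regular_parameters m.L p M G" using l.exists_regular_parameters p_prime by blast
  then interpret r: regular_parameters m.L p M G .
  define \<phi> where "\<phi> y = fraction R S y \<one>" for y
  have "\<phi> (s [^] p \<otimes> x) = \<phi> s [^]\<^bsub>m.L\<^esub> p \<otimes>\<^bsub>m.L\<^esub> \<phi> x"
    unfolding \<phi>_def using s xc m.S_one by (simp add: m.fraction_pow m.loc_mult)
  then have "\<phi> s [^]\<^bsub>m.L\<^esub> p \<otimes>\<^bsub>m.L\<^esub> \<phi> x \<in> frobenius_power m.L (m.fraction_ideal J) p"
    using m.fraction_mem_frobenius_power[OF J xJ] by (simp add: \<phi>_def)
  then have "\<phi> x \<in> frobenius_power m.L {k \<in> m.fraction_ideal K. \<phi> s \<otimes>\<^bsub>m.L\<^esub> k \<in> m.fraction_ideal J} p"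
    using m.fraction_mem_frobenius_power[OF K xK] m.fraction_carr[OF s m.S_one] unfolding \<phi>_def
    by (intro r.frob_colon m.ideal_fraction_ideal J K) auto
  moreover have "{k \<in> m.fraction_ideal K. \<phi> s \<otimes>\<^bsub>m.L\<^esub> k \<in> m.fraction_ideal J} \<subseteq> m.fraction_ideal H"
    unfolding H_def \<phi>_def using m.colon_fraction_ideal[OF J K s] by blast
  ultimately have "\<phi> x \<in> frobenius_power m.L (m.fraction_ideal H) p"
    using l.frobenius_power_mono[OF _ l.ideal_subset_carrier[OF m.ideal_fraction_ideal[OF H]]] by blast
  then have "\<phi> x \<in> m.fraction_ideal (frobenius_power R H p)"
    using m.frobenius_power_fraction_ideal[OF Hc] by blast
  then obtain d t where d: "fraction R S x \<one> = fraction R S d t" "d \<in> frobenius_power R H p" "t \<in> S"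
    unfolding \<phi>_def by (rule m.fraction_idealE)
  have dc: "d \<in> carrier R" using ideal_carrier[OF Hp d(2)] .
  obtain u where u: "u \<in> S" "u \<otimes> (x \<otimes> t) = u \<otimes> (d \<otimes> \<one>)"
    using d(1) m.fraction_eq_iff[OF xc dc m.S_one d(3)] by blast
  have "x \<otimes> (u \<otimes> t) = u \<otimes> (x \<otimes> t)" using xc u(1) d(3) by (simp add: m_ac)
  also have "\<dots> \<in> frobenius_power R H p" unfolding u(2) using dc u(1) ideal_lmult[OF Hp d(2)] by simp
  finally have "u \<otimes> t \<in> P" using P(2) u(1) d(3) by (auto simp: B_def)
  then show False using m.S_mult[OF u(1) d(3)] by (simp add: S_def)
qed

text \<open>The formula for \<open>p\<close> is applied to \<open>J^[p^e]\<close>,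
  \<open>K^[p^e]\<close> and \<open>s^(p^e)\<close>; the induction hypothesis bounds the colon ideal
  that comes out.\<close>

lemma frobenius_colon_iterate:
  assumes J: "ideal J R" and K: "ideal K R" and s: "s \<in> carrier R"
    and "x \<in> frobenius_power R K (p ^ e)" "s [^] (p ^ e) \<otimes> x \<in> frobenius_power R J (p ^ e)"
  shows "x \<in> frobenius_power R {k \<in> K. s \<otimes> k \<in> J} (p ^ e)"
  using assms(4,5)
proof (induction e arbitrary: x)
  case 0
  have "x \<in> K" "s \<otimes> x \<in> J" using 0 s frobenius_power_1[OF J] frobenius_power_1[OF K] by auto
  then show ?case using frobenius_power_1[OF colon_Int_ideal[OF J K s]] by simp
next
  case (Suc e)
  let ?F = "\<lambda>I. frobenius_power R I (p ^ e)"
  have split: "frobenius_power R I (p ^ Suc e) = frobenius_power R (?F I) p" if "ideal I R" for I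
    using frobenius_power_mult[OF ideal_subset_carrier[OF that], of "p ^ e"] by (simp add: mult_ac)
  have F: "ideal (?F I) R" if "ideal I R" for I by (rule frobenius_power_ideal[OF ideal_subset_carrier[OF that]])
  note H = colon_Int_ideal[OF J K s]
  have "s [^] (p ^ Suc e) = (s [^] (p ^ e)) [^] p" using s by (simp add: nat_pow_pow mult_ac)
  then have "x \<in> frobenius_power R {k \<in> ?F K. s [^] (p ^ e) \<otimes> k \<in> ?F J} p"
    using Suc.prems s unfolding split[OF J] split[OF K] by (intro frobenius_colon F J K) auto
  moreover have "{k \<in> ?F K. s [^] (p ^ e) \<otimes> k \<in> ?F J} \<subseteq> ?F {k \<in> K. s \<otimes> k \<in> J}" using Suc.IH by blast
  ultimately show ?case
    unfolding split[OF H] using frobenius_power_mono[OF _ ideal_subset_carrier[OF F[OF H]]] by blast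
qed

lemma frobenius_carrier: "frobenius_power R (carrier R) q = carrier R"
proof -
  have "\<one> [^] q \<in> frobenius_power R (carrier R) q" by (rule nat_pow_mem_frobenius_power) auto
  then show ?thesis using ideal.one_imp_carrier[OF frobenius_power_ideal[OF order_refl]] by simp
qed

text \<open>The colon formula puts 1 into \<open>(J : f)^[p]\<close>, which is contained in
  \<open>(J : f)\<close>.\<close>

lemma frobenius_power_reflects:
  assumes J: "ideal J R" and f: "f \<in> carrier R" "f [^] p \<in> frobenius_power R J p"
  shows "f \<in> J"
proof -
  have "\<one> \<in> frobenius_power R {k \<in> carrier R. f \<otimes> k \<in> J} p"
    using f frobenius_carrier by (intro frobenius_colon J oneideal) auto
  then have "\<one> \<in> {k \<in> carrier R. f \<otimes> k \<in> J}"
    using frobenius_power_le[OF colon_Int_ideal[OF J oneideal f(1)] p_pos] by blast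
  then show ?thesis using f by simp
qed

end

section \<open>Associated primes and symbolic powers\<close>

context noetherian_cring
begin

lemma associated_primeI:
  assumes J: "ideal J R" and y: "y \<in> carrier R" and P: "primeideal P R" "P = {r \<in> carrier R. y \<otimes> r \<in> J}"
  shows "P \<in> associated_primes R J"
proof -
  interpret J: ideal J R by (rule J)
  have "(J +> r) \<otimes>\<^bsub>R Quot J\<^esub> (J +> y) = \<zero>\<^bsub>R Quot J\<^esub> \<longleftrightarrow> y \<otimes> r \<in> J" if r: "r \<in> carrier R" for r
  proof -
    have "(J +> r) \<otimes>\<^bsub>R Quot J\<^esub> (J +> y) = J +> (r \<otimes> y)"
      using J.rcoset_mult_add[OF r y] by (simp add: FactRing_def)
    moreover have "J +> (r \<otimes> y) = J \<longleftrightarrow> r \<otimes> y \<in> J"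
      using J.rcos_const_imp_mem[of "r \<otimes> y"] a_rcos_zero[OF J, of "r \<otimes> y"] r y by blast
    moreover have "\<zero>\<^bsub>R Quot J\<^esub> = J" by (simp add: FactRing_def)
    ultimately show ?thesis using m_comm[OF r y] by simp
  qed
  moreover have "J +> y \<in> carrier (R Quot J)" using y a_rcosetsI[OF ideal_subset_carrier[OF J]] by (simp add: FactRing_def)
  ultimately show ?thesis unfolding associated_primes_def using P by (intro CollectI conjI bexI[of _ "J +> y"]) auto
qed

text \<open>Among the proper annihilators of residue classes that contain that of \<open>z\<close>,
  a maximal one is prime: for \<open>b\<close> outside \<open>ann y\<close> maximality gives
  \<open>ann (y \<otimes> b) = ann y\<close>.\<close>

lemma colon_subset_associated_prime:
  assumes J: "ideal J R" and z: "z \<in> carrier R" "z \<notin> J"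
  shows "\<exists>P\<in>associated_primes R J. {r \<in> carrier R. z \<otimes> r \<in> J} \<subseteq> P"
proof -
  define ann where "ann y = {r \<in> carrier R. y \<otimes> r \<in> J}" for y
  define C where "C = {ann y |y. y \<in> carrier R \<and> y \<notin> J \<and> ann z \<subseteq> ann y}"
  have "\<exists>K\<in>C. \<forall>L\<in>C. K \<subseteq> L \<longrightarrow> L = K"
  proof (rule exists_maximal_ideal)
    show "C \<noteq> {}" using z unfolding C_def by blast
    show "ideal I R" if "I \<in> C" for I using that colon_ideal[OF J] unfolding C_def ann_def by blast
  qed
  then obtain K where "K \<in> C" and K: "\<And>L. L \<in> C \<Longrightarrow> K \<subseteq> L \<Longrightarrow> L = K" by blast
  from \<open>K \<in> C\<close> obtain y where y: "y \<in> carrier R" "y \<notin> J" "ann z \<subseteq> ann y" and Ky: "K = ann y"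
    unfolding C_def by blast
  note max = K[unfolded Ky]
  have "primeideal (ann y) R"
  proof (rule primeidealI[OF _ is_cring])
    show "ideal (ann y) R" unfolding ann_def by (rule colon_ideal[OF J y(1)])
    have "\<one> \<notin> ann y" using y by (simp add: ann_def)
    then show "carrier R \<noteq> ann y" by blast
    fix a b assume ab: "a \<in> carrier R" "b \<in> carrier R" "a \<otimes> b \<in> ann y"
    show "a \<in> ann y \<or> b \<in> ann y"
    proof (rule disjCI)
      assume "b \<notin> ann y"
      then have yb: "y \<otimes> b \<in> carrier R" "y \<otimes> b \<notin> J" using y(1) ab(2) by (auto simp: ann_def)
      have sub: "ann y \<subseteq> ann (y \<otimes> b)"
      proof
        fix r assume "r \<in> ann y"
        then have r: "r \<in> carrier R" "y \<otimes> r \<in> J" by (auto simp: ann_def)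
        have "(y \<otimes> b) \<otimes> r = b \<otimes> (y \<otimes> r)" using y(1) ab(2) r by (simp add: m_ac)
        then show "r \<in> ann (y \<otimes> b)" using r ideal_lmult[OF J r(2) ab(2)] by (simp add: ann_def)
      qed
      have "ann z \<subseteq> ann (y \<otimes> b)" using y(3) sub by (rule order_trans)
      then have "ann (y \<otimes> b) \<in> C" using yb by (auto simp: C_def)
      then have "ann (y \<otimes> b) = ann y" using sub by (rule max)
      moreover have "a \<in> ann (y \<otimes> b)"
      proof -
        have "(y \<otimes> b) \<otimes> a = y \<otimes> (a \<otimes> b)" using y(1) ab by (simp add: m_ac)
        then show ?thesis using ab by (simp add: ann_def)
      qed
      ultimately show "a \<in> ann y" by simp
    qed
  qed
  then have "ann y \<in> associated_primes R J" by (rule associated_primeI[OF J y(1)]) (simp add: ann_def)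
  then show ?thesis using y(3) unfolding ann_def by blast
qed

end

context regular_frobenius_ring
begin

text \<open>The associated primes of \<open>J\<^sup>[\<^sup>q\<^sup>]\<close> are contained in associated primes of \<open>J\<close>: if \<open>b\<close> is the
  annihilator of \<open>x\<close> modulo \<open>J\<^sup>[\<^sup>q\<^sup>]\<close>, then \<open>x \<in> (J : b)\<^sup>[\<^sup>q\<^sup>]\<close>, and \<open>(J : b) = J\<close> unless \<open>b\<close> is contained in an
  associated prime of \<open>J\<close>.\<close>

lemma frobenius_power_saturated:
  assumes J: "ideal J R" and x: "x \<in> carrier R"
    and loc: "\<And>P. P \<in> associated_primes R J \<Longrightarrow> \<exists>s\<in>carrier R - P. s \<otimes> x \<in> frobenius_power R J (p ^ e)"
  shows "x \<in> frobenius_power R J (p ^ e)"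
proof -
  define B where "B = {r \<in> carrier R. x \<otimes> r \<in> frobenius_power R J (p ^ e)}"
  note Jq = frobenius_power_ideal[OF ideal_subset_carrier[OF J]]
  have B: "ideal B R" unfolding B_def by (rule colon_ideal[OF Jq x])
  obtain A where A: "A \<subseteq> carrier R" "finite A" "B = Idl A" using finetely_gen[OF B] by auto
  \<comment> \<open>For the generating set \<open>A\<close> of \<open>B\<close> this is
    \<open>(J : B)\<close>; it is built up by one intersection per generator.\<close>
  define K where "K A = {k \<in> carrier R. \<forall>s\<in>A. s \<otimes> k \<in> J}" for A
  have "ideal (K A') R \<and> x \<in> frobenius_power R (K A') (p ^ e)" if "A' \<subseteq> A" for A'
    using finite_subset[OF that A(2)] that
  proof (induction A' rule: finite_induct)
    case empty
    then show ?case using x oneideal frobenius_carrier by (simp add: K_def)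
  next
    case (insert s A')
    then have K: "ideal (K A') R" "x \<in> frobenius_power R (K A') (p ^ e)" by auto
    have "s \<in> B" using insert.prems mem_Idl[OF A(1)] A(3) by blast
    then have s: "s \<in> carrier R" "x \<otimes> s \<in> frobenius_power R J (p ^ e)" by (auto simp: B_def)
    obtain n where n: "p ^ e = Suc n" using p_pos by (metis gr0_conv_Suc zero_less_power)
    have "s [^] Suc n \<otimes> x = s [^] n \<otimes> (x \<otimes> s)" using s(1) x by (simp add: m_ac)
    then have "s [^] (p ^ e) \<otimes> x \<in> frobenius_power R J (p ^ e)"
      using ideal_lmult[OF Jq s(2), of "s [^] n"] s(1) n by simp
    moreover have eq: "K (Set.insert s A') = {k \<in> K A'. s \<otimes> k \<in> J}" by (auto simp: K_def)
    ultimately show ?case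
      unfolding eq using frobenius_colon_iterate[OF J K(1) s(1) K(2)] colon_Int_ideal[OF J K(1) s(1)] by blast
  qed
  then have K: "ideal (K A) R" "x \<in> frobenius_power R (K A) (p ^ e)" by auto
  \<comment> \<open>An element \<open>z\<close> of \<open>(J : B)\<close> outside \<open>J\<close>
    would put \<open>B\<close> inside an associated prime of \<open>J\<close>, whereas
    \<open>loc\<close> gives an element of \<open>B\<close> outside each of them.\<close>
  have "K A \<subseteq> J"
  proof
    fix z assume z: "z \<in> K A"
    have zc: "z \<in> carrier R" using z by (simp add: K_def)
    show "z \<in> J"
    proof (rule ccontr)
      assume "z \<notin> J"
      then obtain P where P: "P \<in> associated_primes R J" "{r \<in> carrier R. z \<otimes> r \<in> J} \<subseteq> P"
        using colon_subset_associated_prime[OF J zc] by blast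
      have "A \<subseteq> {r \<in> carrier R. z \<otimes> r \<in> J}" using z A(1) zc by (auto simp: K_def m_comm)
      then have "B \<subseteq> {r \<in> carrier R. z \<otimes> r \<in> J}"
        unfolding A(3) by (rule genideal_minimal[OF colon_ideal[OF J zc]])
      moreover obtain s where s: "s \<in> carrier R - P" "s \<otimes> x \<in> frobenius_power R J (p ^ e)"
        using loc[OF P(1)] by blast
      moreover have "s \<in> B" using s x by (simp add: B_def m_comm)
      ultimately show False using P(2) by blast
    qed
  qed
  then show ?thesis using K(2) frobenius_power_mono[OF _ ideal_subset_carrier[OF J]] by blast
qed

lemma symbolic_power_subset_frobenius_power:
  assumes J: "ideal J R" and I: "ideal I R" and rad: "J \<subseteq> ideal_radical R I"
  shows "\<exists>D. \<forall>e r. D * p ^ e < r \<longrightarrow> symbolic_power R J r \<subseteq> frobenius_power R I (p ^ e)"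
proof -
  obtain A where A: "A \<subseteq> carrier R" "finite A" "J = Idl A" using finetely_gen[OF J] by auto
  have "\<exists>n::nat. y [^] n \<in> I" if "y \<in> J" for y using rad that by (auto simp: ideal_radical_def)
  then obtain N where N: "ideal_power R J N \<subseteq> I" by (rule ideal_power_subset_radical[OF J I])
  \<comment> \<open>A power of \<open>p\<close> of size at least \<open>N\<close> is wanted, so that
    \<open>f^q0 \<in> J^N\<close>; \<open>p^N\<close> exceeds \<open>N\<close> because
    \<open>p\<close> is at least 2.\<close>
  define q0 where "q0 = p ^ N"
  have "N < q0" unfolding q0_def using prime_ge_2_nat[OF p_prime] by (intro power_gt_expt) auto
  have JI: "frobenius_power R J q0 \<subseteq> I"
  proof (rule frobenius_power_subset[OF I])
    fix f assume "f \<in> J"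
    then have "f [^] q0 \<in> ideal_power R J q0" by (rule nat_pow_mem_ideal_power[OF J])
    then show "f [^] q0 \<in> I" using ideal_power_mono[OF J, of N q0] \<open>N < q0\<close> N by auto
  qed
  have "symbolic_power R J r \<subseteq> frobenius_power R I (p ^ e)" if r: "card A * q0 * p ^ e < r" for e r
  proof -
    have Jc: "J \<subseteq> carrier R" by (rule ideal_subset_carrier[OF J])
    have q: "q0 * p ^ e = p ^ (N + e)" by (simp add: q0_def power_add)
    \<comment> \<open>Pigeonhole: in a product of \<open>r\<close> generators some generator occurs
      at least \<open>p^(N+e)\<close> times.\<close>
    have "ideal_power R (Idl A) r \<subseteq> frobenius_power R J (p ^ (N + e))"
    proof (rule ideal_power_subset[where e = "\<lambda>_. p ^ (N + e)", OF A(2,1) frobenius_power_ideal[OF Jc]])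
      show "g [^] (p ^ (N + e)) \<in> frobenius_power R J (p ^ (N + e))" if "g \<in> A" for g
        using nat_pow_mem_frobenius_power[OF Jc] mem_Idl[OF A(1) that] A(3) by blast
      show "(\<Sum>_\<in>A. p ^ (N + e)) < r" using r by (simp add: q[symmetric] mult.assoc)
    qed
    then have Jr: "ideal_power R J r \<subseteq> frobenius_power R J (p ^ (N + e))" using A(3) by simp
    \<comment> \<open>At each associated prime of \<open>J\<close> the symbolic power is the
      ordinary one up to a denominator, which \<open>frobenius_power_saturated\<close>
      removes.\<close>
    have "x \<in> frobenius_power R J (p ^ (N + e))" if "x \<in> symbolic_power R J r" for x
      using that Jr unfolding symbolic_power_mem[OF J] by (intro frobenius_power_saturated[OF J]) blast+
    moreover have "frobenius_power R J (p ^ (N + e)) = frobenius_power R (frobenius_power R J q0) (p ^ e)"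
      using frobenius_power_add_exp[OF Jc, of q0 e] by (simp add: q)
    moreover have "\<dots> \<subseteq> frobenius_power R I (p ^ e)"
      by (rule frobenius_power_mono[OF JI ideal_subset_carrier[OF I]])
    ultimately show ?thesis by blast
  qed
  then show ?thesis by blast
qed

section \<open>Existence of the threshold\<close>

lemma filtration_pow:
  assumes A: "ideal_filtration R A" and f: "f \<in> A r" shows "f [^] (k::nat) \<in> A (k * r)"
proof (induction k)
  case 0
  then show ?case using A by (simp add: ideal_filtration_def)
next
  case (Suc k)
  then have "f [^] k \<otimes> f \<in> A (k * r) \<cdot> A r" using f by (intro ideal_prod.prod)
  moreover have "A (k * r) \<cdot> A r \<subseteq> A (Suc k * r)"
    using A by (simp add: ideal_filtration_def add.commute[of r])
  ultimately show ?case by auto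
qed

lemma threshold_existsI:
  assumes A: "ideal_filtration R A" and I: "ideal I R" "I \<noteq> carrier R"
    and D: "\<And>e r. D * p ^ e < r \<Longrightarrow> A r \<subseteq> frobenius_power R I (p ^ e)"
  shows "threshold_exists R p I A"
proof -
  define N where "N e = {r. \<not> A r \<subseteq> frobenius_power R I (p ^ e)}" for e
  define n where "n e = Max (N e)" for e
  have q: "0 < p ^ e" for e using p_pos by simp
  note Ic = ideal_subset_carrier[OF I(1)]
  have le: "r \<le> D * p ^ e" if "r \<in> N e" for e r using that D[of e r] by (force simp: N_def)
  then have "N e \<subseteq> {..D * p ^ e}" for e by blast
  then have fin: "finite (N e)" for e by (rule finite_subset) simp
  have "A 0 = carrier R" using A by (simp add: ideal_filtration_def)
  \<comment> \<open>\<open>A 0\<close> is all of \<open>R\<close> and \<open>I^[q]\<close> is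
    proper. So \<open>N e\<close> is nonempty as well as bounded, and the supremum in
    \<open>nu\<close> is a maximum with a witness.\<close>
  then have "0 \<in> N e" for e
    unfolding N_def using frobenius_power_le[OF I(1) q, of e] I Ic by auto
  then have n: "n e \<in> N e" for e unfolding n_def using Max_in[OF fin] by blast
  have nu: "nu R I A (p ^ e) = enat (n e)" for e
  proof -
    have "nu R I A (p ^ e) = Sup (enat ` N e)" unfolding nu_def N_def by (rule arg_cong[where f = Sup]) auto
    also have "\<dots> = enat (n e)"
    proof (rule antisym)
      show "Sup (enat ` N e) \<le> enat (n e)" using fin by (intro Sup_least) (auto simp: n_def)
      show "enat (n e) \<le> Sup (enat ` N e)" using n by (intro Sup_upper) auto
    qed
    finally show ?thesis .
  qed
  \<comment> \<open>A witness \<open>f\<close> for \<open>n e\<close> has \<open>f^p\<close> in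
    \<open>A (p * n e)\<close> by the filtration property and outside the next Frobenius power by
    \<open>frobenius_power_reflects\<close>.\<close>
  have step: "p * n e \<le> n (Suc e)" for e
  proof -
    obtain f where f: "f \<in> A (n e)" "f \<notin> frobenius_power R I (p ^ e)" using n[of e] by (auto simp: N_def)
    have "ideal (A (n e)) R" using A by (simp add: ideal_filtration_def)
    then have fc: "f \<in> carrier R" using f(1) by (rule ideal_carrier)
    have "f [^] p \<notin> frobenius_power R I (p ^ Suc e)"
      using frobenius_power_reflects[OF frobenius_power_ideal[OF Ic] fc] f(2)
        frobenius_power_mult[OF Ic, of "p ^ e"] by (auto simp: mult.commute)
    then have "p * n e \<in> N (Suc e)" using filtration_pow[OF A f(1), of p] by (auto simp: N_def)
    then show ?thesis unfolding n_def[of "Suc e"] by (rule Max_ge[OF fin])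
  qed
  define ratio where "ratio e = real (n e) / real (p ^ e)" for e
  have "incseq ratio"
  proof (rule incseq_SucI)
    fix e
    have "real p * real (n e) \<le> real (n (Suc e))" using step[of e] by (metis of_nat_le_iff of_nat_mult)
    then show "ratio e \<le> ratio (Suc e)" using p_pos by (simp add: ratio_def field_simps)
  qed
  moreover have "ratio e \<le> real D" for e
  proof -
    have "real (n e) \<le> real D * real (p ^ e)" using le[OF n[of e]] by (metis of_nat_le_iff of_nat_mult)
    then show ?thesis unfolding ratio_def using q[of e] by (simp add: divide_le_eq)
  qed
  ultimately obtain l where "ratio \<longlonglongrightarrow> l" using incseq_convergent[of ratio "real D"] by blast
  then have "(\<lambda>e. ereal (ratio e)) \<longlonglongrightarrow> ereal l" by simp
  then have "has_threshold R p I A l"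
    unfolding has_threshold_def nu ratio_def using p_pos by simp
  then show ?thesis unfolding threshold_exists_def ..
qed

end

theorem theorem3p17:
  fixes R (structure) and p :: nat and \<aa> I :: "'a set"
  assumes "regular_ring R"
    and "Factorial_Ring.prime p"
    and "has_characteristic R p"
    and "ideal \<aa> R" and "\<aa> \<noteq> {\<zero>}" and "\<aa> \<noteq> carrier R"
    and "ideal I R" and "I \<noteq> {\<zero>}" and "I \<noteq> carrier R"
    and "\<aa> \<subseteq> ideal_radical R I"
  shows "threshold_exists R p I (symbolic_power R \<aa>)"
proof -
  interpret regular_ring R by fact
  have "add_pow R p \<one> = \<zero>" using assms(3) by (simp add: has_characteristic_def)
  then interpret regular_frobenius_ring R p by unfold_locales (rule assms(2))
  obtain D where "\<And>e r. D * p ^ e < r \<Longrightarrow> symbolic_power R \<aa> r \<subseteq> frobenius_power R I (p ^ e)"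
    using symbolic_power_subset_frobenius_power[OF assms(4,7,10)] by metis
  then show ?thesis
    by (rule threshold_existsI[OF symbolic_power_filtration[OF assms(4)] assms(7,9)])
qed

end
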